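(* Let $u\in W^{1,2}(\mathbb{B}^3;\mathbb{S}^2)$ be such that there exists $\eta\in L^2\big(\mathbb{B}^3;\bigwedge^1(\mathbb{R}^3)^*\big)$ with $$d\eta=u^*\omega_{\mathbb{S}^2}\quad\text{in the sense of distributions on } \mathbb{B}^3.$$ Then there exists $\hat u\in W^{1,2}(\mathbb{B}^3;\mathbb{S}^3)$ such that $$u=h\circ\hat u \quad\text{(almost everywhere on } \mathbb{B}^3),$$ where $h\colon\mathbb{S}^3\to\mathbb{S}^2$ is the Hopf fibration.
   Context: $\mathbb{B}^3$ is the unit ball of $\mathbb{R}^3$, and $\mathbb{S}^n\subset\mathbb{R}^{n+1}$ is the unit sphere. $W^{1,2}(\mathbb{B}^3;\mathbb{S}^n)$ denotes the set of maps $u\in W^{1,2}(\mathbb{B}^3;\mathbb{R}^{n+1})$ with $|u|=1$ almost everywhere. $L^2(\mathbb{B}^3;\bigwedge^1(\mathbb{R}^3)^* )$ is the space of $1$-forms on $\mathbb{B}^3$ with $L^2$ coefficients. The Hopf fibration $h\colon\mathbb{S}^3\subset\mathbb{C}^2\to\mathbb{S}^2\subset\mathbb{C}\times\mathbb{R}\cong\mathbb{R}^3$ is $h(z,w)=(2z\bar w,\,|z|^2-|w|^2)$. The volume form on $\mathbb{S}^2$ is $\omega_{\mathbb{S}^2}=x^1dx^2\wedge dx^3+x^2dx^3\wedge dx^1+x^3dx^1\wedge dx^2$ (restricted to $\mathbb{S}^2$). For $u=(u^1,u^2,u^3)\in W^{1,2}(\mathbb{B}^3;\mathbb{S}^2)$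 its pullback is the $2$-form with $L^1$ coefficients $$u^*\omega_{\mathbb{S}^2}=u^1du^2\wedge du^3+u^2du^3\wedge du^1+u^3du^1\wedge du^2=\sum_{1\le j<\ell\le 3}u\cdot(\partial_ju\times\partial_\ell u)\,dx^j\wedge dx^\ell,$$ computed with weak derivatives. The identity $d\eta=u^*\omega_{\mathbb{S}^2}$ in the sense of distributions means that $\int_{\mathbb{B}^3}\eta\wedge d\varphi=\int_{\mathbb{B}^3}u^*\omega_{\mathbb{S}^2}\wedge\varphi$ for every smooth $1$-form $\varphi$ compactly supported in the interior of $\mathbb{B}^3$. *)

theory Defs
  imports "HOL-Analysis.Analysis"
begin

section \<open>Test functions and weak derivatives\<close>

primrec Ck :: "nat \<Rightarrow> ('a::euclidean_space \<Rightarrow> 'b::real_normed_vector) \<Rightarrow> bool" where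
  "Ck 0 f \<longleftrightarrow> continuous_on UNIV f"
| "Ck (Suc k) f \<longleftrightarrow> (\<forall>x. f differentiable (at x)) \<and>
     (\<forall>b\<in>Basis. Ck k (\<lambda>x. frechet_derivative f (at x) b))"

definition smooth :: "('a::euclidean_space \<Rightarrow> 'b::real_normed_vector) \<Rightarrow> bool" where
  "smooth f \<longleftrightarrow> (\<forall>k. Ck k f)"

text \<open>The support is a compact subset of \<open>\<Omega>\<close>; since \<open>\<Omega>\<close> is open in all uses, this is the
  same as a smooth function on \<open>\<Omega>\<close> with compact support, extended by zero.\<close>

definition test_function :: "'a::euclidean_space set \<Rightarrow> ('a \<Rightarrow> 'b::real_normed_vector) \<Rightarrow> bool" where
  "test_function \<Omega> \<phi> \<longleftrightarrow>
     smooth \<phi> \<and> compact (closure {x. \<phi> x \<noteq> 0}) \<and> closure {x. \<phi> x \<noteq> 0} \<subseteq> \<Omega>"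

definition locally_integrable_on ::
    "('a::euclidean_space \<Rightarrow> 'b::euclidean_space) \<Rightarrow> 'a set \<Rightarrow> bool" (infixr \<open>locally'_integrable'_on\<close> 46) where
  "f locally_integrable_on \<Omega> \<longleftrightarrow>
     (\<forall>K. compact K \<and> K \<subseteq> \<Omega> \<longrightarrow> set_integrable lebesgue K f)"

definition has_weak_pderiv ::
    "'a::euclidean_space set \<Rightarrow> 'a \<Rightarrow> ('a \<Rightarrow> 'b::euclidean_space) \<Rightarrow> ('a \<Rightarrow> 'b) \<Rightarrow> bool" where
  "has_weak_pderiv \<Omega> b u v \<longleftrightarrow>
     u locally_integrable_on \<Omega> \<and> v locally_integrable_on \<Omega> \<and>
     (\<forall>\<phi>::'a \<Rightarrow> real. test_function \<Omega> \<phi> \<longrightarrow>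
        (LINT x:\<Omega>|lebesgue. frechet_derivative \<phi> (at x) b *\<^sub>R u x) =
        - (LINT x:\<Omega>|lebesgue. \<phi> x *\<^sub>R v x))"

text \<open>A representative of the weak partial derivative of \<open>u\<close> in direction \<open>b\<close>. On an open
  \<open>\<Omega>\<close> the weak derivative is unique up to null sets, so no integral below depends
  on the choice.\<close>

definition weak_pderiv ::
    "'a::euclidean_space set \<Rightarrow> 'a \<Rightarrow> ('a \<Rightarrow> 'b::euclidean_space) \<Rightarrow> 'a \<Rightarrow> 'b" where
  "weak_pderiv \<Omega> b u = (SOME v. has_weak_pderiv \<Omega> b u v)"


section \<open>Sobolev maps into spheres\<close>

definition L2_on :: "'a::euclidean_space set \<Rightarrow> ('a \<Rightarrow> 'b::euclidean_space) \<Rightarrow> bool" where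
  "L2_on \<Omega> f \<longleftrightarrow>
     set_borel_measurable lebesgue \<Omega> f \<and> set_integrable lebesgue \<Omega> (\<lambda>x. (norm (f x))\<^sup>2)"

definition W12 :: "'a::euclidean_space set \<Rightarrow> ('a \<Rightarrow> 'b::euclidean_space) \<Rightarrow> bool" where
  "W12 \<Omega> u \<longleftrightarrow> L2_on \<Omega> u \<and> (\<forall>b\<in>Basis. \<exists>v. has_weak_pderiv \<Omega> b u v \<and> L2_on \<Omega> v)"

text \<open>Maps into the unit sphere of the Euclidean space \<open>'b\<close>: \<open>\<S>\<^sup>2\<close> for
  \<open>'b = real^3\<close>, and \<open>\<S>\<^sup>3\<close> for \<open>'b = complex \<times> complex\<close>.\<close>

definition W12_sphere :: "'a::euclidean_space set \<Rightarrow> ('a \<Rightarrow> 'b::euclidean_space) \<Rightarrow> bool" where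
  "W12_sphere \<Omega> u \<longleftrightarrow> W12 \<Omega> u \<and> (AE x in lebesgue. x \<in> \<Omega> \<longrightarrow> u x \<in> sphere 0 1)"

abbreviation B3 :: "(real^3) set" where
  "B3 \<equiv> ball 0 1"


section \<open>Differential forms on \<open>\<real>\<^sup>3\<close>\<close>

text \<open>A 1-form \<open>\<eta> = (\<Sum>i. \<eta>\<^sub>i dx\<^sup>i)\<close> is given by its coefficients \<open>\<eta> x $ i\<close>. A 2-form \<open>\<alpha>\<close> is given
  by its values \<open>\<alpha> x $ j $ l\<close> on the pairs \<open>(e\<^sub>j, e\<^sub>l)\<close>, an antisymmetric matrix, so
  that \<open>\<alpha> = (\<Sum>j<l. \<alpha>\<^sub>j\<^sub>l dx\<^sup>j \<and> dx\<^sup>l)\<close>. A 3-form is given by its coefficient of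
  \<open>dx\<^sup>1 \<and> dx\<^sup>2 \<and> dx\<^sup>3\<close>, which is also the function one integrates.\<close>

type_synonym form1 = "real^3 \<Rightarrow> real^3"
type_synonym form2 = "real^3 \<Rightarrow> real^3^3"
type_synonym form3 = "real^3 \<Rightarrow> real"

definition ext_deriv :: "form1 \<Rightarrow> form2" where
  "ext_deriv \<phi> x = (\<chi> j l. frechet_derivative (\<lambda>y. \<phi> y $ l) (at x) (axis j 1)
                        - frechet_derivative (\<lambda>y. \<phi> y $ j) (at x) (axis l 1))"

definition wedge12 :: "form1 \<Rightarrow> form2 \<Rightarrow> form3" where
  "wedge12 \<eta> \<alpha> x = \<eta> x $ 1 * \<alpha> x $ 2 $ 3 - \<eta> x $ 2 * \<alpha> x $ 1 $ 3 + \<eta> x $ 3 * \<alpha> x $ 1 $ 2"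

definition wedge21 :: "form2 \<Rightarrow> form1 \<Rightarrow> form3" where
  "wedge21 \<alpha> \<phi> x = \<alpha> x $ 1 $ 2 * \<phi> x $ 3 - \<alpha> x $ 1 $ 3 * \<phi> x $ 2 + \<alpha> x $ 2 $ 3 * \<phi> x $ 1"

text \<open>\<open>omega_S2 p v w\<close> is the value of
  \<open>x\<^sup>1 dx\<^sup>2 \<and> dx\<^sup>3 + x\<^sup>2 dx\<^sup>3 \<and> dx\<^sup>1 + x\<^sup>3 dx\<^sup>1 \<and> dx\<^sup>2\<close> at the point \<open>p\<close> on the vectors \<open>v\<close>, \<open>w\<close>.\<close>

definition omega_S2 :: "real^3 \<Rightarrow> real^3 \<Rightarrow> real^3 \<Rightarrow> real" where
  "omega_S2 p v w =
     p $ 1 * (v $ 2 * w $ 3 - v $ 3 * w $ 2) +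
     p $ 2 * (v $ 3 * w $ 1 - v $ 1 * w $ 3) +
     p $ 3 * (v $ 1 * w $ 2 - v $ 2 * w $ 1)"

definition pullback_omega_S2 :: "(real^3) set \<Rightarrow> (real^3 \<Rightarrow> real^3) \<Rightarrow> form2" where
  "pullback_omega_S2 \<Omega> u x =
     (\<chi> j l. omega_S2 (u x) (weak_pderiv \<Omega> (axis j 1) u x) (weak_pderiv \<Omega> (axis l 1) u x))"

text \<open>\<open>d\<eta> = \<alpha>\<close> in the sense of distributions on \<open>\<Omega>\<close>. There is no sign, because
  \<open>d(\<eta> \<and> \<phi>) = d\<eta> \<and> \<phi> - \<eta> \<and> d\<phi>\<close> for 1-forms.\<close>

definition distrib_ext_deriv :: "(real^3) set \<Rightarrow> form1 \<Rightarrow> form2 \<Rightarrow> bool" where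
  "distrib_ext_deriv \<Omega> \<eta> \<alpha> \<longleftrightarrow>
     (\<forall>\<phi>::form1. test_function \<Omega> \<phi> \<longrightarrow>
        (LINT x:\<Omega>|lebesgue. wedge12 \<eta> (ext_deriv \<phi>) x) =
        (LINT x:\<Omega>|lebesgue. wedge21 \<alpha> \<phi> x))"


section \<open>The Hopf fibration\<close>

definition hopf :: "complex \<times> complex \<Rightarrow> complex \<times> real" where
  "hopf = (\<lambda>(z, w). (2 * z * cnj w, (cmod z)\<^sup>2 - (cmod w)\<^sup>2))"

definition CR_to_R3 :: "complex \<times> real \<Rightarrow> real^3" where
  "CR_to_R3 = (\<lambda>(a, t). vector [Re a, Im a, t])"

end

theory Submission
  imports Defs
begin

text \<open>Write \<open>A\<^sub>j = (u \<times> \<partial>\<^sub>j u - \<eta>\<^sub>j u) / 2\<close>. Since \<open>|u| = 1\<close>, the map \<open>u\<close> satisfies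
  \<open>\<partial>\<^sub>j u = 2 A\<^sub>j \<times> u\<close>, and \<open>d\<eta> = u\<^sup>*\<omega>\<close> says exactly that the square integrable \<open>su(2)\<close>-connection
  \<open>A\<close> is flat. A parallel spinor, that is, a solution of \<open>\<partial>\<^sub>j v = A\<^sub>j v\<close>, has constant norm, and its
  Hopf image obeys the same linear equation as \<open>u\<close>; so it lifts \<open>u\<close> if it does so at one point.
  To construct it, mollify \<open>u\<close>, its derivatives and \<open>\<eta>\<close>; the curvature of the resulting smooth
  connections and the failure of the mollified map to be parallel tend to \<open>0\<close> in \<open>L\<^sup>1\<close>. Transport a
  spinor over \<open>u z\<close> along the segments from \<open>z\<close>. As \<open>su(2)\<close> acts by skew operators, all errors are
  bounded by integrals of \<open>L\<^sup>1\<close>-small functions over segments, with no exponential factor. For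
  almost every \<open>z\<close> these segment integrals are small in \<open>L\<^sup>1\<close> as functions of the endpoint, so the
  transported spinors converge along a subsequence, and the limit is the lift.\<close>

section \<open>Spinors and the Hopf map\<close>

text \<open>The equation \<open>\<partial>\<^sub>j u = 2 A\<^sub>j \<times> u\<close> fixes the part
  of \<open>A\<^sub>j\<close> orthogonal to \<open>u\<close>, namely
  \<open>(u \<times> \<partial>\<^sub>j u) / 2\<close>. A multiple of \<open>u\<close> may be added
  freely: it rotates about \<open>u\<close>, along the fibre of the Hopf map. The curvature of the
  orthogonal part is half the coefficient of the pulled back area form times \<open>u\<close>, so it
  points in exactly this free direction, and the term with \<open>\<eta>\<close> removes it. Square
  integrability of \<open>A\<close> serves twice: the quadratic part of the curvature is integrable,
  and the derivative \<open>A v\<close> of the lift is in L^2. The obstacle is that an L^2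
  connection has no transport along curves, while a Gronwall estimate for its mollifications would
  produce exponentials of segment integrals of \<open>|A|\<close>, which L^2 bounds do not make
  integrable. Hence the insistence on skew operators. The curvature is also nonlinear, so mollifying
  does not preserve flatness; it becomes flat in the limit because all quadratic expressions are
  dominated by the mollification of one integrable function, \<open>1 + |Du|^2 + |\<eta>|^2\<close>
  on the ball.\<close>

lemma vec3_eq_iff: "(x::'a^3) = y \<longleftrightarrow> x $ 1 = y $ 1 \<and> x $ 2 = y $ 2 \<and> x $ 3 = y $ 3"
  by (simp add: vec_eq_iff forall_3)

lemma norm_vec3: "norm (x::real^3) = sqrt ((x$1)\<^sup>2 + (x$2)\<^sup>2 + (x$3)\<^sup>2)"
  by (simp add: norm_eq_sqrt_inner inner_vec_def sum_3 power2_eq_square)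

lemma norm_complex_pair:
  "norm (v::complex \<times> complex) =
     sqrt ((Re (fst v))\<^sup>2 + (Im (fst v))\<^sup>2 + (Re (snd v))\<^sup>2 + (Im (snd v))\<^sup>2)"
  by (simp add: norm_prod_def cmod_power2 add.assoc)

text \<open>\<open>spin a\<close> is \<open>\<i> (a \<bullet> \<sigma>)\<close> for Pauli matrices \<open>\<sigma>\<close>, with signs fitted to the Hopf map.\<close>

definition spin :: "real^3 \<Rightarrow> complex \<times> complex \<Rightarrow> complex \<times> complex" where
  "spin a v =
     (\<i> * (of_real (a$3) * fst v + Complex (a$1) (a$2) * snd v),
      \<i> * (Complex (a$1) (- a$2) * fst v - of_real (a$3) * snd v))"

text \<open>\<open>spin a\<close> squares to \<open>- |a|^2\<close>, so it is \<open>|a|\<close>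
  times an isometry. Estimates on spinors therefore involve no extra constant.\<close>

lemma norm_spin: "norm (spin a v) = norm a * norm v"
  unfolding norm_complex_pair norm_vec3 spin_def real_sqrt_mult[symmetric]
  by (rule arg_cong[where f=sqrt]) (simp add: algebra_simps power2_eq_square)

lemma bounded_bilinear_spin: "bounded_bilinear spin"
proof
  show "\<exists>K. \<forall>a v. norm (spin a v) \<le> norm a * norm v * K"
    by (rule exI[of _ 1]) (simp add: norm_spin)
qed (simp_all add: spin_def prod_eq_iff complex_eq_iff algebra_simps)

interpretation spin: bounded_bilinear spin
  by (rule bounded_bilinear_spin)

lemma inner_spin_self: "v \<bullet> spin a v = 0"
  by (simp add: spin_def inner_prod_def inner_complex_def algebra_simps)

text \<open>In this normalisation the bracket of \<open>su(2)\<close> is twice the cross product.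
  This is the origin of the factor 2 in front of \<open>cross3\<close> in every curvature
  below.\<close>

lemma spin_commutator: "spin a (spin b v) - spin b (spin a v) = spin (2 *\<^sub>R cross3 a b) v"
  by (simp add: spin_def cross3_def prod_eq_iff complex_eq_iff algebra_simps)

definition hopf3 :: "complex \<times> complex \<Rightarrow> real^3" where
  "hopf3 v = CR_to_R3 (hopf v)"

lemma hopf3_components:
  "hopf3 v $ 1 = 2 * (Re (fst v) * Re (snd v) + Im (fst v) * Im (snd v))"
  "hopf3 v $ 2 = 2 * (Im (fst v) * Re (snd v) - Re (fst v) * Im (snd v))"
  "hopf3 v $ 3 = (Re (fst v))\<^sup>2 + (Im (fst v))\<^sup>2 - (Re (snd v))\<^sup>2 - (Im (snd v))\<^sup>2"
  by (simp_all add: hopf3_def CR_to_R3_def hopf_def split_beta cmod_power2 algebra_simps)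

text \<open>The polarisation of the quadratic map \<open>hopf3\<close>. With it, the calculus of
  bounded bilinear maps gives continuity and the derivative.\<close>

definition hopf_polar :: "complex \<times> complex \<Rightarrow> complex \<times> complex \<Rightarrow> real^3" where
  "hopf_polar v w = vector
     [Re (fst v) * Re (snd w) + Im (fst v) * Im (snd w) + Re (fst w) * Re (snd v) + Im (fst w) * Im (snd v),
      Im (fst v) * Re (snd w) - Re (fst v) * Im (snd w) + Im (fst w) * Re (snd v) - Re (fst w) * Im (snd v),
      Re (fst v) * Re (fst w) + Im (fst v) * Im (fst w) - Re (snd v) * Re (snd w) - Im (snd v) * Im (snd w)]"

lemma hopf3_eq_polar: "hopf3 v = hopf_polar v v"
  by (simp add: vec3_eq_iff hopf3_components hopf_polar_def power2_eq_square)

lemma bounded_bilinear_hopf_polar: "bounded_bilinear hopf_polar"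
  unfolding bilinear_conv_bounded_bilinear[symmetric] bilinear_def
  by (intro conjI allI linearI) (simp_all add: hopf_polar_def vec3_eq_iff algebra_simps)

lemma continuous_on_hopf3: "continuous_on UNIV hopf3"
  unfolding hopf3_eq_polar[abs_def]
  by (rule bounded_bilinear.continuous_on[OF bounded_bilinear_hopf_polar]) (auto intro: continuous_intros)

text \<open>The left-hand side is the derivative of \<open>hopf3\<close> at \<open>v\<close> in the
  direction \<open>spin a v\<close>. The identity is the infinitesimal equivariance under the double
  cover of the rotation group by SU(2), whence the factor 2.\<close>

lemma hopf3_equivariant: "hopf_polar v (spin a v) + hopf_polar (spin a v) v = 2 *\<^sub>R cross3 a (hopf3 v)"
  by (simp add: vec3_eq_iff hopf3_components hopf_polar_def cross3_def spin_def algebra_simps power2_eq_square)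

lemma hopf3_has_vector_derivative:
  assumes "(v has_vector_derivative spin a (v t)) (at t within S)"
  shows "((\<lambda>t. hopf3 (v t)) has_vector_derivative 2 *\<^sub>R cross3 a (hopf3 (v t))) (at t within S)"
  using bounded_bilinear.has_vector_derivative[OF bounded_bilinear_hopf_polar assms assms]
  by (simp add: hopf3_equivariant hopf3_eq_polar)

text \<open>An explicit preimage with real positive first coordinate, available away from the south
  pole; the pole itself is the image of \<open>(0, 1)\<close>.\<close>

lemma hopf3_surj:
  assumes "norm y = 1"
  obtains v where "norm v = 1" "hopf3 v = y"
proof -
  from assms have y: "(y$1)\<^sup>2 + (y$2)\<^sup>2 + (y$3)\<^sup>2 = 1"
    by (simp add: norm_vec3)
  show ?thesis
  proof (cases "y $ 3 = - 1")
    case True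
    with y have "y$1 = 0" "y$2 = 0" by (auto simp: add_nonneg_eq_0_iff)
    with True have "hopf3 (0, 1) = y" by (simp add: vec3_eq_iff hopf3_components)
    then show ?thesis by (intro that[of "(0, 1)"]) (simp_all add: norm_complex_pair)
  next
    case False
    have "(y$3)\<^sup>2 \<le> 1" using y by (smt (verit) zero_le_power2)
    then have "- 1 \<le> y$3" using abs_le_square_iff[of "y$3" 1] by simp
    with False have pos: "0 < 1 + y$3" by simp
    \<comment> \<open>On the unit sphere \<open>|z|^2 - |w|^2 = y$3\<close> and
      \<open>|z|^2 + |w|^2 = 1\<close> force \<open>|z|^2 = (1 + y$3) / 2\<close>. With
      \<open>z\<close> real, \<open>w\<close> is then determined by
      \<open>2 z cnj w = y$1 + i y$2\<close>.\<close>
    define r where "r = sqrt ((1 + y$3) / 2)"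
    have r: "r > 0" "r\<^sup>2 = (1 + y$3) / 2" using pos by (simp_all add: r_def)
    define v where "v = (complex_of_real r, Complex (y$1 / (2 * r)) (- y$2 / (2 * r)))"
    have 1: "(y$1)\<^sup>2 + (y$2)\<^sup>2 = (1 - y$3) * (1 + y$3)"
      using y by (simp add: algebra_simps power2_eq_square)
    have "(y$1 / (2 * r))\<^sup>2 + (- y$2 / (2 * r))\<^sup>2 = ((y$1)\<^sup>2 + (y$2)\<^sup>2) / (4 * r\<^sup>2)"
      by (simp add: power_divide power_mult_distrib add_divide_distrib)
    also have "\<dots> = (1 - y$3) / 2"
      unfolding 1 r(2) using pos by (simp add: field_simps)
    finally have 2: "(y$1 / (2 * r))\<^sup>2 + (- y$2 / (2 * r))\<^sup>2 = (1 - y$3) / 2" .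
    have "hopf3 v = y"
      using r 2 by (simp add: vec3_eq_iff hopf3_components v_def)
    moreover have "norm v = 1"
      using r 2 by (simp add: norm_complex_pair v_def add.assoc) 
    ultimately show ?thesis using that by blast
  qed
qed

section \<open>Linear differential equations\<close>

text \<open>Picard iteration written as a series of iterated integrals. The factorial bound on its
  terms makes the series and its termwise derivative converge uniformly on the whole interval at
  once, without subdividing it.\<close>

lemma linear_ode_exists:
  fixes a :: "real \<Rightarrow> 'g::real_normed_vector" and prod :: "'g \<Rightarrow> 'e \<Rightarrow> 'e::banach"
  assumes "bounded_bilinear prod" and a: "continuous_on {0..1} a"
  obtains v where "v 0 = v0"
    "\<And>t. t \<in> {0..1} \<Longrightarrow> (v has_vector_derivative prod (a t) (v t)) (at t within {0..1})"
proof -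
  interpret bounded_bilinear prod by fact
  from pos_bounded obtain K where K: "K > 0" "\<And>a b. norm (prod a b) \<le> norm a * norm b * K" by blast
  from compact_continuous_image[OF a] have "bounded (a ` {0..1})"
    by (simp add: compact_imp_bounded)
  then obtain C where C: "C > 0" "\<And>t. t \<in> {0..1} \<Longrightarrow> norm (a t) \<le> C"
    unfolding bounded_pos by auto
  define M where "M = C * K"
  have M: "M > 0" using C K by (simp add: M_def)
  have pM: "norm (prod (a t) x) \<le> M * norm x" if "t \<in> {0..1}" for t x
    unfolding M_def
    by (rule order.trans[OF K(2)[of "a t" x]])
      (use mult_right_mono[OF C(2)[OF that], of "norm x * K"] K(1) in \<open>simp add: mult_ac\<close>)
  \<comment> \<open>\<open>y k\<close> is the \<open>k\<close>-fold iterated integral applied to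
    \<open>v0\<close>, that is, the difference of two successive Picard iterates.\<close>
  define y where "y = rec_nat (\<lambda>_. v0) (\<lambda>_ f t. integral {0..t} (\<lambda>s. prod (a s) (f s)))"
  have y0: "y 0 = (\<lambda>_. v0)" and yS: "\<And>k. y (Suc k) = (\<lambda>t. integral {0..t} (\<lambda>s. prod (a s) (y k s)))"
    by (simp_all add: y_def)
  have cont: "continuous_on {0..1} (y k)" for k
  proof (induction k)
    case 0 show ?case by (simp add: y0)
  next
    case (Suc k)
    have "(\<lambda>s. prod (a s) (y k s)) integrable_on {0..1}"
      by (intro integrable_continuous_real continuous_on a Suc)
    then show ?case unfolding yS by (rule indefinite_integral_continuous_1)
  qed
  have contp: "continuous_on {0..1} (\<lambda>s. prod (a s) (y k s))" for k
    by (intro continuous_on a cont)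
  have der: "(y (Suc k) has_vector_derivative prod (a t) (y k t)) (at t within {0..1})"
    if "t \<in> {0..1}" for k t
    unfolding yS using integral_has_vector_derivative[OF contp that] .
  have bnd: "norm (y k t) \<le> norm v0 * (M * t) ^ k / fact k" if "t \<in> {0..1}" for k t
    using that
  proof (induction k arbitrary: t)
    case 0 then show ?case by (simp add: y0)
  next
    case (Suc k)
    have "((\<lambda>s. M * (norm v0 * (M * s) ^ k / fact k)) has_integral
        norm v0 * (M * t) ^ Suc k / fact (Suc k) - norm v0 * (M * 0) ^ Suc k / fact (Suc k)) {0..t}"
    proof (rule fundamental_theorem_of_calculus)
      show "((\<lambda>s. norm v0 * (M * s) ^ Suc k / fact (Suc k)) has_vector_derivative
          M * (norm v0 * (M * s) ^ k / fact k)) (at s within {0..t})" for s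
        unfolding has_real_derivative_iff_has_vector_derivative[symmetric] fact_Suc
        by (rule derivative_eq_intros refl | simp)+
    qed (use Suc.prems in auto)
    then have I: "((\<lambda>s. M * (norm v0 * (M * s) ^ k / fact k)) has_integral
        norm v0 * (M * t) ^ Suc k / fact (Suc k)) {0..t}" by simp
    have "norm (integral {0..t} (\<lambda>s. prod (a s) (y k s)))
        \<le> integral {0..t} (\<lambda>s. M * (norm v0 * (M * s) ^ k / fact k))"
    proof (rule integral_norm_bound_integral)
      show "(\<lambda>s. prod (a s) (y k s)) integrable_on {0..t}"
        using Suc.prems by (intro integrable_continuous_real continuous_on_subset[OF contp]) auto
      show "(\<lambda>s. M * (norm v0 * (M * s) ^ k / fact k)) integrable_on {0..t}" using I by blast
      show "norm (prod (a s) (y k s)) \<le> M * (norm v0 * (M * s) ^ k / fact k)" if "s \<in> {0..t}" for s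
      proof -
        have s: "s \<in> {0..1}" using that Suc.prems by auto
        show ?thesis
          using pM[OF s, of "y k s"] mult_left_mono[OF Suc.IH[OF s], of M] M by linarith
      qed
    qed
    then show ?case by (simp only: yS integral_unique[OF I])
  qed
  define m where "m k = norm v0 * (M ^ k / fact k)" for k
  have bm: "norm (y k t) \<le> m k" if t: "t \<in> {0..1}" for k t
  proof -
    have "(M * t) ^ k \<le> M ^ k" using t M by (intro power_mono) (auto simp: mult_le_cancel_left1)
    then have "norm v0 * (M * t) ^ k / fact k \<le> m k"
      unfolding m_def times_divide_eq_right by (intro divide_right_mono mult_left_mono) auto
    then show ?thesis using bnd[OF t, of k] by linarith
  qed
  have sm: "summable m"
    unfolding m_def using summable_exp[of M]
    by (intro summable_mult) (simp add: divide_inverse mult.commute)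
  define v where "v t = (\<Sum>k. y k t)" for t
  have ul: "uniform_limit {0..1} (\<lambda>n t. \<Sum>k<n. y k t) v sequentially"
    unfolding v_def by (rule Weierstrass_m_test[OF _ sm]) (use bm in blast)
  have sums_v: "(\<lambda>k. y k t) sums v t" if "t \<in> {0..1}" for t
    unfolding v_def
    by (intro summable_sums summable_comparison_test'[OF sm, of 0] bm that)
  \<comment> \<open>Term \<open>Suc j\<close> has derivative \<open>prod (a t) (y j t)\<close> and
    term 0 is constant. So \<open>Suc n\<close> differentiated terms add up to the product with only
    \<open>n\<close> terms; this shift is undone at the end by
    \<open>eventually_sequentially_Suc\<close>.\<close>
  define f' where "f' k t h = h *\<^sub>R (case k of 0 \<Rightarrow> 0 | Suc j \<Rightarrow> prod (a t) (y j t))" for k t and h::real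
  have "\<exists>g. \<forall>t\<in>{0..1}. (\<lambda>k. y k t) sums g t \<and>
      (g has_derivative (\<lambda>h. h *\<^sub>R prod (a t) (v t))) (at t within {0..1})"
  proof (rule has_derivative_series)
    show "convex {0..1::real}" by simp
    show "(y k has_derivative f' k t) (at t within {0..1})" if "t \<in> {0..1}" for k t
    proof (cases k)
      case 0
      have "f' 0 t = (\<lambda>_. 0)" by (simp add: f'_def fun_eq_iff)
      then show ?thesis unfolding 0 y0 by (simp only: has_derivative_const)
    next
      case (Suc j)
      then show ?thesis using der[OF that, of j] by (simp add: f'_def[abs_def] has_vector_derivative_def)
    qed
    show "\<forall>\<^sub>F n in sequentially. \<forall>t\<in>{0..1}. \<forall>h.
        norm ((\<Sum>i<n. f' i t h) - h *\<^sub>R prod (a t) (v t)) \<le> e * norm h" if "e > 0" for e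
    proof -
      have "\<forall>\<^sub>F n in sequentially. \<forall>t\<in>{0..1}. dist (\<Sum>k<n. y k t) (v t) < e / M"
        using uniform_limitD[OF ul, of "e / M"] that M by simp
      then have "\<forall>\<^sub>F n in sequentially. \<forall>t\<in>{0..1}. \<forall>h.
        norm ((\<Sum>i<Suc n. f' i t h) - h *\<^sub>R prod (a t) (v t)) \<le> e * norm h"
      proof (rule eventually_mono, intro ballI allI)
        fix n t h assume n: "\<forall>t\<in>{0..1}. dist (\<Sum>k<n. y k t) (v t) < e / M" and t: "t \<in> {0..1::real}"
        have "(\<Sum>i<Suc n. f' i t h) = h *\<^sub>R prod (a t) (\<Sum>k<n. y k t)"
          unfolding sum.lessThan_Suc_shift by (simp add: f'_def sum_right scaleR_sum_right)
        then have "(\<Sum>i<Suc n. f' i t h) - h *\<^sub>R prod (a t) (v t) = h *\<^sub>R prod (a t) ((\<Sum>k<n. y k t) - v t)"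
          by (simp only: diff_right scaleR_diff_right)
        then have "norm ((\<Sum>i<Suc n. f' i t h) - h *\<^sub>R prod (a t) (v t))
            = \<bar>h\<bar> * norm (prod (a t) ((\<Sum>k<n. y k t) - v t))"
          by (simp only: norm_scaleR)
        also have "\<dots> \<le> \<bar>h\<bar> * (M * (e / M))"
        proof (rule mult_left_mono)
          have "norm ((\<Sum>k<n. y k t) - v t) \<le> e / M"
            using n t by (metis dist_norm less_imp_le)
          then show "norm (prod (a t) ((\<Sum>k<n. y k t) - v t)) \<le> M * (e / M)"
            using pM[OF t, of "(\<Sum>k<n. y k t) - v t"] M
            by (meson less_imp_le mult_left_mono order.trans)
        qed simp
        finally show "norm ((\<Sum>i<Suc n. f' i t h) - h *\<^sub>R prod (a t) (v t)) \<le> e * norm h"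
          using M by (simp add: mult.commute)
      qed
      then show ?thesis by (rule eventually_sequentially_Suc[THEN iffD1])
    qed
    show "0 \<in> {0..1::real}" by simp
    show "(\<lambda>k. y k 0) sums v 0" using sums_v by simp
  qed
  then obtain g where g: "\<And>t. t \<in> {0..1} \<Longrightarrow> (\<lambda>k. y k t) sums g t"
    "\<And>t. t \<in> {0..1} \<Longrightarrow> (g has_vector_derivative prod (a t) (v t)) (at t within {0..1})"
    unfolding has_vector_derivative_def by blast
  have gv: "g t = v t" if "t \<in> {0..1}" for t
    using sums_unique2[OF g(1) sums_v] that by blast
  have "v 0 = v0"
  proof -
    have "y k 0 = (if k = 0 then v0 else 0)" for k
      by (cases k) (simp_all add: y0 yS)
    then have "(\<lambda>k. y k 0) sums v0" using sums_If_finite_set[of "{0}" "\<lambda>_. v0"] by simp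
    moreover have "(\<lambda>k. y k 0) sums v 0" by (rule sums_v) simp
    ultimately show ?thesis by (rule sums_unique2[THEN sym])
  qed
  moreover have "(v has_vector_derivative prod (a t) (v t)) (at t within {0..1})" if "t \<in> {0..1}" for t
    by (rule has_vector_derivative_transform[OF that _ g(2)[OF that]]) (simp add: gv)
  ultimately show ?thesis by (rule that)
qed

text \<open>Dividing the energy inequality by the norm bounds the growth rate of
  \<open>norm (y t)\<close> by \<open>g t\<close>. No term proportional to the norm remains, so the
  conclusion has no exponential factor.\<close>

lemma energy_bound:
  fixes y :: "real \<Rightarrow> 'e::real_inner"
  assumes der: "\<And>t. t \<in> {0..1} \<Longrightarrow> (y has_vector_derivative y' t) (at t within {0..1})"
    and le: "\<And>t. t \<in> {0..1} \<Longrightarrow> y t \<bullet> y' t \<le> norm (y t) * g t"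
    and g: "continuous_on {0..1} g" "\<And>t. t \<in> {0..1} \<Longrightarrow> 0 \<le> g t"
  shows "norm (y 1) \<le> norm (y 0) + integral {0..1} g"
proof (rule field_le_epsilon)
  fix d :: real assume d: "d > 0"
  \<comment> \<open>The shift by \<open>d\<close> keeps the square root differentiable where
    \<open>y\<close> vanishes. It costs at most \<open>d\<close> at time 0.\<close>
  define N where "N t = sqrt (y t \<bullet> y t + d\<^sup>2)" for t
  have pos: "y t \<bullet> y t + d\<^sup>2 > 0" for t
    using d by (intro add_nonneg_pos) auto
  have "(N has_vector_derivative (y t \<bullet> y' t) / N t) (at t within {0..1})" if "t \<in> {0..1}" for t
  proof -
    have 1: "((\<lambda>t. y t \<bullet> y t + d\<^sup>2) has_real_derivative 2 * (y t \<bullet> y' t)) (at t within {0..1})"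
      unfolding has_real_derivative_iff_has_vector_derivative
      using has_vector_derivative_add[OF
          bounded_bilinear.has_vector_derivative[OF bounded_bilinear_inner der[OF that] der[OF that]]
          has_vector_derivative_const[of "d\<^sup>2"]]
      by (simp add: inner_commute)
    show ?thesis
      unfolding N_def has_real_derivative_iff_has_vector_derivative[symmetric]
      using DERIV_chain2[OF DERIV_real_sqrt[OF pos] 1]
      by (simp add: field_simps)
  qed
  then have I: "((\<lambda>t. (y t \<bullet> y' t) / N t) has_integral N 1 - N 0) {0..1}"
    by (intro fundamental_theorem_of_calculus) auto
  have "N 1 - N 0 \<le> integral {0..1} g"
  proof (rule has_integral_le[OF I integrable_integral])
    show "g integrable_on {0..1}" by (intro integrable_continuous_real g)
    show "(y t \<bullet> y' t) / N t \<le> g t" if t: "t \<in> {0..1}" for t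
    proof -
      have "norm (y t) \<le> N t" unfolding N_def norm_eq_sqrt_inner by simp
      then have "y t \<bullet> y' t \<le> N t * g t"
        using le[OF t] mult_right_mono[OF _ g(2)[OF t]] by fastforce
      moreover have "N t > 0" using pos by (simp add: N_def)
      ultimately show ?thesis by (simp add: field_simps)
    qed
  qed
  moreover have "norm (y 1) \<le> N 1" by (simp add: N_def norm_eq_sqrt_inner)
  moreover have "N 0 \<le> norm (y 0) + d"
    unfolding N_def using d sqrt_add_le_add_sqrt[of "y 0 \<bullet> y 0" "d\<^sup>2"] by (simp add: norm_eq_sqrt_inner)
  ultimately show "norm (y 1) \<le> norm (y 0) + integral {0..1} g + d" by linarith
qed

definition spin_path :: "(real \<Rightarrow> real^3) \<Rightarrow> complex \<times> complex \<Rightarrow> (real \<Rightarrow> complex \<times> complex) \<Rightarrow> bool" where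
  "spin_path a p v \<longleftrightarrow> v 0 = p \<and>
     (\<forall>t\<in>{0..1}. (v has_vector_derivative spin (a t) (v t)) (at t within {0..1}))"

lemma spin_path_exists:
  assumes "continuous_on {0..1} a"
  obtains v where "spin_path a p v"
  using linear_ode_exists[OF bounded_bilinear_spin assms, of p] unfolding spin_path_def by metis

lemma spin_path_norm:
  assumes "spin_path a p v" "t \<in> {0..1}"
  shows "norm (v t) = norm p"
proof -
  obtain c where "\<And>t. t \<in> {0..1} \<Longrightarrow> v t \<bullet> v t = c"
  proof (rule has_vector_derivative_zero_constant)
    show "convex {0..1::real}" by simp
    fix t :: real assume "t \<in> {0..1}"
    then have d: "(v has_vector_derivative spin (a t) (v t)) (at t within {0..1})"
      using assms(1) by (simp add: spin_path_def)
    show "((\<lambda>t. v t \<bullet> v t) has_vector_derivative 0) (at t within {0..1})"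
      using bounded_bilinear.has_vector_derivative[OF bounded_bilinear_inner d d]
      by (simp add: inner_commute inner_spin_self)
  qed blast
  then have "v t \<bullet> v t = v 0 \<bullet> v 0" using assms(2) by (metis atLeastAtMost_iff order.refl zero_le_one)
  then show ?thesis using assms(1) by (simp add: norm_eq_sqrt_inner spin_path_def)
qed

text \<open>\<open>spin a\<close> is skew, so it does no work and only the source \<open>f\<close>
  contributes to the energy.\<close>

lemma inner_spin_add_le:
  assumes "norm f \<le> g"
  shows "y \<bullet> (spin a y + f) \<le> norm y * g"
proof -
  have "y \<bullet> (spin a y + f) = y \<bullet> f" by (simp add: inner_add_right inner_spin_self)
  also have "\<dots> \<le> norm y * norm f" by (rule norm_cauchy_schwarz)
  also have "\<dots> \<le> norm y * g" using assms by (simp add: mult_left_mono)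
  finally show ?thesis .
qed

text \<open>The difference of the two solutions solves the equation of \<open>a\<close> with source
  \<open>spin (a - b) w\<close>, and \<open>w\<close> has constant norm \<open>norm p\<close>.
  Comparing connections thus costs only the integral of their distance.\<close>

lemma spin_path_dist:
  assumes v: "spin_path a p v" and w: "spin_path b p w"
    and c: "continuous_on {0..1} a" "continuous_on {0..1} b"
  shows "norm (v 1 - w 1) \<le> norm p * integral {0..1} (\<lambda>t. norm (a t - b t))"
proof -
  have "norm (v 1 - w 1) \<le> norm (v 0 - w 0) + integral {0..1} (\<lambda>t. norm p * norm (a t - b t))"
  proof (rule energy_bound)
    show "((\<lambda>t. v t - w t) has_vector_derivative spin (a t) (v t) - spin (b t) (w t)) (at t within {0..1})"
      if "t \<in> {0..1}" for t
      using v w that by (intro has_vector_derivative_diff) (auto simp: spin_path_def)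
    show "(v t - w t) \<bullet> (spin (a t) (v t) - spin (b t) (w t)) \<le> norm (v t - w t) * (norm p * norm (a t - b t))"
      if "t \<in> {0..1}" for t
    proof -
      have "spin (a t) (v t) - spin (b t) (w t) = spin (a t) (v t - w t) + spin (a t - b t) (w t)"
        by (simp add: spin.diff_left spin.diff_right)
      then show ?thesis
        using inner_spin_add_le[of "spin (a t - b t) (w t)" "norm p * norm (a t - b t)"]
          spin_path_norm[OF w that] by (simp add: norm_spin mult.commute)
    qed
  qed (auto intro!: continuous_intros c)
  moreover have "v 0 = w 0" using v w by (simp add: spin_path_def)
  ultimately show ?thesis by simp
qed

text \<open>Up to the defect bounded by \<open>g\<close>, the error \<open>f - hopf3 v\<close> is
  moved by the operator \<open>2 a \<times>\<close>, which is skew as well. The energy bound applies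
  as it does for spinors.\<close>

lemma spin_path_hopf3:
  assumes v: "spin_path a p v"
    and f: "\<And>t. t \<in> {0..1} \<Longrightarrow> (f has_vector_derivative f' t) (at t within {0..1})"
    and le: "\<And>t. t \<in> {0..1} \<Longrightarrow> norm (f' t - 2 *\<^sub>R cross3 (a t) (f t)) \<le> g t"
    and g: "continuous_on {0..1} g"
  shows "norm (f 1 - hopf3 (v 1)) \<le> norm (f 0 - hopf3 p) + integral {0..1} g"
proof -
  have "norm (f 1 - hopf3 (v 1)) \<le> norm (f 0 - hopf3 (v 0)) + integral {0..1} g"
  proof (rule energy_bound)
    show "((\<lambda>t. f t - hopf3 (v t)) has_vector_derivative f' t - 2 *\<^sub>R cross3 (a t) (hopf3 (v t))) (at t within {0..1})"
      if "t \<in> {0..1}" for t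
      using v f that by (intro has_vector_derivative_diff hopf3_has_vector_derivative) (auto simp: spin_path_def)
    show "(f t - hopf3 (v t)) \<bullet> (f' t - 2 *\<^sub>R cross3 (a t) (hopf3 (v t))) \<le> norm (f t - hopf3 (v t)) * g t"
      if "t \<in> {0..1}" for t
    proof -
      let ?y = "f t - hopf3 (v t)"
      have "f' t - 2 *\<^sub>R cross3 (a t) (hopf3 (v t)) = (f' t - 2 *\<^sub>R cross3 (a t) (f t)) + 2 *\<^sub>R cross3 (a t) ?y"
        by (simp add: Cross3.right_diff_distrib scaleR_diff_right)
      then have "?y \<bullet> (f' t - 2 *\<^sub>R cross3 (a t) (hopf3 (v t))) = ?y \<bullet> (f' t - 2 *\<^sub>R cross3 (a t) (f t))"
        by (simp only: inner_add_right inner_scaleR_right dot_cross_self mult_zero_right add_0_right)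
      also have "\<dots> \<le> norm ?y * norm (f' t - 2 *\<^sub>R cross3 (a t) (f t))" by (rule norm_cauchy_schwarz)
      also have "\<dots> \<le> norm ?y * g t" using le[OF that] by (simp add: mult_left_mono)
      finally show ?thesis .
    qed
    show "0 \<le> g t" if "t \<in> {0..1}" for t using le[OF that] norm_ge_zero order.trans by blast
  qed (rule g)
  then show ?thesis using v by (simp add: spin_path_def)
qed

text \<open>In the application \<open>a\<close> and \<open>b\<close> are the connection along a
  segment and along a perturbed one, and \<open>t *\<^sub>R \<alpha> t\<close> is the connection
  evaluated on the displacement at time \<open>t\<close>. To first order \<open>w - v\<close> should
  equal \<open>t *\<^sub>R spin (\<alpha> t) (v t)\<close>. The deviation \<open>y\<close> solves
  the equation of \<open>b\<close> with a source. The first norm in the hypothesis is what is left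
  of this source after commuting \<open>spin (a t)\<close> past \<open>spin (\<alpha> t)\<close>; it
  is of second order when the curvature vanishes. The product of norms comes from writing the
  equation with \<open>b\<close> instead of \<open>a\<close>.\<close>

lemma spin_path_variation:
  assumes v: "spin_path a p v" and w: "spin_path b p w"
    and \<alpha>: "\<And>t. t \<in> {0..1} \<Longrightarrow> (\<alpha> has_vector_derivative \<alpha>' t) (at t within {0..1})"
    and le: "\<And>t. t \<in> {0..1} \<Longrightarrow>
      norm (b t - a t - \<alpha> t - t *\<^sub>R \<alpha>' t + (2 * t) *\<^sub>R cross3 (a t) (\<alpha> t))
        + norm (b t - a t) * norm (\<alpha> t) \<le> g t"
    and g: "continuous_on {0..1} g"
  shows "norm (w 1 - v 1 - spin (\<alpha> 1) (v 1)) \<le> norm p * integral {0..1} g"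
proof -
  define y where "y t = w t - v t - t *\<^sub>R spin (\<alpha> t) (v t)" for t
  define y' where "y' t = spin (b t) (w t) - spin (a t) (v t)
      - (t *\<^sub>R (spin (\<alpha> t) (spin (a t) (v t)) + spin (\<alpha>' t) (v t)) + spin (\<alpha> t) (v t))" for t
  have "norm (y 1) \<le> norm (y 0) + integral {0..1} (\<lambda>t. norm p * g t)"
  proof (rule energy_bound)
    fix t :: real assume t: "t \<in> {0..1}"
    have dv: "(v has_vector_derivative spin (a t) (v t)) (at t within {0..1})"
      and dw: "(w has_vector_derivative spin (b t) (w t)) (at t within {0..1})"
      using v w t by (auto simp: spin_path_def)
    have d2: "((\<lambda>t. t *\<^sub>R spin (\<alpha> t) (v t)) has_vector_derivative
        t *\<^sub>R (spin (\<alpha> t) (spin (a t) (v t)) + spin (\<alpha>' t) (v t)) + 1 *\<^sub>R spin (\<alpha> t) (v t)) (at t within {0..1})"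
      by (intro bounded_bilinear.has_vector_derivative[OF bounded_bilinear_scaleR]
          spin.has_vector_derivative \<alpha> t dv has_vector_derivative_id)
    show "(y has_vector_derivative y' t) (at t within {0..1})"
      unfolding y_def[abs_def] y'_def
      using has_vector_derivative_diff[OF has_vector_derivative_diff[OF dw dv] d2] by simp
    define F where "F = spin (b t - a t - \<alpha> t - t *\<^sub>R \<alpha>' t + (2 * t) *\<^sub>R cross3 (a t) (\<alpha> t)) (v t)
        + t *\<^sub>R spin (b t - a t) (spin (\<alpha> t) (v t))"
    have com: "spin (a t) (spin (\<alpha> t) (v t)) = spin (\<alpha> t) (spin (a t) (v t)) + spin (2 *\<^sub>R cross3 (a t) (\<alpha> t)) (v t)"
      using spin_commutator[of "a t" "\<alpha> t" "v t"] by (simp add: algebra_simps)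
    have "y' t = spin (b t) (y t) + F"
      unfolding y_def y'_def F_def
      by (simp add: spin.diff_left spin.diff_right spin.add_left spin.add_right spin.scaleR_left
          spin.scaleR_right com algebra_simps)
    moreover have "norm F \<le> norm p * g t"
    proof -
      have nv: "norm (v t) = norm p" by (rule spin_path_norm[OF v t])
      let ?Z = "b t - a t - \<alpha> t - t *\<^sub>R \<alpha>' t + (2 * t) *\<^sub>R cross3 (a t) (\<alpha> t)"
      have "norm F \<le> norm ?Z * norm p + \<bar>t\<bar> * (norm (b t - a t) * (norm (\<alpha> t) * norm p))"
        unfolding F_def by (rule order.trans[OF norm_triangle_ineq]) (simp add: norm_spin nv)
      also have "\<dots> \<le> norm ?Z * norm p + 1 * (norm (b t - a t) * (norm (\<alpha> t) * norm p))"
        using t by (intro add_left_mono mult_right_mono) auto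
      also have "\<dots> = norm p * (norm ?Z + norm (b t - a t) * norm (\<alpha> t))"
        by (simp add: algebra_simps)
      also have "\<dots> \<le> norm p * g t" using le[OF t] by (intro mult_left_mono) auto
      finally show ?thesis .
    qed
    ultimately show "y t \<bullet> y' t \<le> norm (y t) * (norm p * g t)" using inner_spin_add_le by metis
    have "0 \<le> g t" by (rule order.trans[OF _ le[OF t]]) simp
    then show "0 \<le> norm p * g t" by simp
  qed (intro continuous_intros g)
  moreover have "y 0 = 0" using v w by (simp add: y_def spin_path_def)
  ultimately show ?thesis by (simp add: y_def)
qed

section \<open>Smooth kernels\<close>

lemma power_div_fact_le_exp:
  fixes x :: real assumes "0 \<le> x"
  shows "x ^ n / fact n \<le> exp x"
proof -
  have "(\<Sum>k\<in>{n}. x ^ k /\<^sub>R fact k) \<le> (\<Sum>k. x ^ k /\<^sub>R fact k)"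
    using assms by (intro sum_le_suminf summable_exp_generic) auto
  then show ?thesis by (simp add: exp_def field_simps)
qed

text \<open>The case \<open>m = 0\<close> is the classical smooth function that is flat at 0. The
  powers in the denominator make the family closed under differentiation up to linear
  combinations.\<close>

definition flat_exp :: "nat \<Rightarrow> real \<Rightarrow> real" where
  "flat_exp m t = (if t \<le> 0 then 0 else exp (- 1 / t) / t ^ m)"

lemma flat_exp_nonneg: "0 \<le> flat_exp m t"
  by (simp add: flat_exp_def)

text \<open>Keep the single term of order \<open>m + 2\<close> of the series of
  \<open>exp (1 / t)\<close>: two powers of \<open>t\<close> survive the division by
  \<open>t ^ m\<close>. Quadratic decay is what differentiability at 0 asks for.\<close>

lemma flat_exp_le: "\<bar>flat_exp m t\<bar> \<le> fact (m + 2) * t\<^sup>2"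
proof (cases "t > 0")
  case True
  define F :: real where "F = fact (m + 2)"
  have F: "F > 0" unfolding F_def by (rule fact_gt_zero)
  have "(1 / t) ^ (m + 2) / F \<le> exp (1 / t)"
    unfolding F_def using True by (intro power_div_fact_le_exp) auto
  then have "exp (- (1 / t)) \<le> F * t ^ (m + 2)"
    using True F by (simp add: exp_minus field_simps)
  then have "\<bar>flat_exp m t\<bar> \<le> F * t\<^sup>2"
    using True by (simp add: flat_exp_def field_simps power_add power2_eq_square)
  then show ?thesis by (simp only: F_def)
qed (simp add: flat_exp_def)

lemma flat_exp_deriv:
  "(flat_exp m has_real_derivative flat_exp (m + 2) t - m * flat_exp (m + 1) t) (at t)"
proof -
  consider "t > 0" | "t < 0" | "t = 0" by linarith
  then show ?thesis
  proof cases
    case 1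
    have "((\<lambda>t. exp (- 1 / t) / t ^ m) has_real_derivative flat_exp (m + 2) t - m * flat_exp (m + 1) t) (at t)"
    proof -
      have p: "((\<lambda>t. t ^ m) has_real_derivative m * t ^ m / t) (at t)"
        using DERIV_pow[of m t] 1 by (cases m) simp_all
      have e: "((\<lambda>t. exp (- 1 / t)) has_real_derivative exp (- 1 / t) * (1 / t\<^sup>2)) (at t)"
        using 1 by (auto intro!: derivative_eq_intros simp: power2_eq_square)
      have "((\<lambda>t. exp (- 1 / t) / t ^ m) has_real_derivative
          (exp (- 1 / t) * (1 / t\<^sup>2) * t ^ m - exp (- 1 / t) * (m * t ^ m / t)) / (t ^ m * t ^ m)) (at t)"
        by (rule DERIV_divide[OF e p]) (use 1 in simp)
      also have "(exp (- 1 / t) * (1 / t\<^sup>2) * t ^ m - exp (- 1 / t) * (m * t ^ m / t)) / (t ^ m * t ^ m)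
          = flat_exp (m + 2) t - m * flat_exp (m + 1) t"
        using 1 by (simp add: flat_exp_def field_simps power2_eq_square)
      finally show ?thesis .
    qed
    then show ?thesis
      by (rule has_field_derivative_transform_within_open[of _ _ _ "{0<..}"])
        (use 1 in \<open>auto simp: flat_exp_def\<close>)
  next
    case 2
    have "((\<lambda>t. 0) has_real_derivative flat_exp (m + 2) t - m * flat_exp (m + 1) t) (at t)"
      using 2 by (auto simp: flat_exp_def)
    then show ?thesis
      by (rule has_field_derivative_transform_within_open[of _ _ _ "{..<0}"])
        (use 2 in \<open>auto simp: flat_exp_def\<close>)
  next
    case 3
    \<comment> \<open>At 0 the function and the claimed derivative both vanish, so the difference
      quotient is just \<open>flat_exp m h / h\<close>.\<close>
    have "((\<lambda>h. flat_exp m h / h) \<longlongrightarrow> 0) (at 0)"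
    proof (rule Lim_null_comparison)
      show "\<forall>\<^sub>F h in at 0. norm (flat_exp m h / h) \<le> fact (m + 2) * \<bar>h\<bar>"
      proof (rule always_eventually, rule allI)
        fix h :: real
        have "norm (flat_exp m h / h) = \<bar>flat_exp m h\<bar> / \<bar>h\<bar>" by (simp add: abs_divide)
        also have "\<dots> \<le> (fact (m + 2) * h\<^sup>2) / \<bar>h\<bar>" by (intro divide_right_mono flat_exp_le) auto
        also have "\<dots> = fact (m + 2) * \<bar>h\<bar>"
          by (cases "h = 0") (simp_all add: power2_eq_square abs_if)
        finally show "norm (flat_exp m h / h) \<le> fact (m + 2) * \<bar>h\<bar>" .
      qed
      show "((\<lambda>h::real. fact (m + 2) * \<bar>h\<bar>) \<longlongrightarrow> 0) (at 0)"
        by (auto intro!: tendsto_eq_intros)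
    qed
    then show ?thesis using 3 by (simp add: DERIV_def flat_exp_def)
  qed
qed

text \<open>A syntactic class containing the bump functions and closed under partial derivatives.
  Membership yields derivatives of all orders by induction, so smoothness of each kernel follows
  without separate closure rules for \<open>Ck\<close>.\<close>

inductive bump_poly :: "('a::euclidean_space \<Rightarrow> real) \<Rightarrow> bool" where
  const: "bump_poly (\<lambda>_. r)"
| coord: "bump_poly (\<lambda>x. x \<bullet> b)"
| flat: "bump_poly (\<lambda>x. flat_exp m (r - (x - c) \<bullet> (x - c)))"
| add: "bump_poly f \<Longrightarrow> bump_poly g \<Longrightarrow> bump_poly (\<lambda>x. f x + g x)"
| mult: "bump_poly f \<Longrightarrow> bump_poly g \<Longrightarrow> bump_poly (\<lambda>x. f x * g x)"

lemma bump_poly_has_derivative: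
  assumes "bump_poly f"
  shows "\<exists>f'. (\<forall>x. (f has_derivative f' x) (at x)) \<and> (\<forall>b. bump_poly (\<lambda>x. f' x b))"
  using assms
proof induction
  case (const r)
  show ?case by (intro exI[of _ "\<lambda>_ _. 0"] conjI allI has_derivative_const bump_poly.const)
next
  case (coord b)
  show ?case
    by (intro exI[of _ "\<lambda>_ h. h \<bullet> b"] conjI allI bump_poly.const)
      (auto intro!: derivative_eq_intros)
next
  case (flat m r c)
  let ?f' = "\<lambda>x h. (flat_exp (m + 2) (r - (x - c) \<bullet> (x - c))
      + (- real m) * flat_exp (m + 1) (r - (x - c) \<bullet> (x - c))) * ((-2) * (x \<bullet> h) + 2 * (c \<bullet> h))"
  have D: "((\<lambda>x. r - (x - c) \<bullet> (x - c)) has_derivative (\<lambda>h. (-2) * (x \<bullet> h) + 2 * (c \<bullet> h))) (at x)" for x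
    by (auto intro!: derivative_eq_intros simp: inner_diff_left inner_diff_right inner_commute algebra_simps)
  have "((\<lambda>x. flat_exp m (r - (x - c) \<bullet> (x - c))) has_derivative ?f' x) (at x)" for x
    using has_derivative_compose[OF D flat_exp_deriv[unfolded has_field_derivative_def]] by simp
  moreover have "bump_poly (\<lambda>x. ?f' x h)" for h
    by (intro bump_poly.add bump_poly.mult bump_poly.const bump_poly.flat bump_poly.coord)
  ultimately show ?case by (intro exI[of _ ?f'] conjI allI)
next
  case (add f g)
  then obtain f' g' where f: "\<And>x. (f has_derivative f' x) (at x)" "\<And>b. bump_poly (\<lambda>x. f' x b)"
    and g: "\<And>x. (g has_derivative g' x) (at x)" "\<And>b. bump_poly (\<lambda>x. g' x b)" by metis
  show ?case
    by (intro exI[of _ "\<lambda>x h. f' x h + g' x h"] conjI allI has_derivative_add f g bump_poly.add)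
next
  case (mult f g)
  then obtain f' g' where f: "\<And>x. (f has_derivative f' x) (at x)" "\<And>b. bump_poly (\<lambda>x. f' x b)"
    and g: "\<And>x. (g has_derivative g' x) (at x)" "\<And>b. bump_poly (\<lambda>x. g' x b)" by metis
  show ?case
    by (intro exI[of _ "\<lambda>x h. f x * g' x h + f' x h * g x"] conjI allI has_derivative_mult f g
        bump_poly.add bump_poly.mult mult.hyps)
qed

text \<open>A kernel is tested in the form of the function sending \<open>y\<close> to
  \<open>k (x - y)\<close>. The free centre \<open>c\<close> in the constructor \<open>flat\<close>
  absorbs both translation and reflection.\<close>

lemma bump_poly_reflect:
  assumes "bump_poly f"
  shows "bump_poly (\<lambda>y. f (x - y))"
  using assms
proof induction
  case (coord b)
  have "(\<lambda>y. (x - y) \<bullet> b) = (\<lambda>y. x \<bullet> b + (-1) * (y \<bullet> b))" by (auto simp: inner_diff_left)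
  then show ?case by (simp only:) (intro bump_poly.intros)
next
  case (flat m r c)
  have "(\<lambda>y. flat_exp m (r - (x - y - c) \<bullet> (x - y - c))) = (\<lambda>y. flat_exp m (r - (y - (x - c)) \<bullet> (y - (x - c))))"
    by (auto simp: inner_diff_left inner_diff_right inner_commute algebra_simps intro!: arg_cong[of _ _ "flat_exp m"])
  then show ?case by (simp only:) (intro bump_poly.intros)
qed (auto intro: bump_poly.intros)

abbreviation pderiv_at :: "('a::real_normed_vector \<Rightarrow> 'b::real_normed_vector) \<Rightarrow> 'a \<Rightarrow> 'a \<Rightarrow> 'b" where
  "pderiv_at f b x \<equiv> frechet_derivative f (at x) b"

lemma bump_poly_frechet:
  assumes "bump_poly f"
  shows "(f has_derivative frechet_derivative f (at x)) (at x)"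
    and "bump_poly (pderiv_at f b)"
proof -
  obtain f' where f': "\<And>x. (f has_derivative f' x) (at x)" "\<And>b. bump_poly (\<lambda>x. f' x b)"
    using bump_poly_has_derivative[OF assms] by metis
  have "frechet_derivative f (at x) = f' x" for x
    using frechet_derivative_at[OF f'(1)] by metis
  then show "(f has_derivative frechet_derivative f (at x)) (at x)" "bump_poly (pderiv_at f b)"
    using f' by auto
qed

lemma bump_poly_continuous: "bump_poly f \<Longrightarrow> continuous_on UNIV f"
  by (intro continuous_at_imp_continuous_on ballI has_derivative_continuous[OF bump_poly_frechet(1)])

text \<open>The constant vector \<open>w\<close> is carried along so that the same statement
  supplies scalar test functions and test 1-forms.\<close>

lemma bump_poly_Ck: "bump_poly f \<Longrightarrow> Ck k (\<lambda>x. f x *\<^sub>R (w::'b::real_normed_vector))"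
proof (induction k arbitrary: f)
  case 0
  then show ?case by (auto intro!: continuous_intros bump_poly_continuous)
next
  case (Suc k)
  have d: "((\<lambda>x. f x *\<^sub>R w) has_derivative (\<lambda>b. pderiv_at f b x *\<^sub>R w)) (at x)" for x
    by (intro has_derivative_scaleR_left bump_poly_frechet(1) Suc.prems)
  have "frechet_derivative (\<lambda>x. f x *\<^sub>R w) (at x) = (\<lambda>b. pderiv_at f b x *\<^sub>R w)" for x
    using frechet_derivative_at[OF d] by metis
  then show ?case
    using d Suc.IH[OF bump_poly_frechet(2)[OF Suc.prems]] by (auto simp: differentiable_def)
qed

text \<open>Neither a sign nor unit mass is part of the definition, so that the derivatives of a
  mollifier are kernels of the same radius.\<close>

definition smooth_kernel :: "real \<Rightarrow> ('a::euclidean_space \<Rightarrow> real) \<Rightarrow> bool" where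
  "smooth_kernel e k \<longleftrightarrow> bump_poly k \<and> (\<forall>x. e < norm x \<longrightarrow> k x = 0)"

lemma kernelD: "smooth_kernel e k \<Longrightarrow> bump_poly k" "smooth_kernel e k \<Longrightarrow> e < norm x \<Longrightarrow> k x = 0"
  by (auto simp: smooth_kernel_def)

lemma kernel_has_derivative: "smooth_kernel e k \<Longrightarrow> (k has_derivative frechet_derivative k (at x)) (at x)"
  by (intro bump_poly_frechet(1) kernelD)

lemma kernel_pderiv:
  assumes "smooth_kernel e k"
  shows "smooth_kernel e (pderiv_at k b)"
  unfolding smooth_kernel_def
proof (intro conjI allI impI)
  show "bump_poly (pderiv_at k b)" by (rule bump_poly_frechet(2)[OF kernelD(1)[OF assms]])
  fix x :: 'a assume x: "e < norm x"
  have "open {x::'a. e < norm x}" by (intro open_Collect_less continuous_intros)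
  then have "(k has_derivative (\<lambda>_. 0)) (at x)"
    by (rule has_derivative_transform_within_open[OF has_derivative_const[of 0]])
      (use x kernelD(2)[OF assms] in auto)
  from fun_cong[OF frechet_derivative_at[OF this], of b] show "pderiv_at k b x = 0" by simp
qed

lemma kernel_continuous: "smooth_kernel e k \<Longrightarrow> continuous_on A k"
  using bump_poly_continuous[of k] continuous_on_subset[of UNIV k A] by (simp add: smooth_kernel_def)

lemma kernel_measurable [measurable_dest]: "smooth_kernel e k \<Longrightarrow> k \<in> borel_measurable borel"
  by (simp add: borel_measurable_continuous_onI[OF kernel_continuous[of e k UNIV]])

lemma kernel_bounded:
  assumes "smooth_kernel e k"
  obtains C where "0 \<le> C" "\<And>x. \<bar>k x\<bar> \<le> C"
proof -
  have "compact (k ` cball 0 e)"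
    by (intro compact_continuous_image kernel_continuous[OF assms]) auto
  then obtain C where C: "C > 0" "\<And>x. x \<in> cball 0 e \<Longrightarrow> norm (k x) \<le> C"
    using compact_imp_bounded bounded_pos by (metis imageI)
  have "\<bar>k x\<bar> \<le> C" for x
  proof (cases "norm x \<le> e")
    case True then show ?thesis using C(2)[of x] by simp
  next
    case False then show ?thesis using C(1) kernelD(2)[OF assms, of x] by simp
  qed
  with C(1) that show ?thesis using less_imp_le by blast
qed

lemma kernel_integrable:
  assumes "smooth_kernel e k"
  shows "integrable lborel k"
proof -
  have "integrable lborel (\<lambda>x. indicator (cball 0 e) x *\<^sub>R k x)"
    by (rule borel_integrable_compact[OF compact_cball kernel_continuous[OF assms]])
  also have "(\<lambda>x. indicator (cball 0 e) x *\<^sub>R k x) = k"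
    using kernelD(2)[OF assms] by (force simp: indicator_def not_le fun_eq_iff)
  finally show ?thesis .
qed

lemma kernel_test_function:
  assumes k: "smooth_kernel e k" and sub: "cball x e \<subseteq> \<Omega>"
  shows "test_function \<Omega> (\<lambda>y. k (x - y) *\<^sub>R (w::'b::real_normed_vector))"
proof -
  have "{y. k (x - y) *\<^sub>R w \<noteq> 0} \<subseteq> cball x e"
    using kernelD(2)[OF k] by (force simp: dist_norm not_le)
  then have 1: "closure {y. k (x - y) *\<^sub>R w \<noteq> 0} \<subseteq> cball x e"
    by (intro closure_minimal) auto
  then have "compact (closure {y. k (x - y) *\<^sub>R w \<noteq> 0})"
    using bounded_subset[OF bounded_cball] by (auto simp: compact_eq_bounded_closed)
  with 1 sub show ?thesis
    unfolding test_function_def smooth_def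
    by (auto intro!: bump_poly_Ck bump_poly_reflect kernelD[OF k])
qed

lemma kernel_test_function_real:
  assumes "smooth_kernel e k" "cball x e \<subseteq> \<Omega>"
  shows "test_function \<Omega> (\<lambda>y. k (x - y))"
  using kernel_test_function[OF assms, of "1::real"] by simp

lemma pderiv_at_reflect:
  assumes "smooth_kernel e k"
  shows "pderiv_at (\<lambda>y. k (x - y)) b y = - pderiv_at k b (x - y)"
proof -
  have "((\<lambda>y. k (x - y)) has_derivative (\<lambda>h. frechet_derivative k (at (x - y)) (- h))) (at y)"
    by (rule has_derivative_compose[of "\<lambda>y. x - y" "\<lambda>h. - h", OF _ kernel_has_derivative[OF assms]])
      (auto intro!: derivative_eq_intros)
  then have "frechet_derivative (\<lambda>y. k (x - y)) (at y) = (\<lambda>h. frechet_derivative k (at (x - y)) (- h))"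
    using frechet_derivative_at by metis
  then show ?thesis
    using linear_neg[OF has_derivative_linear[OF kernel_has_derivative[OF assms]]] by simp
qed

lemma linear_norm_le_sum_Basis:
  fixes f :: "'a::euclidean_space \<Rightarrow> 'b::real_normed_vector"
  assumes "linear f"
  shows "norm (f h) \<le> norm h * (\<Sum>b\<in>Basis. norm (f b))"
proof -
  have "f h = f (\<Sum>b\<in>Basis. (h \<bullet> b) *\<^sub>R b)" by (simp add: euclidean_representation)
  also have "\<dots> = (\<Sum>b\<in>Basis. (h \<bullet> b) *\<^sub>R f b)"
    by (simp add: linear_sum[OF assms] linear_cmul[OF assms])
  also have "norm \<dots> \<le> (\<Sum>b\<in>Basis. norm h * norm (f b))"
    by (rule sum_norm_le) (simp add: Basis_le_norm mult_right_mono)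
  finally show ?thesis by (simp add: sum_distrib_left)
qed

text \<open>Boundedness and a global second-order Taylor estimate, the only regularity of the mollified
  fields that matters below.\<close>

definition quad_diff :: "('a::real_normed_vector \<Rightarrow> 'b::real_normed_vector) \<Rightarrow> ('a \<Rightarrow> 'a \<Rightarrow> 'b) \<Rightarrow> bool" where
  "quad_diff f f' \<longleftrightarrow> (\<forall>x. linear (f' x)) \<and>
     (\<exists>C\<ge>0. \<forall>x k. norm (f x) \<le> C \<and> norm (f' x k) \<le> C * norm k \<and>
        norm (f (x + k) - f x - f' x k) \<le> C * (norm k)\<^sup>2)"

lemma quad_diffI:
  assumes "\<And>x. linear (f' x)" "\<And>x. norm (f x) \<le> C0" "\<And>x k. norm (f' x k) \<le> C1 * norm k"
    "\<And>x k. norm (f (x + k) - f x - f' x k) \<le> C2 * (norm k)\<^sup>2"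
  shows "quad_diff f f'"
  unfolding quad_diff_def
proof (intro conjI allI assms(1))
  show "\<exists>C\<ge>0. \<forall>x k. norm (f x) \<le> C \<and> norm (f' x k) \<le> C * norm k \<and>
      norm (f (x + k) - f x - f' x k) \<le> C * (norm k)\<^sup>2"
  proof (intro exI[of _ "\<bar>C0\<bar> + \<bar>C1\<bar> + \<bar>C2\<bar>"] conjI allI)
    fix x k
    show "norm (f x) \<le> \<bar>C0\<bar> + \<bar>C1\<bar> + \<bar>C2\<bar>" using assms(2)[of x] by linarith
    show "norm (f' x k) \<le> (\<bar>C0\<bar> + \<bar>C1\<bar> + \<bar>C2\<bar>) * norm k"
      by (rule order.trans[OF assms(3)]) (intro mult_right_mono, auto)
    show "norm (f (x + k) - f x - f' x k) \<le> (\<bar>C0\<bar> + \<bar>C1\<bar> + \<bar>C2\<bar>) * (norm k)\<^sup>2"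
      by (rule order.trans[OF assms(4)]) (intro mult_right_mono, auto)
  qed auto
qed

text \<open>The Lipschitz bound is a consequence: steps of length at most 1 are handled by the
  Taylor estimate, longer ones by boundedness.\<close>

lemma quad_diffE:
  assumes "quad_diff f f'"
  obtains C where "C \<ge> 0" "\<And>x. norm (f x) \<le> C" "\<And>x k. norm (f' x k) \<le> C * norm k"
    "\<And>x k. norm (f (x + k) - f x - f' x k) \<le> C * (norm k)\<^sup>2"
    "\<And>x y. norm (f x - f y) \<le> 2 * C * norm (x - y)"
proof -
  obtain C where C: "C \<ge> 0" "\<And>x. norm (f x) \<le> C" "\<And>x k. norm (f' x k) \<le> C * norm k"
    "\<And>x k. norm (f (x + k) - f x - f' x k) \<le> C * (norm k)\<^sup>2"
    using assms unfolding quad_diff_def by blast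
  have "norm (f x - f y) \<le> 2 * C * norm (x - y)" for x y
  proof (cases "norm (x - y) \<le> 1")
    case True
    define k where "k = x - y"
    have "f x - f y = (f (y + k) - f y - f' y k) + f' y k" by (simp add: k_def)
    then have "norm (f x - f y) \<le> C * (norm k)\<^sup>2 + C * norm k"
      using C(3,4) norm_triangle_mono by metis
    also have "(norm k)\<^sup>2 \<le> norm k"
      using True mult_left_mono[of "norm k" 1 "norm k"] by (simp add: k_def power2_eq_square)
    then have "C * (norm k)\<^sup>2 + C * norm k \<le> 2 * C * norm k"
      using mult_left_mono[OF _ C(1)] by fastforce
    finally show ?thesis by (simp add: k_def)
  next
    case False
    have "norm (f x - f y) \<le> C + C" using C(2) norm_triangle_ineq4 add_mono order.trans by meson
    also have "\<dots> \<le> 2 * C * norm (x - y)" using False C(1) mult_left_mono[of 1 "norm (x - y)" "2 * C"] by simp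
    finally show ?thesis .
  qed
  then show ?thesis using that C by blast
qed

lemma quad_diff_linear: "quad_diff f f' \<Longrightarrow> linear (f' x)"
  by (simp add: quad_diff_def)

lemma quad_diff_has_derivative:
  assumes "quad_diff f f'"
  shows "(f has_derivative f' x) (at x)"
proof -
  obtain C where C: "C \<ge> 0" "\<And>x. norm (f x) \<le> C" "\<And>x k. norm (f' x k) \<le> C * norm k"
    "\<And>x k. norm (f (x + k) - f x - f' x k) \<le> C * (norm k)\<^sup>2"
    "\<And>x y. norm (f x - f y) \<le> 2 * C * norm (x - y)"
    using assms by (rule quad_diffE) (rule that)
  have bl: "bounded_linear (f' x)"
  proof (rule bounded_linear_intro[where K=C])
    show "norm (f' x k) \<le> norm k * C" for k using C(3)[of x k] by (simp add: mult.commute)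
  qed (simp_all add: linear_add linear_scale quad_diff_linear[OF assms])
  have "((\<lambda>k. norm (f (x + k) - f x - f' x k) / norm k) \<longlongrightarrow> 0) (at 0)"
  proof (rule Lim_null_comparison)
    show "\<forall>\<^sub>F k in at 0. norm (norm (f (x + k) - f x - f' x k) / norm k) \<le> C * norm k"
    proof (rule always_eventually, rule allI)
      fix k
      have "norm (norm (f (x + k) - f x - f' x k) / norm k) \<le> C * (norm k)\<^sup>2 / norm k"
        using C(4)[of x k] by (simp add: divide_right_mono)
      also have "\<dots> = C * norm k" by (simp add: power2_eq_square)
      finally show "norm (norm (f (x + k) - f x - f' x k) / norm k) \<le> C * norm k" .
    qed
    show "((\<lambda>k. C * norm k) \<longlongrightarrow> 0) (at 0)" by (auto intro!: tendsto_eq_intros)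
  qed
  with bl show ?thesis by (simp add: has_derivative_at)
qed

lemma quad_diff_continuous: "quad_diff f f' \<Longrightarrow> continuous_on A f"
  by (meson quad_diff_has_derivative has_derivative_continuous continuous_at_imp_continuous_on)

lemma quad_diff_bounded_linear:
  assumes "bounded_linear T" "quad_diff f f'"
  shows "quad_diff (\<lambda>x. T (f x)) (\<lambda>x k. T (f' x k))"
proof -
  interpret T: bounded_linear T by fact
  obtain K where K: "K > 0" "\<And>x. norm (T x) \<le> norm x * K" using T.pos_bounded by blast
  obtain C where C: "C \<ge> 0" "\<And>x. norm (f x) \<le> C" "\<And>x k. norm (f' x k) \<le> C * norm k"
    "\<And>x k. norm (f (x + k) - f x - f' x k) \<le> C * (norm k)\<^sup>2"
    "\<And>x y. norm (f x - f y) \<le> 2 * C * norm (x - y)"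
    using assms(2) by (rule quad_diffE) (rule that)
  show ?thesis
  proof (rule quad_diffI)
    show "linear (\<lambda>k. T (f' x k))" for x
      using linear_compose[OF quad_diff_linear[OF assms(2)] T.linear] by (simp add: o_def)
    show "norm (T (f x)) \<le> C * K" for x
      using order.trans[OF K(2) mult_right_mono[OF C(2)]] K(1) by simp
    show "norm (T (f' x k)) \<le> (C * K) * norm k" for x k
      using order.trans[OF K(2) mult_right_mono[OF C(3)]] K(1) by (simp add: mult_ac)
    show "norm (T (f (x + k)) - T (f x) - T (f' x k)) \<le> (C * K) * (norm k)\<^sup>2" for x k
      using order.trans[OF K(2) mult_right_mono[OF C(4)]] K(1) by (simp add: mult_ac flip: T.diff)
  qed
qed

lemma quad_diff_add:
  assumes "quad_diff f f'" "quad_diff g g'"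
  shows "quad_diff (\<lambda>x. f x + g x) (\<lambda>x k. f' x k + g' x k)"
proof -
  obtain C where C: "C \<ge> 0" "\<And>x. norm (f x) \<le> C" "\<And>x k. norm (f' x k) \<le> C * norm k"
    "\<And>x k. norm (f (x + k) - f x - f' x k) \<le> C * (norm k)\<^sup>2"
    "\<And>x y. norm (f x - f y) \<le> 2 * C * norm (x - y)"
    using assms(1) by (rule quad_diffE) (rule that)
  obtain D where D: "D \<ge> 0" "\<And>x. norm (g x) \<le> D" "\<And>x k. norm (g' x k) \<le> D * norm k"
    "\<And>x k. norm (g (x + k) - g x - g' x k) \<le> D * (norm k)\<^sup>2"
    "\<And>x y. norm (g x - g y) \<le> 2 * D * norm (x - y)"
    using assms(2) by (rule quad_diffE) (rule that)
  show ?thesis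
  proof (rule quad_diffI)
    show "linear (\<lambda>k. f' x k + g' x k)" for x
      by (intro linear_compose_add quad_diff_linear[OF assms(1)] quad_diff_linear[OF assms(2)])
    show "norm (f x + g x) \<le> C + D" for x using C(2) D(2) by (rule norm_triangle_mono)
    show "norm (f' x k + g' x k) \<le> (C + D) * norm k" for x k
      using norm_triangle_mono[OF C(3) D(3)] by (simp add: distrib_right)
    show "norm (f (x + k) + g (x + k) - (f x + g x) - (f' x k + g' x k)) \<le> (C + D) * (norm k)\<^sup>2" for x k
      using norm_triangle_mono[OF C(4)[of x k] D(4)[of x k]] by (simp add: algebra_simps)
  qed
qed

lemma quad_diff_bilinear:
  assumes "bounded_bilinear mul" "quad_diff f f'" "quad_diff g g'"
  shows "quad_diff (\<lambda>x. mul (f x) (g x)) (\<lambda>x k. mul (f x) (g' x k) + mul (f' x k) (g x))"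
proof -
  interpret bounded_bilinear mul by fact
  obtain K where K: "K > 0" "\<And>x y. norm (mul x y) \<le> norm x * norm y * K" using pos_bounded by blast
  obtain C where C: "C \<ge> 0" "\<And>x. norm (f x) \<le> C" "\<And>x k. norm (f' x k) \<le> C * norm k"
    "\<And>x k. norm (f (x + k) - f x - f' x k) \<le> C * (norm k)\<^sup>2"
    "\<And>x y. norm (f x - f y) \<le> 2 * C * norm (x - y)"
    using assms(2) by (rule quad_diffE) (rule that)
  obtain D where D: "D \<ge> 0" "\<And>x. norm (g x) \<le> D" "\<And>x k. norm (g' x k) \<le> D * norm k"
    "\<And>x k. norm (g (x + k) - g x - g' x k) \<le> D * (norm k)\<^sup>2"
    "\<And>x y. norm (g x - g y) \<le> 2 * D * norm (x - y)"
    using assms(3) by (rule quad_diffE) (rule that)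
  have K2: "norm (mul x y) \<le> a * b * K" if "norm x \<le> a" "norm y \<le> b" for x y a b
  proof -
    have "0 \<le> a" using that(1) norm_ge_zero order.trans by blast
    then have "norm x * norm y \<le> a * b" using that by (intro mult_mono) auto
    then have "norm x * norm y * K \<le> a * b * K" using K(1) by (intro mult_right_mono) auto
    then show ?thesis using K(2)[of x y] by linarith
  qed
  show ?thesis
  proof (rule quad_diffI)
    show "linear (\<lambda>k. mul (f x) (g' x k) + mul (f' x k) (g x))" for x
    proof -
      have "linear (\<lambda>k. mul (f x) (g' x k))"
        using linear_compose[OF quad_diff_linear[OF assms(3)] bounded_linear.linear[OF bounded_linear_right]]
        by (simp add: o_def)
      moreover have "linear (\<lambda>k. mul (f' x k) (g x))"
        using linear_compose[OF quad_diff_linear[OF assms(2)] bounded_linear.linear[OF bounded_linear_left]]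
        by (simp add: o_def)
      ultimately show ?thesis by (rule linear_compose_add)
    qed
    show "norm (mul (f x) (g x)) \<le> C * D * K" for x by (rule K2[OF C(2) D(2)])
    show "norm (mul (f x) (g' x k) + mul (f' x k) (g x)) \<le> (2 * C * D * K) * norm k" for x k
      using norm_triangle_mono[OF K2[OF C(2)[of x] D(3)[of x k]] K2[OF C(3)[of x k] D(2)[of x]]]
      by (simp add: mult_ac)
    show "norm (mul (f (x + k)) (g (x + k)) - mul (f x) (g x) - (mul (f x) (g' x k) + mul (f' x k) (g x)))
        \<le> (6 * C * D * K) * (norm k)\<^sup>2" (is "norm ?lhs \<le> _") for x k
    proof -
      \<comment> \<open>The remainder of a product splits into one remainder for each factor and the
        product of the two increments. The Lipschitz bounds contribute \<open>2 * 2\<close> for the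
        last piece, hence the constant 6.\<close>
      have "?lhs = mul (f x) (g (x + k) - g x - g' x k) + mul (f (x + k) - f x - f' x k) (g x)
          + mul (f (x + k) - f x) (g (x + k) - g x)"
        by (simp add: add_left add_right diff_left diff_right)
      moreover have "norm (mul (f (x + k) - f x) (g (x + k) - g x)) \<le> (2 * C * norm k) * (2 * D * norm k) * K"
        using C(5)[of "x + k" x] D(5)[of "x + k" x] by (intro K2) simp_all
      ultimately have "norm ?lhs
        \<le> C * (D * (norm k)\<^sup>2) * K + (C * (norm k)\<^sup>2) * D * K + (2 * C * norm k) * (2 * D * norm k) * K"
        using norm_triangle_mono[OF norm_triangle_mono[OF K2[OF C(2)[of x] D(4)[of x k]] K2[OF C(4)[of x k] D(2)[of x]]]]
        by metis
      also have "\<dots> = (6 * C * D * K) * (norm k)\<^sup>2"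
        by (simp add: algebra_simps power2_eq_square)
      finally show ?thesis .
    qed
  qed
qed

text \<open>First and second partial derivatives of a kernel are kernels and so are bounded. Hence
  the derivative is globally Lipschitz, which makes the linearisation error quadratic.\<close>

lemma kernel_quad_diff:
  assumes k: "smooth_kernel e k"
  shows "quad_diff k (\<lambda>x h. pderiv_at k h x)"
proof -
  have lin: "linear (frechet_derivative k (at x))" for x
    using kernel_has_derivative[OF k] has_derivative_linear by blast
  have "\<forall>b. \<exists>C\<ge>0. \<forall>x. \<bar>pderiv_at k b x\<bar> \<le> C"
    using kernel_bounded[OF kernel_pderiv[OF k]] by metis
  then obtain C1 where C1: "\<And>b. C1 b \<ge> 0" "\<And>b x. \<bar>pderiv_at k b x\<bar> \<le> C1 b" by metis
  have "\<forall>b c. \<exists>C\<ge>0. \<forall>x. \<bar>pderiv_at (pderiv_at k b) c x\<bar> \<le> C"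
    using kernel_bounded[OF kernel_pderiv[OF kernel_pderiv[OF k]]] by metis
  then obtain C2 where C2: "\<And>b c. C2 b c \<ge> 0" "\<And>b c x. \<bar>pderiv_at (pderiv_at k b) c x\<bar> \<le> C2 b c" by metis
  define L where "L b = (\<Sum>c\<in>Basis. C2 b c)" for b
  have Lip: "\<bar>pderiv_at k b x - pderiv_at k b y\<bar> \<le> L b * norm (x - y)" for b x y
  proof -
    have "norm (pderiv_at k b x - pderiv_at k b y) \<le> L b * norm (x - y)"
    proof (rule differentiable_bound[of UNIV])
      fix z
      show "(pderiv_at k b has_derivative frechet_derivative (pderiv_at k b) (at z)) (at z within UNIV)"
        using kernel_has_derivative[OF kernel_pderiv[OF k]] by simp
      show "onorm (frechet_derivative (pderiv_at k b) (at z)) \<le> L b"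
      proof (rule onorm_le)
        fix h :: 'a
        have "norm (frechet_derivative (pderiv_at k b) (at z) h)
            \<le> norm h * (\<Sum>c\<in>Basis. norm (frechet_derivative (pderiv_at k b) (at z) c))"
          by (intro linear_norm_le_sum_Basis has_derivative_linear[OF kernel_has_derivative[OF kernel_pderiv[OF k]]])
        also have "\<dots> \<le> norm h * L b"
          unfolding L_def using C2(2) by (intro mult_left_mono sum_mono) auto
        finally show "norm (frechet_derivative (pderiv_at k b) (at z) h) \<le> L b * norm h" by (simp add: mult.commute)
      qed
    qed auto
    then show ?thesis by simp
  qed
  obtain C0 where C0: "\<And>x. \<bar>k x\<bar> \<le> C0" using kernel_bounded[OF k] by metis
  define S where "S = (\<Sum>b\<in>Basis. L b)"
  show ?thesis
  proof (rule quad_diffI[of _ _ C0 "\<Sum>b\<in>Basis. C1 b" S])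
    fix x h
    show "norm (k x) \<le> C0" using C0 by simp
    show "norm (pderiv_at k h x) \<le> (\<Sum>b\<in>Basis. C1 b) * norm h"
    proof -
      have "norm (pderiv_at k h x) \<le> norm h * (\<Sum>b\<in>Basis. norm (pderiv_at k b x))"
        by (rule linear_norm_le_sum_Basis[OF lin])
      also have "\<dots> \<le> norm h * (\<Sum>b\<in>Basis. C1 b)" using C1(2) by (intro mult_left_mono sum_mono) auto
      finally show ?thesis by (simp add: mult.commute)
    qed
    have "norm (k (x + h) - k x - pderiv_at k (x + h - x) x) \<le> norm (x + h - x) * (norm h * S)"
    proof (rule differentiable_bound_linearization[where S="cball x (norm h)"])
      show "x + t *\<^sub>R (x + h - x) \<in> cball x (norm h)" if "t \<in> {0..1}" for t
        using that by (simp add: dist_norm mult_left_le_one_le)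
      show "(k has_derivative frechet_derivative k (at y)) (at y within cball x (norm h))" for y
        by (rule has_derivative_at_withinI[OF kernel_has_derivative[OF k]])
      show "onorm (frechet_derivative k (at y) - frechet_derivative k (at x)) \<le> norm h * S"
        if "y \<in> cball x (norm h)" for y
      proof (rule onorm_le)
        fix j :: 'a
        have "norm ((frechet_derivative k (at y) - frechet_derivative k (at x)) j)
          \<le> norm j * (\<Sum>b\<in>Basis. norm ((frechet_derivative k (at y) - frechet_derivative k (at x)) b))"
          by (rule linear_norm_le_sum_Basis) (simp add: fun_diff_def linear_compose_sub lin)
        also have "\<dots> \<le> norm j * (\<Sum>b\<in>Basis. norm h * L b)"
        proof (intro mult_left_mono sum_mono)
          fix b :: 'a
          have "norm ((frechet_derivative k (at y) - frechet_derivative k (at x)) b) \<le> L b * norm (y - x)"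
            using Lip[where b=b and x=y and y=x] by simp
          also have "\<dots> \<le> L b * norm h"
            using that C2(1) by (intro mult_left_mono) (auto simp: L_def dist_norm norm_minus_commute sum_nonneg)
          finally show "norm ((frechet_derivative k (at y) - frechet_derivative k (at x)) b) \<le> norm h * L b"
            by (simp add: mult.commute)
        qed auto
        finally show "norm ((frechet_derivative k (at y) - frechet_derivative k (at x)) j) \<le> norm h * S * norm j"
          by (simp add: S_def sum_distrib_left mult_ac)
      qed
    qed auto
    then show "norm (k (x + h) - k x - pderiv_at k h x) \<le> S * (norm h)\<^sup>2"
      by (simp add: power2_eq_square mult_ac)
  qed (rule lin)
qed

text \<open>Every radius has its own profile, normalised by its own integral, instead of being
  rescaled from a fixed one.\<close>

definition mollifier :: "real \<Rightarrow> 'a::euclidean_space \<Rightarrow> real" where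
  "mollifier e x = flat_exp 0 (e\<^sup>2 - x \<bullet> x) / (LINT y|lborel. flat_exp 0 (e\<^sup>2 - (y::'a) \<bullet> y))"

lemma kernel_flat:
  assumes "e > 0"
  shows "smooth_kernel e (\<lambda>x. flat_exp m (e\<^sup>2 - x \<bullet> x))"
  unfolding smooth_kernel_def
proof (intro conjI allI impI)
  show "bump_poly (\<lambda>x. flat_exp m (e\<^sup>2 - x \<bullet> x))" using bump_poly.flat[of m "e\<^sup>2" 0] by simp
  fix x :: 'a assume "e < norm x"
  then have "e\<^sup>2 \<le> x \<bullet> x" using assms by (simp add: power_mono flip: power2_norm_eq_inner)
  then show "flat_exp m (e\<^sup>2 - x \<bullet> x) = 0" by (simp add: flat_exp_def)
qed

lemma integral_flat_exp_pos:
  assumes e: "e > 0"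
  shows "0 < (LINT y|lborel. flat_exp 0 (e\<^sup>2 - (y::'a::euclidean_space) \<bullet> y))"
proof -
  let ?f = "\<lambda>x::'a. flat_exp 0 (e\<^sup>2 - x \<bullet> x)"
  have i: "integrable lborel ?f" by (rule kernel_integrable[OF kernel_flat[OF e]])
  have "integral\<^sup>L lborel ?f \<noteq> 0"
  proof
    assume "integral\<^sup>L lborel ?f = 0"
    then have "AE x in lborel. ?f x = 0"
      using integral_nonneg_eq_0_iff_AE[OF i] by (simp add: flat_exp_nonneg)
    then have "AE x in lborel. x \<notin> ball (0::'a) e"
    proof eventually_elim
      case (elim x)
      have "\<not> norm x < e"
      proof
        assume "norm x < e"
        then have "(norm x)\<^sup>2 < e\<^sup>2" by (intro power_strict_mono) auto
        then have "0 < ?f x" by (simp add: flat_exp_def power2_norm_eq_inner)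
        with elim show False by simp
      qed
      then show ?case by simp
    qed
    then have "ball (0::'a) e \<in> null_sets lborel"
      using AE_iff_null_sets[of "ball (0::'a) e" lborel] by simp
    then have "ball (0::'a) e \<in> null_sets lebesgue" by (rule null_sets_completionI)
    then have "negligible (ball (0::'a) e)" by (simp only: negligible_iff_null_sets)
    then show False using open_not_negligible[of "ball (0::'a) e"] e by simp
  qed
  moreover have "integral\<^sup>L lborel ?f \<ge> 0"
    by (rule Bochner_Integration.integral_nonneg) (rule flat_exp_nonneg)
  ultimately show ?thesis by linarith
qed

lemma mollifier_nonneg: "e > 0 \<Longrightarrow> 0 \<le> mollifier e x"
  unfolding mollifier_def
  by (rule divide_nonneg_pos[OF flat_exp_nonneg integral_flat_exp_pos])

lemma integral_mollifier: "e > 0 \<Longrightarrow> (LINT x|lborel. mollifier e (x::'a::euclidean_space)) = 1"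
  unfolding mollifier_def using integral_flat_exp_pos[where 'a='a, of e] by simp

lemma kernel_mollifier:
  assumes e: "e > 0"
  shows "smooth_kernel e (mollifier e :: 'a::euclidean_space \<Rightarrow> real)"
proof -
  define r where "r = inverse (LINT y|lborel. flat_exp 0 (e\<^sup>2 - (y::'a) \<bullet> y))"
  have "mollifier e = (\<lambda>x::'a. r * flat_exp 0 (e\<^sup>2 - x \<bullet> x))"
    by (simp add: fun_eq_iff mollifier_def r_def divide_inverse mult.commute)
  moreover have "smooth_kernel e (\<lambda>x::'a. r * flat_exp 0 (e\<^sup>2 - x \<bullet> x))"
    unfolding smooth_kernel_def
  proof (intro conjI allI impI)
    show "bump_poly (\<lambda>x::'a. r * flat_exp 0 (e\<^sup>2 - x \<bullet> x))"
      by (rule bump_poly.mult[OF bump_poly.const kernelD(1)[OF kernel_flat[OF e]]])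
    show "r * flat_exp 0 (e\<^sup>2 - x \<bullet> x) = 0" if "e < norm x" for x :: 'a
      using kernelD(2)[OF kernel_flat[OF e] that, of 0] by simp
  qed
  ultimately show ?thesis by simp
qed

text \<open>The mollifier is a function of \<open>x \<bullet> x\<close>, and the explicit second
  derivative is visibly symmetric in the two directions. This symmetry is what later cancels the
  second derivatives of the mollified \<open>u\<close> in the curvature.\<close>

lemma pderiv_mollifier_commute:
  fixes b c x :: "'a::euclidean_space"
  assumes e: "e > 0"
  shows "pderiv_at (pderiv_at (mollifier e) b) c x = pderiv_at (pderiv_at (mollifier e) c) b x"
proof -
  define I where "I = (LINT y|lborel. flat_exp 0 (e\<^sup>2 - (y::'a) \<bullet> y))"
  define h where "h m x = flat_exp m (e\<^sup>2 - x \<bullet> x) / I" for m and x :: 'a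
  have dh: "(h m has_derivative (\<lambda>v. (h (m + 2) x - m * h (m + 1) x) * (- 2 * (x \<bullet> v)))) (at x)" for m x
  proof -
    have "((\<lambda>x::'a. e\<^sup>2 - x \<bullet> x) has_derivative (\<lambda>v. - 2 * (x \<bullet> v))) (at x)"
      by (auto intro!: derivative_eq_intros simp: inner_commute)
    from has_derivative_compose[OF this flat_exp_deriv[unfolded has_field_derivative_def, of m]]
    have "((\<lambda>x. flat_exp m (e\<^sup>2 - x \<bullet> x)) has_derivative
        (\<lambda>v. (flat_exp (m + 2) (e\<^sup>2 - x \<bullet> x) - m * flat_exp (m + 1) (e\<^sup>2 - x \<bullet> x)) * (- 2 * (x \<bullet> v)))) (at x)" .
    from has_derivative_mult_right[OF this, of "inverse I"] show ?thesis
      unfolding h_def by (simp add: divide_inverse algebra_simps)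
  qed
  have m0: "mollifier e = h 0" by (simp add: fun_eq_iff mollifier_def h_def I_def)
  have 1: "pderiv_at (mollifier e) b = (\<lambda>x. h 2 x * (- 2 * (x \<bullet> b)))" for b :: 'a
    unfolding m0
  proof
    fix x :: 'a
    show "pderiv_at (h 0) b x = h 2 x * (- 2 * (x \<bullet> b))"
      using fun_cong[OF frechet_derivative_at[OF dh[of 0 x]], of b] by (simp add: numeral_2_eq_2)
  qed
  have 2: "((\<lambda>x. h 2 x * (- 2 * (x \<bullet> b))) has_derivative
      (\<lambda>v. h 2 x * (- 2 * (v \<bullet> b)) + ((h 4 x - 2 * h 3 x) * (- 2 * (x \<bullet> v))) * (- 2 * (x \<bullet> b)))) (at x)" for b x :: 'a
  proof -
    have d: "((\<lambda>x. - 2 * (x \<bullet> b)) has_derivative (\<lambda>v. - 2 * (v \<bullet> b))) (at x)"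
      by (rule has_derivative_mult_right[OF has_derivative_inner_left[OF has_derivative_ident]])
    show ?thesis
      by (rule has_derivative_eq_rhs[OF has_derivative_mult[OF dh[of 2 x] d]]) (simp add: fun_eq_iff)
  qed
  have "pderiv_at (pderiv_at (mollifier e) b) c x
      = h 2 x * (- 2 * (c \<bullet> b)) + ((h 4 x - 2 * h 3 x) * (- 2 * (x \<bullet> c))) * (- 2 * (x \<bullet> b))" for b c :: 'a
    unfolding 1[of b] using fun_cong[OF frechet_derivative_at[OF 2[where b=b and x=x]], of c] by (rule sym)
  from this[of b c] this[of c b] show ?thesis by (simp add: inner_commute)
qed

section \<open>Mollification\<close>

definition conv :: "('a::euclidean_space \<Rightarrow> 'b::{banach, second_countable_topology}) \<Rightarrow> ('a \<Rightarrow> real) \<Rightarrow> 'a \<Rightarrow> 'b" where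
  "conv f k x = (LINT y|lborel. k (x - y) *\<^sub>R f y)"

lemma lborel_distr_reflect: "distr lborel borel (\<lambda>y. x - y) = (lborel :: 'a::euclidean_space measure)"
  using lborel_affine[of "-1" x] by (simp add: density_1)

lemma integral_lborel_reflect:
  fixes x :: "'a::euclidean_space" and f :: "'a \<Rightarrow> 'b::{banach, second_countable_topology}"
  assumes [measurable]: "f \<in> borel_measurable borel"
  shows "(LINT y|lborel. f (x - y)) = (LINT y|lborel. f y)"
  by (subst (2) lborel_distr_reflect[of x, symmetric]) (simp add: integral_distr)

lemma integral_lborel_shift:
  fixes x :: "'a::euclidean_space" and f :: "'a \<Rightarrow> 'b::{banach, second_countable_topology}"
  assumes [measurable]: "f \<in> borel_measurable borel"
  shows "(LINT y|lborel. f (x + y)) = (LINT y|lborel. f y)"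
  by (subst (2) lborel_distr_plus[of x, symmetric]) (simp add: integral_distr)

text \<open>A function that is not integrable has Bochner integral 0 by convention, so the bound
  holds in that case too, \<open>g\<close> being nonnegative almost everywhere.\<close>

lemma norm_integral_le_AE:
  fixes f :: "'a \<Rightarrow> 'b::{banach, second_countable_topology}"
  assumes "integrable M g" "AE x in M. norm (f x) \<le> g x"
  shows "norm (LINT x|M. f x) \<le> (LINT x|M. g x)"
proof (cases "integrable M f")
  case True
  then have "norm (LINT x|M. f x) \<le> (LINT x|M. norm (f x))" by simp
  also have "\<dots> \<le> (LINT x|M. g x)" using True assms by (intro integral_mono_AE) auto
  finally show ?thesis .
next
  case False
  have "0 \<le> (LINT x|M. g x)"
    using assms(2) by (intro integral_nonneg_AE) (auto elim!: eventually_mono intro: order.trans[OF norm_ge_zero])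
  then show ?thesis using False by (simp add: not_integrable_integral_eq)
qed

lemma integrable_scaleR_bounded:
  fixes f :: "'a \<Rightarrow> 'b::{banach, second_countable_topology}"
  assumes "integrable M f" "g \<in> borel_measurable M" "\<And>y. \<bar>g y\<bar> \<le> C"
  shows "integrable M (\<lambda>y. g y *\<^sub>R f y)"
proof (rule Bochner_Integration.integrable_bound)
  show "integrable M (\<lambda>y. C * norm (f y))" using assms(1) by simp
  show "(\<lambda>y. g y *\<^sub>R f y) \<in> borel_measurable M" using assms by simp
  show "AE y in M. norm (g y *\<^sub>R f y) \<le> norm (C * norm (f y))"
  proof (rule AE_I2)
    fix y
    have "norm (g y *\<^sub>R f y) \<le> C * norm (f y)" using assms(3)[of y] by (simp add: mult_right_mono)
    then show "norm (g y *\<^sub>R f y) \<le> norm (C * norm (f y))" by simp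
  qed
qed

lemma norm_integral_scaleR_le:
  fixes f :: "'a \<Rightarrow> 'b::{banach, second_countable_topology}"
  assumes "integrable M f" "g \<in> borel_measurable M" "\<And>y. \<bar>g y\<bar> \<le> C"
  shows "norm (LINT y|M. g y *\<^sub>R f y) \<le> C * (LINT y|M. norm (f y))"
proof -
  have "norm (LINT y|M. g y *\<^sub>R f y) \<le> (LINT y|M. C * norm (f y))"
  proof (rule norm_integral_le_AE)
    show "integrable M (\<lambda>y. C * norm (f y))" using assms(1) by simp
    show "AE y in M. norm (g y *\<^sub>R f y) \<le> C * norm (f y)"
      using assms(3) by (intro AE_I2) (simp add: mult_right_mono)
  qed
  then show ?thesis by simp
qed

lemma kernel_reflect_measurable [measurable]:
  "smooth_kernel e k \<Longrightarrow> (\<lambda>y. k (x - y)) \<in> borel_measurable borel"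
  using measurable_compose[of "\<lambda>y. x - y" borel borel k borel] kernel_measurable by simp

lemma conv_integrable:
  fixes f :: "'a::euclidean_space \<Rightarrow> 'b::{banach, second_countable_topology}"
  assumes "smooth_kernel e k" "integrable lborel f"
  shows "integrable lborel (\<lambda>y. k (x - y) *\<^sub>R f y)"
proof -
  obtain C where "0 \<le> C" "\<And>x. \<bar>k x\<bar> \<le> C" using kernel_bounded[OF assms(1)] by blast
  then show ?thesis
    using kernel_reflect_measurable[OF assms(1), of x] by (intro integrable_scaleR_bounded[OF assms(2), of _ C]) auto
qed

lemma conv_bounded_linear:
  assumes "smooth_kernel e k" "integrable lborel f" "bounded_linear T"
  shows "T (conv f k x) = conv (\<lambda>y. T (f y)) k x"
  unfolding conv_def integral_bounded_linear[OF assms(3) conv_integrable[OF assms(1,2)], symmetric]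
  by (simp add: linear_scale[OF bounded_linear.linear[OF assms(3)]])

lemma conv_diff:
  assumes "smooth_kernel e k" "integrable lborel f" "integrable lborel g"
  shows "conv (\<lambda>y. f y - g y) k x = conv f k x - conv g k x"
  unfolding conv_def scaleR_diff_right
  by (intro Bochner_Integration.integral_diff conv_integrable[OF assms(1)] assms)

text \<open>The Taylor estimate of the kernel is uniform in the position. Integrated against
  \<open>f\<close> it becomes the estimate for the convolution, with the constant multiplied by the
  L^1 norm of \<open>f\<close>; the derivative falls on the kernel.\<close>

lemma quad_diff_conv:
  assumes k: "smooth_kernel e k" and f: "integrable lborel f"
  shows "quad_diff (conv f k) (\<lambda>x h. conv f (pderiv_at k h) x)"
proof -
  have lin: "linear (frechet_derivative k (at x))" for x
    using quad_diff_linear[OF kernel_quad_diff[OF k]] by simp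
  obtain C where C: "C \<ge> 0" "\<And>x. norm (k x) \<le> C" "\<And>x h. norm (pderiv_at k h x) \<le> C * norm h"
    "\<And>x h. norm (k (x + h) - k x - pderiv_at k h x) \<le> C * (norm h)\<^sup>2"
    "\<And>x y. norm (k x - k y) \<le> 2 * C * norm (x - y)"
    using kernel_quad_diff[OF k] by (rule quad_diffE) (rule that)
  let ?F = "LINT y|lborel. norm (f y)"
  have kd: "smooth_kernel e (pderiv_at k h)" for h by (rule kernel_pderiv[OF k])
  note I = conv_integrable[OF k f] conv_integrable[OF kd f]
  note [measurable] = kernel_reflect_measurable[OF k] kernel_reflect_measurable[OF kd]
  show ?thesis
  proof (rule quad_diffI[of _ _ "C * ?F" "C * ?F" "C * ?F"])
    fix x h
    show "linear (\<lambda>h. conv f (pderiv_at k h) x)"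
    proof (rule linearI)
      show "conv f (pderiv_at k (h + j)) x = conv f (pderiv_at k h) x + conv f (pderiv_at k j) x" for h j
        unfolding conv_def linear_add[OF lin] scaleR_add_left
        by (intro Bochner_Integration.integral_add I)
      show "conv f (pderiv_at k (r *\<^sub>R h)) x = r *\<^sub>R conv f (pderiv_at k h) x" for r h
        unfolding conv_def linear_scale[OF lin] by (simp flip: scaleR_scaleR)
    qed
    show "norm (conv f k x) \<le> C * ?F"
      unfolding conv_def using C(2) by (intro norm_integral_scaleR_le f) auto
    have "norm (conv f (pderiv_at k h) x) \<le> (C * norm h) * ?F"
      unfolding conv_def using C(3) by (intro norm_integral_scaleR_le f) auto
    then show "norm (conv f (pderiv_at k h) x) \<le> (C * ?F) * norm h" by (simp add: mult_ac)
    have "conv f k (x + h) - conv f k x - conv f (pderiv_at k h) x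
        = (LINT y|lborel. (k (x + h - y) - k (x - y) - pderiv_at k h (x - y)) *\<^sub>R f y)"
      unfolding conv_def scaleR_diff_left
      using I by (subst Bochner_Integration.integral_diff Bochner_Integration.integrable_diff | simp)+
    also have "norm \<dots> \<le> (C * (norm h)\<^sup>2) * ?F"
    proof (rule norm_integral_scaleR_le[OF f])
      show "\<bar>k (x + h - y) - k (x - y) - pderiv_at k h (x - y)\<bar> \<le> C * (norm h)\<^sup>2" for y
        using C(4)[of "x - y" h] by (simp add: add_diff_eq diff_add_eq)
    qed simp
    finally show "norm (conv f k (x + h) - conv f k x - conv f (pderiv_at k h) x) \<le> (C * ?F) * (norm h)\<^sup>2"
      by (simp add: mult_ac)
  qed
qed

lemma conv_measurable:
  "smooth_kernel e k \<Longrightarrow> integrable lborel f \<Longrightarrow> conv f k \<in> borel_measurable borel"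
  by (rule borel_measurable_continuous_onI[OF quad_diff_continuous[OF quad_diff_conv]])

lemma norm_conv_le:
  fixes f :: "'a::euclidean_space \<Rightarrow> 'b::{banach, second_countable_topology}"
  assumes "smooth_kernel e k" "integrable lborel f" "integrable lborel g" "\<And>x. 0 \<le> k x"
    "AE y in lborel. norm (f y) \<le> g y"
  shows "norm (conv f k x) \<le> conv g k x"
  unfolding conv_def
proof (rule norm_integral_le_AE)
  show "integrable lborel (\<lambda>y. k (x - y) *\<^sub>R g y)" by (rule conv_integrable[OF assms(1,3)])
  show "AE y in lborel. norm (k (x - y) *\<^sub>R f y) \<le> k (x - y) *\<^sub>R g y"
    using assms(5) by eventually_elim (simp add: assms(4) mult_left_mono)
qed

lemma integral_kernel_reflect:
  assumes "e > 0"
  shows "(LINT y|lborel. mollifier e (x - y)) = 1"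
  using integral_lborel_reflect[OF kernel_measurable[OF kernel_mollifier[OF assms]], of x]
    integral_mollifier[OF assms] by simp

text \<open>Jensen's inequality, obtained from nonnegativity of the variance of \<open>f\<close>
  about its mean \<open>c\<close> under the mollifier. It keeps squares of mollified fields below a
  mollified integrable function, hence under control in L^1.\<close>

lemma norm_conv_square_le:
  fixes f :: "'a::euclidean_space \<Rightarrow> 'b::euclidean_space"
  assumes e: "e > 0" and f: "integrable lborel f" and f2: "integrable lborel (\<lambda>y. (norm (f y))\<^sup>2)"
  shows "(norm (conv f (mollifier e) x))\<^sup>2 \<le> conv (\<lambda>y. (norm (f y))\<^sup>2) (mollifier e) x"
proof -
  let ?k = "\<lambda>y. mollifier e (x - y)"
  define c where "c = conv f (mollifier e) x"
  note k = kernel_mollifier[OF e]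
  \<comment> \<open>An integral different from the default value 0 certifies integrability.\<close>
  have ik: "integrable lborel ?k"
    using not_integrable_integral_eq[of lborel ?k] integral_kernel_reflect[OF e, of x] by fastforce
  have i1: "integrable lborel (\<lambda>y. ?k y *\<^sub>R f y)" by (rule conv_integrable[OF k f])
  have i2: "integrable lborel (\<lambda>y. ?k y * (norm (f y))\<^sup>2)" using conv_integrable[OF k f2] by simp
  have i3: "integrable lborel (\<lambda>y. (?k y *\<^sub>R f y) \<bullet> c)" by (rule integrable_inner_left[OF i1])
  have "0 \<le> (LINT y|lborel. ?k y * (norm (f y - c))\<^sup>2)"
    by (rule Bochner_Integration.integral_nonneg) (simp add: mollifier_nonneg[OF e])
  also have "(\<lambda>y. ?k y * (norm (f y - c))\<^sup>2)
      = (\<lambda>y. (?k y * (norm (f y))\<^sup>2 - 2 * ((?k y *\<^sub>R f y) \<bullet> c)) + (norm c)\<^sup>2 * ?k y)"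
    by (simp add: power2_norm_eq_inner inner_diff_left inner_diff_right inner_commute algebra_simps)
  also have "(LINT y|lborel. (?k y * (norm (f y))\<^sup>2 - 2 * ((?k y *\<^sub>R f y) \<bullet> c)) + (norm c)\<^sup>2 * ?k y)
      = (LINT y|lborel. ?k y * (norm (f y))\<^sup>2) - 2 * (LINT y|lborel. (?k y *\<^sub>R f y) \<bullet> c)
        + (norm c)\<^sup>2 * (LINT y|lborel. ?k y)"
    using i2 i3 ik by (simp del: inner_scaleR_left)
  also have "(LINT y|lborel. (?k y *\<^sub>R f y) \<bullet> c) = (norm c)\<^sup>2"
    using i1 by (simp only: integral_inner_left) (simp add: c_def conv_def power2_norm_eq_inner)
  also have "(LINT y|lborel. ?k y) = 1" by (rule integral_kernel_reflect[OF e])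
  finally show ?thesis by (simp add: c_def conv_def)
qed

text \<open>Tonelli, translation invariance and unit mass: mollification is a contraction of
  L^1.\<close>

lemma nn_integral_conv_le:
  fixes f :: "'a::euclidean_space \<Rightarrow> 'b::{banach, second_countable_topology}"
  assumes e: "e > 0" and f: "integrable lborel f"
  shows "(\<integral>\<^sup>+x. norm (conv f (mollifier e) x) \<partial>lborel) \<le> (\<integral>\<^sup>+x. norm (f x) \<partial>lborel)"
proof -
  note k = kernel_mollifier[OF e]
  note [measurable] = kernel_measurable[OF kernel_mollifier[OF e, where 'a='a]]
  have [measurable]: "f \<in> borel_measurable borel" using f by auto
  have "(\<integral>\<^sup>+x. norm (conv f (mollifier e) x) \<partial>lborel)
      \<le> (\<integral>\<^sup>+x. (\<integral>\<^sup>+y. ennreal (mollifier e (x - y)) * norm (f y) \<partial>lborel) \<partial>lborel)"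
  proof (rule nn_integral_mono)
    fix x
    have "ennreal (norm (conv f (mollifier e) x)) \<le> (\<integral>\<^sup>+y. norm (mollifier e (x - y) *\<^sub>R f y) \<partial>lborel)"
      unfolding conv_def by (rule integral_norm_bound_ennreal[OF conv_integrable[OF k f]])
    also have "\<dots> = (\<integral>\<^sup>+y. ennreal (mollifier e (x - y)) * norm (f y) \<partial>lborel)"
      by (intro nn_integral_cong) (simp add: mollifier_nonneg[OF e] ennreal_mult)
    finally show "ennreal (norm (conv f (mollifier e) x)) \<le> \<dots>" .
  qed
  also have "\<dots> = (\<integral>\<^sup>+y. (\<integral>\<^sup>+x. ennreal (mollifier e (x - y)) * norm (f y) \<partial>lborel) \<partial>lborel)"
    by (rule lborel_pair.Fubini') measurable
  also have "\<dots> = (\<integral>\<^sup>+y. norm (f y) \<partial>lborel)"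
  proof (rule nn_integral_cong)
    fix y :: 'a
    have "(\<integral>\<^sup>+x. ennreal (mollifier e (x - y)) \<partial>lborel) = (\<integral>\<^sup>+x. ennreal (mollifier e x) \<partial>distr lborel borel ((+) (- y)))"
      by (subst nn_integral_distr) (auto simp: add.commute)
    also have "\<dots> = ennreal (LINT x|lborel. mollifier e (x::'a))"
      unfolding lborel_distr_plus
      by (rule nn_integral_eq_integral[OF kernel_integrable[OF k]]) (simp add: mollifier_nonneg[OF e])
    finally show "(\<integral>\<^sup>+x. ennreal (mollifier e (x - y)) * norm (f y) \<partial>lborel) = norm (f y)"
      by (simp add: nn_integral_multc integral_mollifier[OF e])
  qed
  finally show ?thesis .
qed

lemma
  fixes f :: "'a::euclidean_space \<Rightarrow> 'b::{banach, second_countable_topology}"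
  assumes e: "e > 0" and f: "integrable lborel f"
  shows integrable_conv: "integrable lborel (conv f (mollifier e))"
    and integral_norm_conv_le: "(LINT x|lborel. norm (conv f (mollifier e) x)) \<le> (LINT x|lborel. norm (f x))"
proof -
  have nn: "(\<integral>\<^sup>+x. norm (f x) \<partial>lborel) = ennreal (LINT x|lborel. norm (f x))"
    using f by (intro nn_integral_eq_integral) auto
  note le = nn_integral_conv_le[OF e f, unfolded nn]
  have m: "conv f (mollifier e) \<in> borel_measurable lborel"
    using conv_measurable[OF kernel_mollifier[OF e] f] by simp
  show i: "integrable lborel (conv f (mollifier e))"
  proof (rule integrableI_bounded[OF m])
    show "(\<integral>\<^sup>+x. norm (conv f (mollifier e) x) \<partial>lborel) < \<infinity>"
      using le by (rule order.strict_trans1) simp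
  qed
  have "(\<integral>\<^sup>+x. norm (conv f (mollifier e) x) \<partial>lborel) = ennreal (LINT x|lborel. norm (conv f (mollifier e) x))"
    using i by (intro nn_integral_eq_integral) auto
  with le show "(LINT x|lborel. norm (conv f (mollifier e) x)) \<le> (LINT x|lborel. norm (f x))"
    by (simp add: ennreal_le_iff)
qed

text \<open>Regularity of the measure squeezes \<open>A\<close> between a closed set and an open
  set. Both are cut down to balls to force bounded support, and Urysohn's lemma interpolates between
  them.\<close>

lemma indicator_approx_continuous:
  fixes A :: "'a::euclidean_space set"
  assumes A: "A \<in> sets lborel" "emeasure lborel A < \<infinity>" and e: "e > 0"
  obtains g :: "'a \<Rightarrow> real" and R where "continuous_on UNIV g" "\<And>x. R < norm x \<Longrightarrow> g x = 0" "integrable lborel g"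
    "(LINT x|lborel. norm (indicator A x - g x)) < e"
proof -
  \<comment> \<open>The approximation fails only on three sets of measure at most \<open>d\<close>
    each; a quarter instead of a third leaves room for the strict inequality.\<close>
  define d where "d = e / 4"
  have d: "d > 0" using e by (simp add: d_def)
  have A': "A \<in> sets borel" using A by simp
  obtain U where U: "open U" "A \<subseteq> U" "emeasure lborel (U - A) < d"
    using outer_regular_lborel[OF A' d] by blast
  obtain V where V: "open V" "- A \<subseteq> V" "emeasure lborel (V - - A) < d"
    using outer_regular_lborel[OF borel_comp[OF A'] d] by blast
  define T where "T = - V"
  have T: "closed T" "T \<subseteq> A" "emeasure lborel (A - T) < d"
  proof -
    show "closed T" "T \<subseteq> A" using V by (auto simp: T_def)
    have "A - T = V - - A" by (auto simp: T_def)
    then show "emeasure lborel (A - T) < d" using V by simp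
  qed
  have Tfin: "emeasure lborel (T - cball 0 (real n)) \<noteq> \<infinity>" for n
  proof -
    have "emeasure lborel (T - cball 0 (real n)) \<le> emeasure lborel A"
      using T A by (intro emeasure_mono) auto
    then have "emeasure lborel (T - cball 0 (real n)) < \<infinity>" using A(2) by (rule order.strict_trans1)
    then show ?thesis by simp
  qed
  \<comment> \<open>\<open>T\<close> has finite measure but may be unbounded. By continuity from
    above, its part outside a large ball is negligible.\<close>
  have "(\<lambda>n. emeasure lborel (T - cball 0 (real n))) \<longlonglongrightarrow> emeasure lborel (\<Inter>n. T - cball 0 (real n))"
    using T(1) Tfin by (intro Lim_emeasure_decseq) (auto simp: decseq_def)
  also have "(\<Inter>n. T - cball 0 (real n)) = {}"
  proof -
    have "\<exists>n. x \<in> cball 0 (real n)" for x :: 'a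
      using real_arch_simple[of "norm x"] by simp
    then show ?thesis by blast
  qed
  finally have "\<forall>\<^sub>F n in sequentially. emeasure lborel (T - cball 0 (real n)) < ennreal d"
    using d by (intro order_tendstoD(2)) auto
  then obtain n where n: "emeasure lborel (T - cball 0 (real n)) < ennreal d"
    unfolding eventually_sequentially by blast
  define K where "K = T \<inter> cball 0 (real n)"
  define W where "W = U \<inter> ball 0 (real n + 1)"
  have KW: "closed K" "closed (- W)" "K \<inter> - W = {}" "W \<in> sets borel" "K \<in> sets borel" "K \<subseteq> A" "W - A \<subseteq> U - A"
    using T U by (auto simp: K_def W_def)
  obtain g :: "'a \<Rightarrow> real" where g: "continuous_on UNIV g" "\<And>x. g x \<in> closed_segment 1 0"
    "\<And>x. x \<in> K \<Longrightarrow> g x = 1" "\<And>x. x \<in> - W \<Longrightarrow> g x = 0"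
    by (rule Urysohn[OF KW(1-3), of 1 0]) (rule that)
  have g01: "0 \<le> g x" "g x \<le> 1" for x using g(2)[of x] by (auto simp: closed_segment_eq_real_ivl)
  have gR: "g x = 0" if "real n + 1 < norm x" for x using that g(4)[of x] by (simp add: W_def)
  have gi: "integrable lborel g"
  proof -
    have "integrable lborel (\<lambda>x. indicator (cball 0 (real n + 1)) x *\<^sub>R g x)"
      by (rule borel_integrable_compact[OF compact_cball continuous_on_subset[OF g(1)]]) simp
    also have "(\<lambda>x. indicator (cball 0 (real n + 1)) x *\<^sub>R g x) = g"
      using gR by (force simp: indicator_def not_le fun_eq_iff)
    finally show ?thesis .
  qed
  let ?D = "(U - A) \<union> ((A - T) \<union> (T - cball 0 (real n)))"
  have D: "?D \<in> sets lborel" using U T A by auto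
  have "emeasure lborel ?D \<le> emeasure lborel (U - A) + (emeasure lborel (A - T) + emeasure lborel (T - cball 0 (real n)))"
    using U T A by (intro order.trans[OF emeasure_subadditive] add_left_mono emeasure_subadditive) auto
  also have "\<dots> \<le> ennreal d + (ennreal d + ennreal d)"
    using U(3) T(3) n by (intro add_mono less_imp_le)
  also have "\<dots> = ennreal (3 * d)" using d by (simp flip: ennreal_plus)
  finally have Dle: "emeasure lborel ?D \<le> ennreal (3 * d)" .
  have Di: "integrable lborel (indicator ?D :: 'a \<Rightarrow> real)"
    using D Dle by (intro integrable_real_indicator) (auto simp: less_top[symmetric] top_unique)
  have Dm: "measure lborel ?D \<le> 3 * d"
    using Dle d by (simp add: measure_def enn2real_leI)
  have Ai: "integrable lborel (indicator A :: 'a \<Rightarrow> real)"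
    using A by (intro integrable_real_indicator) auto
  have "(LINT x|lborel. norm (indicator A x - g x)) \<le> (LINT x|lborel. indicator ?D x)"
  proof (rule integral_mono)
    show "integrable lborel (\<lambda>x. norm (indicator A x - g x))" using Ai gi by simp
    show "norm (indicator A x - g x) \<le> indicator ?D x" for x
    proof -
      have "norm (indicator A x - g x) \<le> 1" using g01[of x] by (auto simp: indicator_def)
      moreover have "indicator A x = g x" if "x \<notin> ?D"
      proof (cases "x \<in> A")
        case True
        with that have "x \<in> K" by (auto simp: K_def)
        with True g(3) show ?thesis by simp
      next
        case False
        with that have "x \<in> - W" by (auto simp: W_def)
        with False g(4) show ?thesis by simp
      qed
      ultimately show ?thesis by (auto simp: indicator_def)
    qed
  qed (rule Di)
  also have "\<dots> = measure lborel ?D" using D by simp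
  also have "\<dots> < e" using Dm d by (simp add: d_def)
  finally show ?thesis using that g(1) gR gi by blast
qed

lemma integrable_approx_continuous:
  fixes f :: "'a::euclidean_space \<Rightarrow> 'b::{banach, second_countable_topology}"
  assumes "integrable lborel f"
  shows "\<forall>e>0. \<exists>g R. continuous_on UNIV g \<and> (\<forall>x. R < norm x \<longrightarrow> g x = 0) \<and> integrable lborel g
    \<and> (LINT x|lborel. norm (f x - g x)) < e"
  using assms
proof induction
  case (base A c)
  show ?case
  proof (intro allI impI)
    fix e :: real assume e: "e > 0"
    have e': "e / (norm c + 1) > 0" using e by (simp add: add_nonneg_pos)
    obtain g :: "'a \<Rightarrow> real" and R where g: "continuous_on UNIV g" "\<And>x. R < norm x \<Longrightarrow> g x = 0" "integrable lborel g"
      "(LINT x|lborel. norm (indicator A x - g x)) < e / (norm c + 1)"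
      by (rule indicator_approx_continuous[OF base e']) (rule that)
    have "(LINT x|lborel. norm (indicator A x *\<^sub>R c - g x *\<^sub>R c)) = (LINT x|lborel. norm (indicator A x - g x) * norm c)"
      by (simp flip: scaleR_diff_left)
    also have "\<dots> = (LINT x|lborel. norm (indicator A x - g x)) * norm c" by simp
    also have "\<dots> \<le> (e / (norm c + 1)) * norm c" using g(4) by (intro mult_right_mono) auto
    also have "\<dots> < e" using e norm_ge_zero[of c] by (simp add: divide_less_eq add_nonneg_pos)
    finally show "\<exists>g R. continuous_on UNIV g \<and> (\<forall>x. R < norm x \<longrightarrow> g x = 0) \<and> integrable lborel g
        \<and> (LINT x|lborel. norm (indicator A x *\<^sub>R c - g x)) < e"
      using g by (intro exI[of _ "\<lambda>x. g x *\<^sub>R c"] exI[of _ R]) (auto intro!: continuous_intros)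
  qed
next
  case (add f1 f2)
  show ?case
  proof (intro allI impI)
    fix e :: real assume e: "e > 0"
    then have e2: "e / 2 > 0" by simp
    obtain g1 R1 where g1: "continuous_on UNIV g1" "\<And>x. R1 < norm x \<Longrightarrow> g1 x = 0" "integrable lborel g1"
      "(LINT x|lborel. norm (f1 x - g1 x)) < e / 2" using add.IH(1)[rule_format, OF e2] by blast
    obtain g2 R2 where g2: "continuous_on UNIV g2" "\<And>x. R2 < norm x \<Longrightarrow> g2 x = 0" "integrable lborel g2"
      "(LINT x|lborel. norm (f2 x - g2 x)) < e / 2" using add.IH(2)[rule_format, OF e2] by blast
    have "(LINT x|lborel. norm (f1 x + f2 x - (g1 x + g2 x))) \<le> (LINT x|lborel. norm (f1 x - g1 x) + norm (f2 x - g2 x))"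
    proof (rule integral_mono)
      show "norm (f1 x + f2 x - (g1 x + g2 x)) \<le> norm (f1 x - g1 x) + norm (f2 x - g2 x)" for x
        unfolding add_diff_add by (rule norm_triangle_ineq)
    qed (use add.hyps g1 g2 in auto)
    also have "\<dots> < e" using add.hyps g1(3,4) g2(3,4) by simp
    finally show "\<exists>g R. continuous_on UNIV g \<and> (\<forall>x. R < norm x \<longrightarrow> g x = 0) \<and> integrable lborel g
        \<and> (LINT x|lborel. norm (f1 x + f2 x - g x)) < e"
      using g1 g2 by (intro exI[of _ "\<lambda>x. g1 x + g2 x"] exI[of _ "max R1 R2"]) (auto intro!: continuous_intros)
  qed
next
  case (lim f s)
  show ?case
  proof (intro allI impI)
    fix e :: real assume e: "e > 0"
    have "(\<lambda>i. LINT x|lborel. norm (f x - s i x)) \<longlonglongrightarrow> (LINT x|lborel. norm (f x - f x))"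
    proof (rule integral_dominated_convergence)
      show "integrable lborel (\<lambda>x. 3 * norm (f x))" using lim.hyps by simp
      show "AE x in lborel. (\<lambda>i. norm (f x - s i x)) \<longlonglongrightarrow> norm (f x - f x)"
        using lim.hyps(2) by (intro AE_I2 tendsto_intros) auto
      show "AE x in lborel. norm (norm (f x - s i x)) \<le> 3 * norm (f x)" for i
      proof (rule AE_I2)
        fix x :: 'a assume "x \<in> space lborel"
        then show "norm (norm (f x - s i x)) \<le> 3 * norm (f x)"
          using lim.hyps(3)[of x i] norm_triangle_ineq4[of "f x" "s i x"] by simp
      qed
    qed (use lim.hyps in auto)
    then have "(\<lambda>i. LINT x|lborel. norm (f x - s i x)) \<longlonglongrightarrow> 0" by simp
    then have "\<forall>\<^sub>F i in sequentially. (LINT x|lborel. norm (f x - s i x)) < e / 2"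
      using e by (intro order_tendstoD(2)) auto
    then obtain i where i: "(LINT x|lborel. norm (f x - s i x)) < e / 2"
      unfolding eventually_sequentially by blast
    obtain g R where g: "continuous_on UNIV g" "\<And>x. R < norm x \<Longrightarrow> g x = 0" "integrable lborel g"
      "(LINT x|lborel. norm (s i x - g x)) < e / 2" using lim.IH[of i, rule_format, of "e / 2"] e by auto
    have "(LINT x|lborel. norm (f x - g x)) \<le> (LINT x|lborel. norm (f x - s i x) + norm (s i x - g x))"
      using lim.hyps g by (intro integral_mono norm_diff_triangle_le[OF order.refl order.refl]) auto
    also have "\<dots> < e" using lim.hyps g i by simp
    finally show "\<exists>g R. continuous_on UNIV g \<and> (\<forall>x. R < norm x \<longrightarrow> g x = 0) \<and> integrable lborel g
        \<and> (LINT x|lborel. norm (f x - g x)) < e"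
      using g by blast
  qed
qed

lemma conv_mollifier_minus:
  fixes f :: "'a::euclidean_space \<Rightarrow> 'b::{banach, second_countable_topology}"
  assumes e: "e > 0" and f: "integrable lborel f"
  shows "conv f (mollifier e) x - f x = (LINT y|lborel. mollifier e (x - y) *\<^sub>R (f y - f x))"
proof -
  note k = kernel_mollifier[OF e]
  have ik: "integrable lborel (\<lambda>y. mollifier e (x - y))"
    using not_integrable_integral_eq integral_kernel_reflect[OF e, of x] by fastforce
  have "(LINT y|lborel. mollifier e (x - y) *\<^sub>R (f y - f x))
      = (LINT y|lborel. mollifier e (x - y) *\<^sub>R f y) - (LINT y|lborel. mollifier e (x - y) *\<^sub>R f x)"
    unfolding scaleR_diff_right
    using ik by (intro Bochner_Integration.integral_diff conv_integrable[OF k f]) auto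
  also have "(LINT y|lborel. mollifier e (x - y) *\<^sub>R f x) = f x"
    using ik integral_kernel_reflect[OF e, of x] by simp
  finally show ?thesis by (simp add: conv_def)
qed

text \<open>For a continuous function of bounded support the convergence is uniform on a fixed ball.
  The general case follows because mollification contracts L^1, so the error of approximating
  \<open>f\<close> by \<open>g\<close> is paid only twice.\<close>

lemma conv_tendsto_L1:
  fixes f :: "'a::euclidean_space \<Rightarrow> 'b::{banach, second_countable_topology}"
  assumes f: "integrable lborel f" and e: "\<And>n. e n > 0" "e \<longlonglongrightarrow> 0"
  shows "(\<lambda>n. LINT x|lborel. norm (conv f (mollifier (e n)) x - f x)) \<longlonglongrightarrow> 0"
proof (rule LIMSEQ_I)
  fix r :: real assume r: "r > 0"
  obtain g R where g: "continuous_on UNIV g" "\<And>x. R < norm x \<Longrightarrow> g x = 0" "integrable lborel g"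
    "(LINT x|lborel. norm (f x - g x)) < r / 4"
    using integrable_approx_continuous[OF f, rule_format, of "r / 4"] r by auto
  \<comment> \<open>Once the radius is below 1, the mollified \<open>g\<close> lives on
    \<open>S\<close>. Uniform continuity is taken on a larger ball because the points averaged over
    leave \<open>S\<close> by less than 1, and \<open>m + 1\<close> avoids a division by a vanishing
    volume.\<close>
  define S where "S = cball (0::'a) (\<bar>R\<bar> + 1)"
  define m where "m = measure lborel S"
  have m: "m \<ge> 0" by (simp add: m_def)
  have "uniformly_continuous_on (cball 0 (\<bar>R\<bar> + 3)) g"
    by (intro compact_uniformly_continuous continuous_on_subset[OF g(1)]) auto
  then obtain d where d: "d > 0" "\<And>x y. x \<in> cball 0 (\<bar>R\<bar> + 3) \<Longrightarrow> y \<in> cball 0 (\<bar>R\<bar> + 3) \<Longrightarrow> dist y x < d \<Longrightarrow> dist (g y) (g x) < r / (4 * (m + 1))"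
    unfolding uniformly_continuous_on_def using r m by (metis add_nonneg_pos divide_pos_pos mult_pos_pos zero_less_numeral zero_less_one)
  have "\<forall>\<^sub>F n in sequentially. e n < min d 1" using e(2) d(1) by (intro order_tendstoD(2)) auto
  then obtain N where N: "\<And>n. n \<ge> N \<Longrightarrow> e n < min d 1" unfolding eventually_sequentially by blast
  show "\<exists>no. \<forall>n\<ge>no. norm ((LINT x|lborel. norm (conv f (mollifier (e n)) x - f x)) - 0) < r"
  proof (intro exI[of _ N] allI impI)
    fix n assume n: "n \<ge> N"
    let ?k = "mollifier (e n) :: 'a \<Rightarrow> real"
    note k = kernel_mollifier[OF e(1), of n, where 'a='a]
    have en: "e n < d" "e n < 1" using N[OF n] by auto
    have gc: "norm (conv g ?k x - g x) \<le> r / (4 * (m + 1)) * indicator S x" for x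
    proof (cases "x \<in> S")
      case True
      have "norm (LINT y|lborel. ?k (x - y) *\<^sub>R (g y - g x)) \<le> (LINT y|lborel. ?k (x - y) * (r / (4 * (m + 1))))"
      proof (rule norm_integral_le_AE)
        have ik: "integrable lborel (\<lambda>y. ?k (x - y))"
          using not_integrable_integral_eq integral_kernel_reflect[OF e(1), of n x] by fastforce
        then show "integrable lborel (\<lambda>y. ?k (x - y) * (r / (4 * (m + 1))))" by simp
        have "norm (?k (x - y) *\<^sub>R (g y - g x)) \<le> ?k (x - y) * (r / (4 * (m + 1)))" for y
        proof (cases "e n < norm (x - y)")
          case True
          then show ?thesis using kernelD(2)[OF k True] by simp
        next
          case False
          have xx: "norm x \<le> \<bar>R\<bar> + 1" using \<open>x \<in> S\<close> by (simp add: S_def)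
          have "norm y \<le> norm x + norm (x - y)" using norm_triangle_sub[of y x] by (simp add: norm_minus_commute)
          then have "dist (g y) (g x) < r / (4 * (m + 1))"
            using False en xx by (intro d(2)) (auto simp: dist_norm norm_minus_commute)
          then have "norm (g y - g x) \<le> r / (4 * (m + 1))" by (simp only: dist_norm less_imp_le)
          then have "?k (x - y) * norm (g y - g x) \<le> ?k (x - y) * (r / (4 * (m + 1)))"
            by (rule mult_left_mono[OF _ mollifier_nonneg[OF e(1)]])
          then show ?thesis by (simp only: norm_scaleR abs_of_nonneg[OF mollifier_nonneg[OF e(1)]])
        qed
        then show "AE y in lborel. norm (?k (x - y) *\<^sub>R (g y - g x)) \<le> ?k (x - y) * (r / (4 * (m + 1)))"
          by (intro AE_I2)
      qed
      also have "\<dots> = r / (4 * (m + 1))" using integral_kernel_reflect[OF e(1), of n x] by simp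
      finally show ?thesis using True by (simp add: conv_mollifier_minus[OF e(1) g(3)])
    next
      case False
      have z: "?k (x - y) *\<^sub>R g y = 0" for y
      proof (cases "e n < norm (x - y)")
        case True then show ?thesis using kernelD(2)[OF k True] by simp
      next
        case nT: False
        then have "R < norm y" using False en norm_triangle_sub[of x y] by (simp add: S_def)
        then show ?thesis using g(2) by simp
      qed
      have "R < norm x" using False by (simp add: S_def)
      then show ?thesis using g(2)[of x] False by (simp add: conv_def z)
    qed
    have Si: "integrable lborel (indicator S :: 'a \<Rightarrow> real)"
      unfolding S_def using emeasure_lborel_cball_finite by (intro integrable_real_indicator) auto
    have I: "integrable lborel (\<lambda>x. norm (conv (\<lambda>y. f y - g y) ?k x))" "integrable lborel (\<lambda>x. norm (f x - g x))"
      using integrable_conv[OF e(1), of "\<lambda>y. f y - g y" n] f g(3) by auto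
    have "(LINT x|lborel. norm (conv f ?k x - f x))
        \<le> (LINT x|lborel. (norm (conv (\<lambda>y. f y - g y) ?k x) + r / (4 * (m + 1)) * indicator S x) + norm (f x - g x))"
    proof (rule integral_mono)
      show "integrable lborel (\<lambda>x. norm (conv f ?k x - f x))" using integrable_conv[OF e(1) f] f by simp
      show "integrable lborel (\<lambda>x. (norm (conv (\<lambda>y. f y - g y) ?k x) + r / (4 * (m + 1)) * indicator S x) + norm (f x - g x))"
        by (intro Bochner_Integration.integrable_add I integrable_mult_right Si)
      fix x
      have "conv f ?k x - f x = (conv (\<lambda>y. f y - g y) ?k x + (conv g ?k x - g x)) - (f x - g x)"
        by (simp add: conv_diff[OF k f g(3)])
      also have "norm \<dots> \<le> (norm (conv (\<lambda>y. f y - g y) ?k x) + norm (conv g ?k x - g x)) + norm (f x - g x)"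
        by (intro norm_triangle_le_diff add_right_mono norm_triangle_ineq)
      also have "\<dots> \<le> (norm (conv (\<lambda>y. f y - g y) ?k x) + r / (4 * (m + 1)) * indicator S x) + norm (f x - g x)"
        using gc[of x] by simp
      finally show "norm (conv f ?k x - f x) \<le> \<dots>" .
    qed
    also have "\<dots> = (LINT x|lborel. norm (conv (\<lambda>y. f y - g y) ?k x)) + r / (4 * (m + 1)) * m + (LINT x|lborel. norm (f x - g x))"
      using I Si by (simp add: m_def S_def)
    also have "(LINT x|lborel. norm (conv (\<lambda>y. f y - g y) ?k x)) \<le> (LINT x|lborel. norm (f x - g x))"
      using f g(3) by (intro integral_norm_conv_le e(1)) auto
    also have "r / (4 * (m + 1)) * m \<le> r / 4" using r m by (simp add: field_simps)
    finally have "(LINT x|lborel. norm (conv f ?k x - f x)) < r" using g(4) r by simp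
    moreover have "(LINT x|lborel. norm (conv f ?k x - f x)) \<ge> 0"
      by (rule Bochner_Integration.integral_nonneg) simp
    ultimately show "norm ((LINT x|lborel. norm (conv f ?k x - f x)) - 0) < r" by simp
  qed
qed

lemma conv_tendsto_AE_subseq:
  fixes f :: "'a::euclidean_space \<Rightarrow> 'b::{banach, second_countable_topology}"
  assumes f: "integrable lborel f" and e: "\<And>n. e n > 0" "e \<longlonglongrightarrow> 0"
  obtains r where "strict_mono (r :: nat \<Rightarrow> nat)" "AE x in lborel. (\<lambda>n. conv f (mollifier (e (r n))) x) \<longlonglongrightarrow> f x"
proof -
  have "\<exists>r::nat\<Rightarrow>nat. strict_mono r \<and> (AE x in lborel. (\<lambda>n. conv f (mollifier (e (r n))) x - f x) \<longlonglongrightarrow> 0)"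
  proof (rule tendsto_L1_AE_subseq[where u="\<lambda>n x. conv f (mollifier (e n)) x - f x"])
    show "integrable lborel (\<lambda>x. conv f (mollifier (e n)) x - f x)" for n
      using integrable_conv[OF e(1) f] f by simp
  qed (rule conv_tendsto_L1[OF f e])
  then show ?thesis using that by (auto simp: LIM_zero_iff)
qed

text \<open>The fundamental lemma of the calculus of variations with mollifiers as the only test
  functions: near a given point of \<open>\<Omega>\<close> all sufficiently small radii are
  admissible, and mollifications converge almost everywhere along a subsequence.\<close>

lemma AE_zero_of_conv:
  fixes f :: "'a::euclidean_space \<Rightarrow> 'b::{banach, second_countable_topology}"
  assumes f: "integrable lborel f" and "open \<Omega>"
    and z: "\<And>e x. e > 0 \<Longrightarrow> cball x e \<subseteq> \<Omega> \<Longrightarrow> conv f (mollifier e) x = 0"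
  shows "AE x in lborel. x \<in> \<Omega> \<longrightarrow> f x = 0"
proof -
  define e where "e n = 1 / real (Suc n)" for n
  have e: "\<And>n. e n > 0" "e \<longlonglongrightarrow> 0"
    unfolding e_def using LIMSEQ_inverse_real_of_nat by (simp_all add: inverse_eq_divide)
  obtain r where r: "strict_mono (r :: nat \<Rightarrow> nat)" "AE x in lborel. (\<lambda>n. conv f (mollifier (e (r n))) x) \<longlonglongrightarrow> f x"
    using conv_tendsto_AE_subseq[OF f e] by metis
  show ?thesis
    using r(2)
  proof eventually_elim
    case (elim x)
    show ?case
    proof
      assume "x \<in> \<Omega>"
      then obtain d where d: "d > 0" "cball x d \<subseteq> \<Omega>" using \<open>open \<Omega>\<close> open_contains_cball by blast
      have "(\<lambda>n. e (r n)) \<longlonglongrightarrow> 0" using LIMSEQ_subseq_LIMSEQ[OF e(2) r(1)] by (simp add: o_def)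
      then have "\<forall>\<^sub>F n in sequentially. e (r n) < d" using d by (intro order_tendstoD(2)) auto
      then have "\<forall>\<^sub>F n in sequentially. conv f (mollifier (e (r n))) x = 0"
      proof eventually_elim
        case (elim n)
        then have "cball x (e (r n)) \<subseteq> \<Omega>" using d(2) by (meson less_imp_le order.trans subset_cball)
        then show ?case by (rule z[OF e(1)])
      qed
      then have "(\<lambda>n. conv f (mollifier (e (r n))) x) \<longlonglongrightarrow> 0" by (rule tendsto_eventually)
      then show "f x = 0" using elim LIMSEQ_unique by blast
    qed
  qed
qed

text \<open>Dominated convergence with dominating functions that vary with \<open>n\<close> and
  converge in L^1. This is the form required for products of mollified functions, whose natural
  bound is a mollification that moves with \<open>n\<close>.\<close>

lemma L1_convergence_of_dominated:
  fixes s :: "nat \<Rightarrow> 'a \<Rightarrow> 'b::{banach, second_countable_topology}"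
  assumes meas [measurable]: "\<And>n. s n \<in> borel_measurable M" "f \<in> borel_measurable M"
    and h: "\<And>n. integrable M (h n)" "integrable M H"
    and lim: "AE x in M. (\<lambda>n. s n x) \<longlonglongrightarrow> f x" "AE x in M. (\<lambda>n. h n x) \<longlonglongrightarrow> H x"
    and L1: "(\<lambda>n. LINT x|M. norm (h n x - H x)) \<longlonglongrightarrow> 0"
    and bnd: "\<And>n. AE x in M. norm (s n x) \<le> C * (h n x :: real)" and "C \<ge> 0"
  shows "integrable M f" "\<And>n. integrable M (s n)" "(\<lambda>n. LINT x|M. norm (s n x - f x)) \<longlonglongrightarrow> 0"
proof -
  have bAll: "AE x in M. \<forall>n. norm (s n x) \<le> C * h n x" using bnd by (simp add: AE_all_countable)
  have fb: "AE x in M. norm (f x) \<le> C * H x"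
    using lim bAll
  proof eventually_elim
    case (elim x)
    then show ?case by (intro LIMSEQ_le[OF tendsto_norm[OF elim(1)] tendsto_mult_left[OF elim(2)]]) auto
  qed
  show fi: "integrable M f"
    by (rule Bochner_Integration.integrable_bound[of M "\<lambda>x. C * H x"]) (use h fb in auto)
  show si: "integrable M (s n)" for n
    by (rule Bochner_Integration.integrable_bound[of M "\<lambda>x. C * h n x"]) (use h bnd[of n] in auto)
  \<comment> \<open>Since \<open>|s n - f| \<le> 2 * C * H + C * |h n - H|\<close>, subtracting the
    last term leaves a function under the fixed bound \<open>2 * C * H\<close>; ordinary dominated
    convergence applies to its positive part.\<close>
  define p where "p n x = max 0 (norm (s n x - f x) - C * norm (h n x - H x))" for n x
  have "(\<lambda>n. LINT x|M. p n x) \<longlonglongrightarrow> (LINT x|M. 0)"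
  proof (rule integral_dominated_convergence)
    show "integrable M (\<lambda>x. 2 * C * H x)" using h by simp
    show "(\<lambda>x. p n x) \<in> borel_measurable M" for n
      unfolding p_def using h by measurable
    show "AE x in M. (\<lambda>n. p n x) \<longlonglongrightarrow> 0"
      using lim
    proof eventually_elim
      case (elim x)
      have "(\<lambda>n. p n x) \<longlonglongrightarrow> max 0 (norm (f x - f x) - C * norm (H x - H x))"
        unfolding p_def by (intro tendsto_intros elim)
      then show ?case by simp
    qed
    show "AE x in M. norm (p n x) \<le> 2 * C * H x" for n
      using bnd[of n] fb
    proof eventually_elim
      case (elim x)
      have "norm (s n x - f x) \<le> C * h n x + C * H x"
        using norm_triangle_ineq4[of "s n x" "f x"] elim by linarith
      also have "\<dots> = 2 * (C * H x) + C * (h n x - H x)" by (simp add: algebra_simps)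
      also have "\<dots> \<le> 2 * (C * H x) + C * norm (h n x - H x)"
        using \<open>C \<ge> 0\<close> by (intro add_left_mono mult_left_mono) auto
      finally have "norm (s n x - f x) - C * norm (h n x - H x) \<le> 2 * (C * H x)" by linarith
      moreover have "0 \<le> C * H x" by (rule order.trans[OF norm_ge_zero elim(2)])
      ultimately show ?case by (simp add: p_def)
    qed
  qed auto
  then have p0: "(\<lambda>n. LINT x|M. p n x) \<longlonglongrightarrow> 0" by simp
  have pi: "integrable M (p n)" for n
    unfolding p_def using si fi h by (intro integrable_max) auto
  show "(\<lambda>n. LINT x|M. norm (s n x - f x)) \<longlonglongrightarrow> 0"
  proof (rule tendsto_sandwich[OF _ _ tendsto_const])
    show "(\<lambda>n. (LINT x|M. p n x) + C * (LINT x|M. norm (h n x - H x))) \<longlonglongrightarrow> 0"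
      using tendsto_add[OF p0 tendsto_mult_left[OF L1, of C]] by simp
    show "\<forall>\<^sub>F n in sequentially. 0 \<le> (LINT x|M. norm (s n x - f x))"
      by (intro always_eventually allI Bochner_Integration.integral_nonneg) simp
    show "\<forall>\<^sub>F n in sequentially. (LINT x|M. norm (s n x - f x)) \<le> (LINT x|M. p n x) + C * (LINT x|M. norm (h n x - H x))"
    proof (rule always_eventually, rule allI)
      fix n
      have "(LINT x|M. norm (s n x - f x)) \<le> (LINT x|M. p n x + C * norm (h n x - H x))"
        using si fi h pi by (intro integral_mono) (auto simp: p_def)
      also have "\<dots> = (LINT x|M. p n x) + C * (LINT x|M. norm (h n x - H x))"
        using h pi by simp
      finally show "(LINT x|M. norm (s n x - f x)) \<le> \<dots>" .
    qed
  qed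
qed

section \<open>Averages over segments\<close>

lemma nn_integral_affine_le:
  fixes g :: "'a::euclidean_space \<Rightarrow> ennreal"
  assumes [measurable]: "g \<in> borel_measurable borel" and c: "1 / 2 \<le> c"
  shows "(\<integral>\<^sup>+x. g (v + c *\<^sub>R x) \<partial>lborel) \<le> 2 ^ DIM('a) * (\<integral>\<^sup>+x. g x \<partial>lborel)"
proof -
  have "(\<integral>\<^sup>+x. g x \<partial>lborel) = ennreal (\<bar>c\<bar> ^ DIM('a)) * (\<integral>\<^sup>+x. g (v + c *\<^sub>R x) \<partial>lborel)"
    using c by (subst lborel_affine[of c v]) (auto simp: nn_integral_density nn_integral_distr nn_integral_cmult)
  then have "2 ^ DIM('a) * (\<integral>\<^sup>+x. g x \<partial>lborel) = (2 ^ DIM('a) * ennreal (\<bar>c\<bar> ^ DIM('a))) * (\<integral>\<^sup>+x. g (v + c *\<^sub>R x) \<partial>lborel)"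
    by (simp add: mult.assoc)
  moreover have "1 \<le> (2 ^ DIM('a) * ennreal (\<bar>c\<bar> ^ DIM('a)))"
  proof -
    have "1 \<le> (2 * \<bar>c\<bar>) ^ DIM('a)" using c by (intro one_le_power) auto
    then have "ennreal 1 \<le> ennreal (2 ^ DIM('a) * \<bar>c\<bar> ^ DIM('a))"
      by (intro ennreal_leI) (simp add: power_mult_distrib)
    also have "\<dots> = ennreal (2 ^ DIM('a)) * ennreal (\<bar>c\<bar> ^ DIM('a))" by (rule ennreal_mult) auto
    also have "ennreal (2 ^ DIM('a)) = 2 ^ DIM('a)" by (simp flip: ennreal_power)
    finally show ?thesis by simp
  qed
  ultimately show ?thesis
    using mult_right_mono[of 1 "2 ^ DIM('a) * ennreal (\<bar>c\<bar> ^ DIM('a))" "\<integral>\<^sup>+x. g (v + c *\<^sub>R x) \<partial>lborel"] by simp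
qed

lemma segment_average_at:
  fixes K :: "'a::euclidean_space \<Rightarrow> ennreal"
  assumes [measurable]: "K \<in> borel_measurable borel" "B \<in> sets borel" and B: "convex B" and t: "0 \<le> t" "t \<le> 1"
  shows "(\<integral>\<^sup>+z. \<integral>\<^sup>+x. K (z + t *\<^sub>R (x - z)) * indicator B x * indicator B z \<partial>lborel \<partial>lborel)
    \<le> 2 ^ DIM('a) * (\<integral>\<^sup>+y. K y * indicator B y \<partial>lborel) * emeasure lborel B"
proof -
  let ?I = "2 ^ DIM('a) * (\<integral>\<^sup>+y. K y * indicator B y \<partial>lborel)"
  \<comment> \<open>By convexity the intermediate point lies in \<open>B\<close>, so its indicator
    can be inserted. The indicator of the endpoint integrated over can then be dropped.\<close>
  have seg: "K (z + t *\<^sub>R (x - z)) * indicator B x * indicator B z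
      \<le> (K (z + t *\<^sub>R (x - z)) * indicator B (z + t *\<^sub>R (x - z))) * (indicator B x * indicator B z)" for x z
  proof (cases "x \<in> B \<and> z \<in> B")
    case True
    have "z + t *\<^sub>R (x - z) = (1 - t) *\<^sub>R z + t *\<^sub>R x" by (simp add: algebra_simps)
    then have "z + t *\<^sub>R (x - z) \<in> B" using True B t by (simp add: convexD)
    then show ?thesis using True by simp
  qed (auto simp: indicator_def)
  show ?thesis
  proof (cases "1 / 2 \<le> t")
    case True
    have "(\<integral>\<^sup>+z. \<integral>\<^sup>+x. K (z + t *\<^sub>R (x - z)) * indicator B x * indicator B z \<partial>lborel \<partial>lborel)
        \<le> (\<integral>\<^sup>+z. ?I * indicator B z \<partial>lborel)"
    proof (rule nn_integral_mono)
      fix z :: 'a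
      have "(\<integral>\<^sup>+x. K (z + t *\<^sub>R (x - z)) * indicator B x * indicator B z \<partial>lborel)
          \<le> (\<integral>\<^sup>+x. (K ((1 - t) *\<^sub>R z + t *\<^sub>R x) * indicator B ((1 - t) *\<^sub>R z + t *\<^sub>R x)) * indicator B z \<partial>lborel)"
      proof (rule nn_integral_mono)
        fix x :: 'a
        have eq: "(1 - t) *\<^sub>R z + t *\<^sub>R x = z + t *\<^sub>R (x - z)" by (simp add: algebra_simps)
        show "K (z + t *\<^sub>R (x - z)) * indicator B x * indicator B z
          \<le> (K ((1 - t) *\<^sub>R z + t *\<^sub>R x) * indicator B ((1 - t) *\<^sub>R z + t *\<^sub>R x)) * indicator B z"
          unfolding eq by (rule order.trans[OF seg]) (auto simp: indicator_def)
      qed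
      also have "\<dots> = (\<integral>\<^sup>+x. K ((1 - t) *\<^sub>R z + t *\<^sub>R x) * indicator B ((1 - t) *\<^sub>R z + t *\<^sub>R x) \<partial>lborel) * indicator B z"
        by (rule nn_integral_multc) measurable
      also have "\<dots> \<le> ?I * indicator B z"
        by (intro mult_right_mono nn_integral_affine_le[where g="\<lambda>y. K y * indicator B y"] True) auto
      finally show "(\<integral>\<^sup>+x. K (z + t *\<^sub>R (x - z)) * indicator B x * indicator B z \<partial>lborel) \<le> ?I * indicator B z" .
    qed
    also have "\<dots> = ?I * emeasure lborel B" by (rule nn_integral_cmult_indicator) simp
    finally show ?thesis .
  next
    case False
    have "(\<integral>\<^sup>+z. \<integral>\<^sup>+x. K (z + t *\<^sub>R (x - z)) * indicator B x * indicator B z \<partial>lborel \<partial>lborel)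
        = (\<integral>\<^sup>+x. \<integral>\<^sup>+z. K (z + t *\<^sub>R (x - z)) * indicator B x * indicator B z \<partial>lborel \<partial>lborel)"
      by (rule lborel_pair.Fubini') measurable
    also have "\<dots> \<le> (\<integral>\<^sup>+x. ?I * indicator B x \<partial>lborel)"
    proof (rule nn_integral_mono)
      fix x :: 'a
      have "(\<integral>\<^sup>+z. K (z + t *\<^sub>R (x - z)) * indicator B x * indicator B z \<partial>lborel)
          \<le> (\<integral>\<^sup>+z. (K (t *\<^sub>R x + (1 - t) *\<^sub>R z) * indicator B (t *\<^sub>R x + (1 - t) *\<^sub>R z)) * indicator B x \<partial>lborel)"
      proof (rule nn_integral_mono)
        fix z :: 'a
        have eq: "t *\<^sub>R x + (1 - t) *\<^sub>R z = z + t *\<^sub>R (x - z)" by (simp add: algebra_simps)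
        show "K (z + t *\<^sub>R (x - z)) * indicator B x * indicator B z
          \<le> (K (t *\<^sub>R x + (1 - t) *\<^sub>R z) * indicator B (t *\<^sub>R x + (1 - t) *\<^sub>R z)) * indicator B x"
          unfolding eq by (rule order.trans[OF seg]) (auto simp: indicator_def)
      qed
      also have "\<dots> = (\<integral>\<^sup>+z. K (t *\<^sub>R x + (1 - t) *\<^sub>R z) * indicator B (t *\<^sub>R x + (1 - t) *\<^sub>R z) \<partial>lborel) * indicator B x"
        by (rule nn_integral_multc) measurable
      also have "\<dots> \<le> ?I * indicator B x"
        using False by (intro mult_right_mono nn_integral_affine_le[where g="\<lambda>y. K y * indicator B y"]) auto
      finally show "(\<integral>\<^sup>+z. K (z + t *\<^sub>R (x - z)) * indicator B x * indicator B z \<partial>lborel) \<le> ?I * indicator B x" .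
    qed
    also have "\<dots> = ?I * emeasure lborel B" by (rule nn_integral_cmult_indicator) simp
    finally show ?thesis .
  qed
qed

text \<open>Substituting in whichever endpoint has weight at least \<open>1/2\<close> avoids the singular kernel that
  polar coordinates around a fixed endpoint would produce.\<close>

lemma segment_average:
  fixes K :: "'a::euclidean_space \<Rightarrow> ennreal"
  assumes [measurable]: "K \<in> borel_measurable borel" "B \<in> sets borel" and B: "convex B"
  shows "(\<integral>\<^sup>+z. \<integral>\<^sup>+x. (\<integral>\<^sup>+t. K (z + t *\<^sub>R (x - z)) * indicator {0..1::real} t \<partial>lborel) * indicator B x * indicator B z \<partial>lborel \<partial>lborel)
    \<le> 2 ^ DIM('a) * (\<integral>\<^sup>+y. K y * indicator B y \<partial>lborel) * emeasure lborel B"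
proof -
  let ?F = "\<lambda>z x t. K (z + t *\<^sub>R (x - z)) * indicator {0..1::real} t * indicator B x * indicator B z"
  let ?C = "2 ^ DIM('a) * (\<integral>\<^sup>+y. K y * indicator B y \<partial>lborel) * emeasure lborel B"
  have "(\<integral>\<^sup>+z. \<integral>\<^sup>+x. (\<integral>\<^sup>+t. K (z + t *\<^sub>R (x - z)) * indicator {0..1::real} t \<partial>lborel) * indicator B x * indicator B z \<partial>lborel \<partial>lborel)
      = (\<integral>\<^sup>+z. \<integral>\<^sup>+x. \<integral>\<^sup>+t. ?F z x t \<partial>lborel \<partial>lborel \<partial>lborel)"
    by (intro nn_integral_cong) (simp add: nn_integral_multc)
  also have "\<dots> = (\<integral>\<^sup>+z. \<integral>\<^sup>+t. \<integral>\<^sup>+x. ?F z x t \<partial>lborel \<partial>lborel \<partial>lborel)"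
    by (intro nn_integral_cong lborel_pair.Fubini') measurable
  also have "\<dots> = (\<integral>\<^sup>+t. \<integral>\<^sup>+z. \<integral>\<^sup>+x. ?F z x t \<partial>lborel \<partial>lborel \<partial>lborel)"
    by (rule lborel_pair.Fubini') measurable
  also have "\<dots> \<le> (\<integral>\<^sup>+t. ?C * indicator {0..1::real} t \<partial>lborel)"
  proof (rule nn_integral_mono)
    fix t :: real
    show "(\<integral>\<^sup>+z. \<integral>\<^sup>+x. ?F z x t \<partial>lborel \<partial>lborel) \<le> ?C * indicator {0..1::real} t"
    proof (cases "t \<in> {0..1}")
      case True
      then show ?thesis using segment_average_at[OF assms, of t] by simp
    qed simp
  qed
  also have "\<dots> = ?C" by (simp add: nn_integral_cmult_indicator)
  finally show ?thesis .
qed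

section \<open>Integration by parts against test functions\<close>

lemma test_functionE:
  fixes \<phi> :: "'a::euclidean_space \<Rightarrow> real"
  assumes "test_function \<Omega> \<phi>"
  obtains C R where "C \<ge> 0" "\<And>x. \<bar>\<phi> x\<bar> \<le> C" "\<And>x y. \<bar>\<phi> x - \<phi> y\<bar> \<le> C * norm (x - y)"
    "\<And>x. \<phi> x \<noteq> 0 \<Longrightarrow> norm x \<le> R" "\<And>x. (\<phi> has_derivative frechet_derivative \<phi> (at x)) (at x)"
    "continuous_on UNIV \<phi>" "\<And>b. b \<in> Basis \<Longrightarrow> continuous_on UNIV (pderiv_at \<phi> b)"
    "\<And>b x. b \<in> Basis \<Longrightarrow> \<bar>pderiv_at \<phi> b x\<bar> \<le> C"
    "\<And>b x. x \<notin> closure {x. \<phi> x \<noteq> 0} \<Longrightarrow> pderiv_at \<phi> b x = 0"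
proof -
  let ?S = "closure {x. \<phi> x \<noteq> 0}"
  have ck: "Ck 0 \<phi>" "Ck (Suc 0) \<phi>" and S: "compact ?S"
    using assms unfolding test_function_def smooth_def by blast+
  have c0: "continuous_on UNIV \<phi>" using ck(1) by simp
  have d: "(\<phi> has_derivative frechet_derivative \<phi> (at x)) (at x)" for x
    using ck(2) by (simp add: frechet_derivative_works)
  have c1: "continuous_on UNIV (pderiv_at \<phi> b)" if "b \<in> Basis" for b using ck(2) that by simp
  have z: "\<phi> x = 0" if "x \<notin> ?S" for x using that closure_subset[of "{x. \<phi> x \<noteq> 0}"] by blast
  have z1: "pderiv_at \<phi> b x = 0" if "x \<notin> ?S" for b x
  proof -
    have "(\<phi> has_derivative (\<lambda>_. 0)) (at x)"
    proof (rule has_derivative_transform_within_open[where f="\<lambda>_. 0" and g=\<phi> and s="- ?S"])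
      show "open (- ?S)" by (rule open_Compl[OF closed_closure])
      show "x \<in> - ?S" using that by blast
      show "0 = \<phi> y" if "y \<in> - ?S" for y using z[OF ComplD[OF that]] by (rule sym)
    qed (rule has_derivative_const)
    from fun_cong[OF frechet_derivative_at[OF this], of b] show ?thesis by simp
  qed
  have "\<exists>C\<ge>0. \<forall>x. \<bar>f x\<bar> \<le> C" if f: "continuous_on UNIV f" "\<And>x. x \<notin> ?S \<Longrightarrow> f x = 0" for f :: "'a \<Rightarrow> real"
  proof -
    have "bounded (f ` ?S)"
      by (intro compact_imp_bounded compact_continuous_image S continuous_on_subset[OF f(1)]) auto
    then obtain C where "C > 0" "\<And>x. x \<in> ?S \<Longrightarrow> \<bar>f x\<bar> \<le> C" unfolding bounded_pos by auto
    then have "\<bar>f x\<bar> \<le> C" for x using f(2)[of x] by (cases "x \<in> ?S") auto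
    then show ?thesis using \<open>C > 0\<close> less_imp_le by blast
  qed
  note bd = this
  obtain C0 where C0: "C0 \<ge> 0" "\<And>x. \<bar>\<phi> x\<bar> \<le> C0" using bd[OF c0 z] by blast
  have "\<forall>b. \<exists>C\<ge>0. b \<in> Basis \<longrightarrow> (\<forall>x. \<bar>pderiv_at \<phi> b x\<bar> \<le> C)"
  proof
    fix b :: 'a
    show "\<exists>C\<ge>0. b \<in> Basis \<longrightarrow> (\<forall>x. \<bar>pderiv_at \<phi> b x\<bar> \<le> C)"
      using bd[OF c1 z1, of b] by (cases "b \<in> Basis") auto
  qed
  then obtain C1 where C1: "\<And>b. C1 b \<ge> 0" "\<And>b x. b \<in> Basis \<Longrightarrow> \<bar>pderiv_at \<phi> b x\<bar> \<le> C1 b" by metis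
  define C where "C = C0 + (\<Sum>b\<in>Basis. C1 b)"
  have sC: "(\<Sum>b\<in>Basis. C1 b) \<le> C" using C0 by (simp add: C_def)
  have C1C: "C1 b \<le> C" if "b \<in> Basis" for b
    using member_le_sum[of b Basis C1] that C1(1) sC by auto
  have Lip: "norm (\<phi> x - \<phi> y) \<le> C * norm (x - y)" for x y
  proof (rule differentiable_bound[of UNIV])
    show "(\<phi> has_derivative frechet_derivative \<phi> (at z)) (at z within UNIV)" for z using d by simp
    show "onorm (frechet_derivative \<phi> (at z)) \<le> C" for z
    proof (rule onorm_le)
      fix h :: 'a
      have "norm (frechet_derivative \<phi> (at z) h) \<le> norm h * (\<Sum>b\<in>Basis. norm (pderiv_at \<phi> b z))"
        by (rule linear_norm_le_sum_Basis[OF has_derivative_linear[OF d]])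
      also have "\<dots> \<le> norm h * (\<Sum>b\<in>Basis. C1 b)"
        using C1(2) by (intro mult_left_mono sum_mono) auto
      also have "\<dots> \<le> norm h * C" using sC by (intro mult_left_mono) auto
      finally show "norm (frechet_derivative \<phi> (at z) h) \<le> C * norm h" by (simp add: mult.commute)
    qed
  qed auto
  obtain R where R: "\<And>x. x \<in> ?S \<Longrightarrow> norm x \<le> R"
    using compact_imp_bounded[OF S] unfolding bounded_iff by blast
  show ?thesis
  proof (rule that[of C R])
    show "C \<ge> 0" using C0 C1(1) by (auto simp: C_def intro!: add_nonneg_nonneg sum_nonneg)
    show "\<bar>\<phi> x\<bar> \<le> C" for x using C0(2)[of x] C1(1) by (auto simp: C_def intro!: add_increasing2 sum_nonneg)
    show "\<bar>\<phi> x - \<phi> y\<bar> \<le> C * norm (x - y)" for x y using Lip[of x y] by simp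
    show "norm x \<le> R" if "\<phi> x \<noteq> 0" for x using R z that by blast
    show "\<bar>pderiv_at \<phi> b x\<bar> \<le> C" if "b \<in> Basis" for b x using C1(2)[OF that, of x] C1C[OF that] by linarith
  qed (fact d c0 c1 z1)+
qed

lemma integrable_bounded_support:
  fixes f :: "'a::euclidean_space \<Rightarrow> 'b::{banach, second_countable_topology}"
  assumes [measurable]: "f \<in> borel_measurable borel" and "\<And>x. norm (f x) \<le> C" "\<And>x. f x \<noteq> 0 \<Longrightarrow> norm x \<le> R"
  shows "integrable lborel f"
proof (rule Bochner_Integration.integrable_bound)
  show "integrable lborel (\<lambda>x::'a. C * indicator (cball 0 R) x :: real)"
    using emeasure_lborel_cball_finite by (intro integrable_mult_right integrable_real_indicator) auto
  show "AE x in lborel. norm (f x) \<le> norm (C * indicator (cball 0 R) x)"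
  proof (rule AE_I2)
    fix x
    show "norm (f x) \<le> norm (C * indicator (cball 0 R) x)"
      using assms(2)[of x] assms(3)[of x] by (cases "f x = 0") (auto simp: indicator_def)
  qed
qed simp

text \<open>Stated with difference quotients because transported spinors are never shown to be
  differentiable in the endpoint.\<close>

lemma approximate_integration_by_parts:
  fixes \<phi> :: "'a::euclidean_space \<Rightarrow> real" and v w :: "'a \<Rightarrow> 'b::euclidean_space"
  assumes \<phi>: "test_function \<Omega> \<phi>" and c: "c \<in> Basis"
    and v: "v \<in> borel_measurable borel" "\<And>x. norm (v x) \<le> Cv"
    and w: "w \<in> borel_measurable borel" "\<And>x. norm (w x) \<le> Cw"
    and E: "E \<in> borel_measurable borel" "integrable lborel (\<lambda>x. \<bar>\<phi> x\<bar> * E x)"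
    and le: "\<And>x s. \<phi> x \<noteq> 0 \<Longrightarrow> 0 < s \<Longrightarrow> s \<le> 1 \<Longrightarrow> norm (v (x + s *\<^sub>R c) - v x - s *\<^sub>R w x) \<le> s * E x + Q * s\<^sup>2"
  shows "norm ((LINT x|lborel. pderiv_at \<phi> c x *\<^sub>R v x) + (LINT x|lborel. \<phi> x *\<^sub>R w x)) \<le> (LINT x|lborel. \<bar>\<phi> x\<bar> * E x)"
proof -
  obtain C R where C: "C \<ge> 0" "\<And>x. \<bar>\<phi> x\<bar> \<le> C" "\<And>x y. \<bar>\<phi> x - \<phi> y\<bar> \<le> C * norm (x - y)"
    "\<And>x. \<phi> x \<noteq> 0 \<Longrightarrow> norm x \<le> R" "\<And>x. (\<phi> has_derivative frechet_derivative \<phi> (at x)) (at x)"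
    "continuous_on UNIV \<phi>" "\<And>b. b \<in> Basis \<Longrightarrow> continuous_on UNIV (pderiv_at \<phi> b)"
    "\<And>b x. b \<in> Basis \<Longrightarrow> \<bar>pderiv_at \<phi> b x\<bar> \<le> C"
    "\<And>b x. x \<notin> closure {x. \<phi> x \<noteq> 0} \<Longrightarrow> pderiv_at \<phi> b x = 0"
    using \<phi> by (rule test_functionE) (rule that)
  note [measurable] = v(1) w(1) E(1) borel_measurable_continuous_onI[OF C(6)] borel_measurable_continuous_onI[OF C(7)[OF c]]
  have Cv: "Cv \<ge> 0" and Cw: "Cw \<ge> 0" using order.trans[OF norm_ge_zero v(2)] order.trans[OF norm_ge_zero w(2)] by auto
  have nc: "norm c = 1" using c by simp
  define s where "s n = 1 / real (Suc n)" for n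
  have s: "\<And>n. 0 < s n" "\<And>n. s n \<le> 1" "s \<longlonglongrightarrow> 0"
    unfolding s_def using LIMSEQ_inverse_real_of_nat by (simp_all add: inverse_eq_divide)
  \<comment> \<open>A backward difference quotient of \<open>\<phi>\<close>: translating the
    integral turns it into minus the forward quotient of \<open>v\<close>, the one controlled by the
    hypothesis.\<close>
  define D where "D n x = (\<phi> x - \<phi> (x - s n *\<^sub>R c)) / s n" for n x
  have [measurable]: "D n \<in> borel_measurable borel" for n unfolding D_def by measurable
  have Db: "\<bar>D n x\<bar> \<le> C" for n x
  proof -
    have "\<bar>D n x\<bar> = \<bar>\<phi> x - \<phi> (x - s n *\<^sub>R c)\<bar> / s n" using s(1)[of n] by (simp add: D_def abs_divide)
    also have "\<dots> \<le> (C * norm (s n *\<^sub>R c)) / s n" using C(3)[of x "x - s n *\<^sub>R c"] s(1)[of n]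
      by (intro divide_right_mono) auto
    also have "\<dots> = C" using s(1)[of n] nc by simp
    finally show ?thesis .
  qed
  have Ds: "norm x \<le> R + 1" if "D n x \<noteq> 0" for n x
  proof -
    have "\<phi> x \<noteq> 0 \<or> \<phi> (x - s n *\<^sub>R c) \<noteq> 0" using that by (auto simp: D_def)
    then show ?thesis
    proof
      assume "\<phi> (x - s n *\<^sub>R c) \<noteq> 0"
      then have "norm (x - s n *\<^sub>R c) \<le> R" by (rule C(4))
      moreover have "norm x \<le> norm (x - s n *\<^sub>R c) + norm (s n *\<^sub>R c)"
        using norm_triangle_ineq[of "x - s n *\<^sub>R c" "s n *\<^sub>R c"] by simp
      ultimately show ?thesis using s(1,2)[of n] nc by simp
    qed (use C(4)[of x] in auto)
  qed
  have Dlim: "(\<lambda>n. D n x) \<longlonglongrightarrow> pderiv_at \<phi> c x" for x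
  proof -
    have "((\<lambda>r. \<phi> (x + r *\<^sub>R c)) has_derivative (\<lambda>r. frechet_derivative \<phi> (at x) (r *\<^sub>R c))) (at 0)"
    proof (rule has_derivative_compose[of "\<lambda>r. x + r *\<^sub>R c" "\<lambda>r. r *\<^sub>R c" 0 UNIV \<phi> "frechet_derivative \<phi> (at x)"])
      show "((\<lambda>r. x + r *\<^sub>R c) has_derivative (\<lambda>r. r *\<^sub>R c)) (at 0)" by (auto intro!: derivative_eq_intros)
    qed (use C(5)[of x] in simp)
    then have "((\<lambda>r. \<phi> (x + r *\<^sub>R c)) has_real_derivative pderiv_at \<phi> c x) (at 0)"
      using linear_scale[OF has_derivative_linear[OF C(5)]]
      by (simp add: has_field_derivative_def mult_commute_abs)
    then have "((\<lambda>h. (\<phi> (x + h *\<^sub>R c) - \<phi> x) / h) \<longlongrightarrow> pderiv_at \<phi> c x) (at 0)"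
      by (simp add: DERIV_def)
    moreover have "filterlim (\<lambda>n. - s n) (at 0) sequentially"
      unfolding filterlim_at using tendsto_minus[OF s(3)] s(1) by (auto simp: less_imp_neq[symmetric])
    ultimately have "(\<lambda>n. (\<phi> (x + (- s n) *\<^sub>R c) - \<phi> x) / (- s n)) \<longlonglongrightarrow> pderiv_at \<phi> c x"
      by (rule filterlim_compose)
    moreover have "(\<phi> (x + (- s n) *\<^sub>R c) - \<phi> x) / (- s n) = D n x" for n
      by (simp add: D_def minus_divide_right[symmetric] diff_divide_distrib)
    ultimately show ?thesis by simp
  qed
  have lim: "(\<lambda>n. LINT x|lborel. D n x *\<^sub>R v x) \<longlonglongrightarrow> (LINT x|lborel. pderiv_at \<phi> c x *\<^sub>R v x)"
  proof (rule integral_dominated_convergence)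
    show "integrable lborel (\<lambda>x::'a. C * Cv * indicator (cball 0 (R + 1)) x)"
      using emeasure_lborel_cball_finite by (intro integrable_mult_right integrable_real_indicator) auto
    show "AE x in lborel. (\<lambda>n. D n x *\<^sub>R v x) \<longlonglongrightarrow> pderiv_at \<phi> c x *\<^sub>R v x"
      by (intro AE_I2 tendsto_intros Dlim)
    show "AE x in lborel. norm (D n x *\<^sub>R v x) \<le> C * Cv * indicator (cball 0 (R + 1)) x" for n
    proof (rule AE_I2)
      fix x
      have "norm (D n x *\<^sub>R v x) \<le> C * Cv" using mult_mono[OF Db[of n x] v(2)[of x] C(1)] by simp
      then show "norm (D n x *\<^sub>R v x) \<le> C * Cv * indicator (cball 0 (R + 1)) x"
        using Ds[of n x] by (cases "D n x = 0") (auto simp: indicator_def C(1) Cv)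
    qed
  qed simp_all
  have i\<phi>w: "integrable lborel (\<lambda>x. \<phi> x *\<^sub>R w x)"
  proof (rule integrable_bounded_support[of _ "C * Cw" R])
    show "norm (\<phi> x *\<^sub>R w x) \<le> C * Cw" for x using mult_mono[OF C(2) w(2) C(1)] by simp
  qed (use C(4) in auto)
  have i\<phi>v: "integrable lborel (\<lambda>x. \<phi> x *\<^sub>R v x)"
  proof (rule integrable_bounded_support[of _ "C * Cv" R])
    show "norm (\<phi> x *\<^sub>R v x) \<le> C * Cv" for x using mult_mono[OF C(2) v(2) C(1)] by simp
  qed (use C(4) in auto)
  have i\<phi>vs: "integrable lborel (\<lambda>x. \<phi> x *\<^sub>R v (x + r *\<^sub>R c))" for r
  proof (rule integrable_bounded_support[of _ "C * Cv" R])
    show "norm (\<phi> x *\<^sub>R v (x + r *\<^sub>R c)) \<le> C * Cv" for x using mult_mono[OF C(2) v(2) C(1)] by simp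
  qed (use C(4) in auto)
  have i\<phi>: "integrable lborel (\<lambda>x. \<bar>\<phi> x\<bar>)"
    by (rule integrable_bounded_support[of _ C R]) (use C(2,4) in auto)
  have bound: "norm ((LINT x|lborel. D n x *\<^sub>R v x) + (LINT x|lborel. \<phi> x *\<^sub>R w x))
      \<le> (LINT x|lborel. \<bar>\<phi> x\<bar> * E x) + Q * s n * (LINT x|lborel. \<bar>\<phi> x\<bar>)" for n
  proof -
    let ?s = "s n"
    have sh: "(LINT x|lborel. \<phi> (x - ?s *\<^sub>R c) *\<^sub>R v x) = (LINT x|lborel. \<phi> x *\<^sub>R v (x + ?s *\<^sub>R c))"
      using integral_lborel_shift[of "\<lambda>x. \<phi> (x - ?s *\<^sub>R c) *\<^sub>R v x" "?s *\<^sub>R c"] by (simp add: add.commute)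
    have ish: "integrable lborel (\<lambda>x. \<phi> (x - ?s *\<^sub>R c) *\<^sub>R v x)"
    proof (rule integrable_bounded_support[of _ "C * Cv" "R + 1"])
      show "norm (\<phi> (x - ?s *\<^sub>R c) *\<^sub>R v x) \<le> C * Cv" for x using mult_mono[OF C(2) v(2) C(1)] by simp
      fix x assume "\<phi> (x - ?s *\<^sub>R c) *\<^sub>R v x \<noteq> 0"
      then have "norm (x - ?s *\<^sub>R c) \<le> R" using C(4) by simp
      moreover have "norm x \<le> norm (x - ?s *\<^sub>R c) + norm (?s *\<^sub>R c)"
        using norm_triangle_ineq[of "x - ?s *\<^sub>R c" "?s *\<^sub>R c"] by simp
      ultimately show "norm x \<le> R + 1" using s(1,2)[of n] nc by simp
    qed simp
    have "(LINT x|lborel. D n x *\<^sub>R v x) = (LINT x|lborel. (1 / ?s) *\<^sub>R (\<phi> x *\<^sub>R v x - \<phi> (x - ?s *\<^sub>R c) *\<^sub>R v x))"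
      by (intro Bochner_Integration.integral_cong refl) (simp add: D_def divide_inverse scaleR_diff_left scaleR_diff_right algebra_simps)
    also have "\<dots> = (1 / ?s) *\<^sub>R ((LINT x|lborel. \<phi> x *\<^sub>R v x) - (LINT x|lborel. \<phi> x *\<^sub>R v (x + ?s *\<^sub>R c)))"
      unfolding sh[symmetric] using i\<phi>v ish by simp
    finally have "(LINT x|lborel. D n x *\<^sub>R v x) + (LINT x|lborel. \<phi> x *\<^sub>R w x)
        = (1 / ?s) *\<^sub>R ((LINT x|lborel. \<phi> x *\<^sub>R v x) - (LINT x|lborel. \<phi> x *\<^sub>R v (x + ?s *\<^sub>R c)))
          + (LINT x|lborel. \<phi> x *\<^sub>R w x)" by simp
    also have "\<dots> = - (LINT x|lborel. (1 / ?s) *\<^sub>R (\<phi> x *\<^sub>R v (x + ?s *\<^sub>R c) - \<phi> x *\<^sub>R v x) - \<phi> x *\<^sub>R w x)"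
    proof -
      have "(LINT x|lborel. (1 / ?s) *\<^sub>R (\<phi> x *\<^sub>R v (x + ?s *\<^sub>R c) - \<phi> x *\<^sub>R v x) - \<phi> x *\<^sub>R w x)
          = (LINT x|lborel. (1 / ?s) *\<^sub>R (\<phi> x *\<^sub>R v (x + ?s *\<^sub>R c) - \<phi> x *\<^sub>R v x)) - (LINT x|lborel. \<phi> x *\<^sub>R w x)"
        by (intro Bochner_Integration.integral_diff integrable_scaleR_right Bochner_Integration.integrable_diff i\<phi>v i\<phi>vs i\<phi>w)
      also have "(LINT x|lborel. (1 / ?s) *\<^sub>R (\<phi> x *\<^sub>R v (x + ?s *\<^sub>R c) - \<phi> x *\<^sub>R v x))
          = (1 / ?s) *\<^sub>R ((LINT x|lborel. \<phi> x *\<^sub>R v (x + ?s *\<^sub>R c)) - (LINT x|lborel. \<phi> x *\<^sub>R v x))"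
        using i\<phi>v i\<phi>vs by (simp only: integral_scaleR_right Bochner_Integration.integral_diff)
      finally show ?thesis by (simp add: scaleR_diff_right)
    qed
    also have "norm \<dots> \<le> (LINT x|lborel. \<bar>\<phi> x\<bar> * E x + Q * ?s * \<bar>\<phi> x\<bar>)"
      unfolding norm_minus_cancel
    proof (rule norm_integral_le_AE)
      show "integrable lborel (\<lambda>x. \<bar>\<phi> x\<bar> * E x + Q * ?s * \<bar>\<phi> x\<bar>)" using E(2) i\<phi> by simp
      show "AE x in lborel. norm ((1 / ?s) *\<^sub>R (\<phi> x *\<^sub>R v (x + ?s *\<^sub>R c) - \<phi> x *\<^sub>R v x) - \<phi> x *\<^sub>R w x)
          \<le> \<bar>\<phi> x\<bar> * E x + Q * ?s * \<bar>\<phi> x\<bar>"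
      proof (rule AE_I2)
        fix x
        show "norm ((1 / ?s) *\<^sub>R (\<phi> x *\<^sub>R v (x + ?s *\<^sub>R c) - \<phi> x *\<^sub>R v x) - \<phi> x *\<^sub>R w x) \<le> \<bar>\<phi> x\<bar> * E x + Q * ?s * \<bar>\<phi> x\<bar>"
        proof (cases "\<phi> x = 0")
          case False
          have "(1 / ?s) *\<^sub>R (\<phi> x *\<^sub>R v (x + ?s *\<^sub>R c) - \<phi> x *\<^sub>R v x) - \<phi> x *\<^sub>R w x
              = (\<phi> x / ?s) *\<^sub>R (v (x + ?s *\<^sub>R c) - v x - ?s *\<^sub>R w x)"
            using s(1)[of n] by (simp add: scaleR_diff_right)
          also have "norm \<dots> = (\<bar>\<phi> x\<bar> / ?s) * norm (v (x + ?s *\<^sub>R c) - v x - ?s *\<^sub>R w x)"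
            using s(1)[of n] by simp
          also have "\<dots> \<le> (\<bar>\<phi> x\<bar> / ?s) * (?s * E x + Q * ?s\<^sup>2)"
            using le[OF False s(1,2)] s(1)[of n] by (intro mult_left_mono) auto
          also have "\<dots> = \<bar>\<phi> x\<bar> * E x + Q * ?s * \<bar>\<phi> x\<bar>"
            using s(1)[of n] by (simp add: field_simps power2_eq_square)
          finally show ?thesis .
        qed simp
      qed
    qed
    also have "\<dots> = (LINT x|lborel. \<bar>\<phi> x\<bar> * E x) + Q * ?s * (LINT x|lborel. \<bar>\<phi> x\<bar>)"
      using E(2) i\<phi> by simp
    finally show ?thesis .
  qed
  \<comment> \<open>The quadratic error carries the step length and disappears in the limit; the
    first-order error \<open>E\<close> is all that remains.\<close>
  have "(\<lambda>n. (LINT x|lborel. \<bar>\<phi> x\<bar> * E x) + Q * s n * (LINT x|lborel. \<bar>\<phi> x\<bar>))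
      \<longlonglongrightarrow> (LINT x|lborel. \<bar>\<phi> x\<bar> * E x) + Q * 0 * (LINT x|lborel. \<bar>\<phi> x\<bar>)"
    by (intro tendsto_intros s(3))
  then show ?thesis
    by (intro LIMSEQ_le[OF tendsto_norm[OF tendsto_add[OF lim tendsto_const]]]) (use bound in auto)
qed

section \<open>Parallel transport along segments\<close>

definition segint :: "('a::euclidean_space \<Rightarrow> real) \<Rightarrow> 'a \<Rightarrow> 'a \<Rightarrow> real" where
  "segint K z x = (LBINT t:{0..1}. K (z + t *\<^sub>R (x - z)))"

text \<open>Three faces of the segment integral: the gauge integral for the differential equations,
  the nonnegative integral for Tonelli, and Borel measurability in the endpoint.\<close>

lemma
  fixes K :: "'a::euclidean_space \<Rightarrow> real"
  assumes K: "continuous_on UNIV K"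
  shows segint_eq_integral: "segint K z x = integral {0..1} (\<lambda>t. K (z + t *\<^sub>R (x - z)))"
    and segint_continuous_path: "continuous_on {0..1} (\<lambda>t. K (z + t *\<^sub>R (x - z)))"
    and ennreal_segint: "(\<And>y. 0 \<le> K y) \<Longrightarrow>
      ennreal (segint K z x) = (\<integral>\<^sup>+t. ennreal (K (z + t *\<^sub>R (x - z))) * indicator {0..1::real} t \<partial>lborel)"
    and segint_measurable: "(\<lambda>x. segint K z x) \<in> borel_measurable borel"
proof -
  show c: "continuous_on {0..1} (\<lambda>t. K (z + t *\<^sub>R (x - z)))"
    by (rule continuous_on_compose2[OF K]) (auto intro!: continuous_intros)
  have i: "set_integrable lborel {0..1} (\<lambda>t. K (z + t *\<^sub>R (x - z)))"
    by (rule borel_integrable_atLeastAtMost'[OF c])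
  show "segint K z x = integral {0..1} (\<lambda>t. K (z + t *\<^sub>R (x - z)))"
    unfolding segint_def by (rule set_borel_integral_eq_integral(2)[OF i])
  show "ennreal (segint K z x) = (\<integral>\<^sup>+t. ennreal (K (z + t *\<^sub>R (x - z))) * indicator {0..1::real} t \<partial>lborel)"
    if nn: "\<And>y. 0 \<le> K y"
  proof -
    have "ennreal (segint K z x) = (\<integral>\<^sup>+t. ennreal (indicator {0..1} t *\<^sub>R K (z + t *\<^sub>R (x - z))) \<partial>lborel)"
      unfolding segint_def set_lebesgue_integral_def
      using i[unfolded set_integrable_def] nn by (intro nn_integral_eq_integral[symmetric]) auto
    also have "\<dots> = (\<integral>\<^sup>+t. ennreal (K (z + t *\<^sub>R (x - z))) * indicator {0..1::real} t \<partial>lborel)"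
      by (intro nn_integral_cong) (auto simp: indicator_def)
    finally show ?thesis .
  qed
  have [measurable]: "K \<in> borel_measurable borel" by (rule borel_measurable_continuous_onI[OF K])
  show "(\<lambda>x. segint K z x) \<in> borel_measurable borel"
    unfolding segint_def set_lebesgue_integral_def by measurable
qed

lemma segint_nonneg: "(\<And>y. 0 \<le> K y) \<Longrightarrow> 0 \<le> segint K z x"
  unfolding segint_def set_lebesgue_integral_def by (rule Bochner_Integration.integral_nonneg) simp

text \<open>The series is summed before null sets are discarded, so a single base point
  \<open>z\<close> serves all \<open>n\<close>. The sum integrated over both \<open>z\<close> and
  the endpoint is at most a fixed multiple of the summed L^1 norms, by
  \<open>segment_average\<close>.\<close>

lemma AE_segint_summable:
  fixes K :: "nat \<Rightarrow> 'a::euclidean_space \<Rightarrow> real"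
  assumes K: "\<And>n. continuous_on UNIV (K n)" "\<And>n y. 0 \<le> K n y"
    and B: "B \<in> sets borel" "convex B" "emeasure lborel B < \<infinity>"
    and sum: "(\<Sum>n. \<integral>\<^sup>+x. ennreal (K n x) * indicator B x \<partial>lborel) < \<infinity>"
  shows "AE z in lborel. z \<in> B \<longrightarrow> (\<Sum>n. \<integral>\<^sup>+x. ennreal (segint (K n) z x) * indicator B x \<partial>lborel) < \<infinity>"
proof -
  have [measurable]: "K n \<in> borel_measurable borel" for n by (rule borel_measurable_continuous_onI[OF K(1)])
  have [measurable]: "B \<in> sets borel" by fact
  define g where "g n z = (\<integral>\<^sup>+x. (\<integral>\<^sup>+t. ennreal (K n (z + t *\<^sub>R (x - z))) * indicator {0..1::real} t \<partial>lborel)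
      * indicator B x * indicator B z \<partial>lborel)" for n z
  have [measurable]: "g n \<in> borel_measurable borel" for n unfolding g_def by measurable
  let ?C = "2 ^ DIM('a) * emeasure lborel B"
  have C: "?C < \<infinity>" using B(3) by (simp add: ennreal_mult_less_top power_less_top_ennreal)
  have "(\<integral>\<^sup>+z. (\<Sum>n. g n z) \<partial>lborel) = (\<Sum>n. \<integral>\<^sup>+z. g n z \<partial>lborel)"
    by (rule nn_integral_suminf) measurable
  also have "\<dots> \<le> (\<Sum>n. ?C * (\<integral>\<^sup>+x. ennreal (K n x) * indicator B x \<partial>lborel))"
  proof (rule suminf_le)
    show "(\<integral>\<^sup>+z. g n z \<partial>lborel) \<le> ?C * (\<integral>\<^sup>+x. ennreal (K n x) * indicator B x \<partial>lborel)" for n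
      using segment_average[of "\<lambda>y. ennreal (K n y)" B] B by (simp add: g_def mult_ac)
  qed auto
  also have "\<dots> = ?C * (\<Sum>n. \<integral>\<^sup>+x. ennreal (K n x) * indicator B x \<partial>lborel)" by simp
  also have "\<dots> < \<infinity>" using C sum by (simp add: ennreal_mult_less_top)
  finally have "(\<integral>\<^sup>+z. (\<Sum>n. g n z) \<partial>lborel) \<noteq> \<infinity>" by simp
  then have "AE z in lborel. (\<Sum>n. g n z) \<noteq> \<infinity>" by (intro nn_integral_PInf_AE) auto
  then show ?thesis
  proof eventually_elim
    case (elim z)
    show ?case
    proof
      assume z: "z \<in> B"
      have "(\<integral>\<^sup>+x. ennreal (segint (K n) z x) * indicator B x \<partial>lborel) = g n z" for n
        using z by (simp add: g_def ennreal_segint[OF K(1) K(2)])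
      then show "(\<Sum>n. \<integral>\<^sup>+x. ennreal (segint (K n) z x) * indicator B x \<partial>lborel) < \<infinity>"
        using elim by (simp add: top.not_eq_extremum)
    qed
  qed
qed

definition conn :: "('a::euclidean_space \<Rightarrow> 'a \<Rightarrow> real^3) \<Rightarrow> 'a \<Rightarrow> 'a \<Rightarrow> real^3" where
  "conn A x h = (\<Sum>b\<in>Basis. (h \<bullet> b) *\<^sub>R A b x)"

lemma conn_add: "conn A x (h + k) = conn A x h + conn A x k"
  by (simp add: conn_def inner_add_left scaleR_add_left sum.distrib)

lemma conn_scaleR_Basis:
  assumes "c \<in> Basis"
  shows "conn A x (s *\<^sub>R c) = s *\<^sub>R A c x"
proof -
  have "conn A x (s *\<^sub>R c) = (\<Sum>b\<in>Basis. if b = c then s *\<^sub>R A c x else 0)"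
    unfolding conn_def by (intro sum.cong refl) (auto simp: inner_Basis assms)
  then show ?thesis using assms by simp
qed

lemma norm_sum_Basis_le:
  fixes h :: "'a::euclidean_space"
  assumes "\<And>b. b \<in> Basis \<Longrightarrow> norm (f b) \<le> M"
  shows "norm (\<Sum>b\<in>Basis. (h \<bullet> b) *\<^sub>R f b) \<le> DIM('a) * norm h * M"
proof -
  have "norm (\<Sum>b\<in>Basis. (h \<bullet> b) *\<^sub>R f b) \<le> (\<Sum>b\<in>(Basis::'a set). norm h * M)"
  proof (rule sum_norm_le)
    fix b :: 'a assume b: "b \<in> Basis"
    show "norm ((h \<bullet> b) *\<^sub>R f b) \<le> norm h * M"
      unfolding norm_scaleR real_norm_def[symmetric]
      using Basis_le_norm[OF b, of h] assms[OF b] by (intro mult_mono) auto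
  qed
  then show ?thesis by simp
qed

lemma conn_diff_le:
  fixes h :: "'a::euclidean_space"
  assumes "\<And>b. b \<in> Basis \<Longrightarrow> norm (A b x - A' b y) \<le> M"
  shows "norm (conn A x h - conn A' y h) \<le> DIM('a) * norm h * M"
  unfolding conn_def sum_subtractf[symmetric] scaleR_diff_right[symmetric]
  by (rule norm_sum_Basis_le[OF assms])

lemma conn_path_continuous:
  assumes "\<And>b. b \<in> Basis \<Longrightarrow> continuous_on UNIV (A b)"
  shows "continuous_on {0..1} (\<lambda>t. conn A (z + t *\<^sub>R h) k)"
  unfolding conn_def
  by (intro continuous_on_sum continuous_on_scaleR continuous_on_const continuous_on_compose2[OF assms])
    (auto intro!: continuous_intros)

text \<open>An arbitrary choice of solution along the segment from \<open>z\<close> to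
  \<open>x\<close>, run in unit time. The estimates below hold for whichever solution is
  chosen.\<close>

definition transport_path where
  "transport_path A z p x = (SOME v. spin_path (\<lambda>t. conn A (z + t *\<^sub>R (x - z)) (x - z)) p v)"

definition transport where
  "transport A z p x = transport_path A z p x 1"

lemma spin_path_transport:
  assumes "\<And>b. b \<in> Basis \<Longrightarrow> continuous_on UNIV (A b)"
  shows "spin_path (\<lambda>t. conn A (z + t *\<^sub>R (x - z)) (x - z)) p (transport_path A z p x)"
proof -
  obtain v where "spin_path (\<lambda>t. conn A (z + t *\<^sub>R (x - z)) (x - z)) p v"
    by (rule spin_path_exists[OF conn_path_continuous[OF assms]])
  then show ?thesis unfolding transport_path_def
    by (rule someI[of "spin_path (\<lambda>t. conn A (z + t *\<^sub>R (x - z)) (x - z)) p"])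
qed

lemma norm_transport:
  assumes "\<And>b. b \<in> Basis \<Longrightarrow> continuous_on UNIV (A b)"
  shows "norm (transport A z p x) = norm p"
  unfolding transport_def using spin_path_norm[OF spin_path_transport[OF assms]] by simp

lemma transport_dist_connections:
  fixes x z :: "'a::euclidean_space"
  assumes A: "\<And>b. b \<in> Basis \<Longrightarrow> continuous_on UNIV (A b)"
    and A': "\<And>b. b \<in> Basis \<Longrightarrow> continuous_on UNIV (A' b)"
    and K: "continuous_on UNIV K" and B: "convex B" "z \<in> B" "x \<in> B"
    and le: "\<And>b y. b \<in> Basis \<Longrightarrow> y \<in> B \<Longrightarrow> norm (A b y - A' b y) \<le> K y"
  shows "norm (transport A z p x - transport A' z p x) \<le> norm p * (DIM('a) * norm (x - z) * segint K z x)"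
proof -
  have seg: "z + t *\<^sub>R (x - z) \<in> B" if "t \<in> {0..1}" for t
  proof -
    have "z + t *\<^sub>R (x - z) = (1 - t) *\<^sub>R z + t *\<^sub>R x" by (simp add: algebra_simps)
    then show ?thesis using B that by (simp add: convexD)
  qed
  let ?a = "\<lambda>A t. conn A (z + t *\<^sub>R (x - z)) (x - z)"
  have "norm (transport A z p x - transport A' z p x) \<le> norm p * integral {0..1} (\<lambda>t. norm (?a A t - ?a A' t))"
    unfolding transport_def
    by (rule spin_path_dist[OF spin_path_transport[OF A] spin_path_transport[OF A']
          conn_path_continuous[OF A] conn_path_continuous[OF A']])
  also have "\<dots> \<le> norm p * integral {0..1} (\<lambda>t. DIM('a) * norm (x - z) * K (z + t *\<^sub>R (x - z)))"
  proof (intro mult_left_mono integral_le integrable_continuous_real)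
    show "continuous_on {0..1} (\<lambda>t. norm (?a A t - ?a A' t))"
      by (intro continuous_intros conn_path_continuous[OF A] conn_path_continuous[OF A'])
    show "continuous_on {0..1} (\<lambda>t. DIM('a) * norm (x - z) * K (z + t *\<^sub>R (x - z)))"
      by (intro continuous_intros segint_continuous_path[OF K])
    show "norm (?a A t - ?a A' t) \<le> DIM('a) * norm (x - z) * K (z + t *\<^sub>R (x - z))" if "t \<in> {0..1}" for t
      by (intro conn_diff_le le seg[OF that])
  qed auto
  also have "integral {0..1} (\<lambda>t. DIM('a) * norm (x - z) * K (z + t *\<^sub>R (x - z))) = DIM('a) * norm (x - z) * segint K z x"
    by (simp add: segint_eq_integral[OF K])
  finally show ?thesis .
qed

lemma transport_hopf3_le:
  fixes x z :: "'a::euclidean_space"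
  assumes A: "\<And>b. b \<in> Basis \<Longrightarrow> continuous_on UNIV (A b)"
    and U: "quad_diff U DU"
    and K: "continuous_on UNIV K" and B: "convex B" "z \<in> B" "x \<in> B"
    and le: "\<And>b y. b \<in> Basis \<Longrightarrow> y \<in> B \<Longrightarrow> norm (DU y b - 2 *\<^sub>R cross3 (A b y) (U y)) \<le> K y"
  shows "norm (U x - hopf3 (transport A z p x)) \<le> norm (U z - hopf3 p) + DIM('a) * norm (x - z) * segint K z x"
proof -
  have seg: "z + t *\<^sub>R (x - z) \<in> B" if "t \<in> {0..1}" for t
  proof -
    have "z + t *\<^sub>R (x - z) = (1 - t) *\<^sub>R z + t *\<^sub>R x" by (simp add: algebra_simps)
    then show ?thesis using B that by (simp add: convexD)
  qed
  let ?\<gamma> = "\<lambda>t. z + t *\<^sub>R (x - z)"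
  have "norm (U (?\<gamma> 1) - hopf3 (transport_path A z p x 1))
      \<le> norm (U (?\<gamma> 0) - hopf3 p) + integral {0..1} (\<lambda>t. DIM('a) * norm (x - z) * K (?\<gamma> t))"
  proof (rule spin_path_hopf3[OF spin_path_transport[OF A], where f="\<lambda>t. U (?\<gamma> t)" and f'="\<lambda>t. DU (?\<gamma> t) (x - z)"])
    fix t :: real assume t: "t \<in> {0..1}"
    have d: "(?\<gamma> has_derivative (\<lambda>r. r *\<^sub>R (x - z))) (at t within {0..1})"
      by (auto intro!: derivative_eq_intros)
    have "((\<lambda>t. U (?\<gamma> t)) has_derivative (\<lambda>r. DU (?\<gamma> t) (r *\<^sub>R (x - z)))) (at t within {0..1})"
      by (rule has_derivative_compose[OF d quad_diff_has_derivative[OF U]])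
    then show "((\<lambda>t. U (?\<gamma> t)) has_vector_derivative DU (?\<gamma> t) (x - z)) (at t within {0..1})"
      by (simp add: has_vector_derivative_def linear_scale[OF quad_diff_linear[OF U]])
    have "DU (?\<gamma> t) (x - z) = DU (?\<gamma> t) (\<Sum>b\<in>Basis. ((x - z) \<bullet> b) *\<^sub>R b)" by (simp add: euclidean_representation)
    also have "\<dots> = (\<Sum>b\<in>Basis. ((x - z) \<bullet> b) *\<^sub>R DU (?\<gamma> t) b)"
      by (simp add: linear_sum[OF quad_diff_linear[OF U]] linear_scale[OF quad_diff_linear[OF U]])
    finally have e1: "DU (?\<gamma> t) (x - z) = (\<Sum>b\<in>Basis. ((x - z) \<bullet> b) *\<^sub>R DU (?\<gamma> t) b)" .
    have e2: "2 *\<^sub>R cross3 (conn A (?\<gamma> t) (x - z)) (U (?\<gamma> t))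
        = (\<Sum>b\<in>Basis. ((x - z) \<bullet> b) *\<^sub>R (2 *\<^sub>R cross3 (A b (?\<gamma> t)) (U (?\<gamma> t))))"
    proof -
      have "linear (\<lambda>a. 2 *\<^sub>R cross3 a (U (?\<gamma> t)))"
        by (rule linearI) (simp_all add: cross_add_left cross_mult_left scaleR_add_right)
      from linear_sum[OF this, of "\<lambda>b. ((x - z) \<bullet> b) *\<^sub>R A b (?\<gamma> t)" Basis] linear_scale[OF this]
      show ?thesis by (simp only: conn_def)
    qed
    show "norm (DU (?\<gamma> t) (x - z) - 2 *\<^sub>R cross3 (conn A (?\<gamma> t) (x - z)) (U (?\<gamma> t)))
        \<le> DIM('a) * norm (x - z) * K (?\<gamma> t)"
      unfolding e1 e2 sum_subtractf[symmetric] scaleR_diff_right[symmetric, of "(x - z) \<bullet> _"]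
      by (intro norm_sum_Basis_le le seg[OF t])
  next
    show "continuous_on {0..1} (\<lambda>t. DIM('a) * norm (x - z) * K (?\<gamma> t))"
      by (intro continuous_intros segint_continuous_path[OF K])
  qed
  then show ?thesis by (simp add: segint_eq_integral[OF K] transport_def)
qed

text \<open>Its purpose is Borel measurability in the endpoint. Comparing the pulled back
  connections on two segments from \<open>z\<close> gives a Lipschitz bound at each
  \<open>x\<close>, with a constant depending on \<open>x\<close>.\<close>

lemma transport_continuous:
  fixes z :: "'a::euclidean_space"
  assumes A: "\<And>b. b \<in> Basis \<Longrightarrow> quad_diff (A b) (DA b)"
  shows "continuous_on UNIV (transport A z p)"
proof -
  note c = quad_diff_continuous[OF A]
  have "\<forall>b\<in>Basis. \<exists>C\<ge>0. (\<forall>x. norm (A b x) \<le> C) \<and> (\<forall>x y. norm (A b x - A b y) \<le> 2 * C * norm (x - y))"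
    using A by (meson quad_diffE)
  then obtain C where C: "\<And>b. b \<in> Basis \<Longrightarrow> C b \<ge> 0" "\<And>b x. b \<in> Basis \<Longrightarrow> norm (A b x) \<le> C b"
    "\<And>b x y. b \<in> Basis \<Longrightarrow> norm (A b x - A b y) \<le> 2 * C b * norm (x - y)" by metis
  define S where "S = (\<Sum>b\<in>(Basis::'a set). C b)"
  have CS: "C b \<le> S" if "b \<in> Basis" for b unfolding S_def by (rule member_le_sum) (use that C(1) in auto)
  have S: "S \<ge> 0" unfolding S_def using C(1) by (rule sum_nonneg)
  have AS: "norm (A b x) \<le> S" "norm (A b x - A b y) \<le> 2 * S * norm (x - y)" if "b \<in> Basis" for b x y
  proof -
    show "norm (A b x) \<le> S" using C(2)[OF that, of x] CS[OF that] by linarith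
    have "2 * C b * norm (x - y) \<le> 2 * S * norm (x - y)" using CS[OF that] by (intro mult_right_mono mult_left_mono) auto
    then show "norm (A b x - A b y) \<le> 2 * S * norm (x - y)" using C(3)[OF that, of x y] by linarith
  qed
  show ?thesis
  proof (intro continuous_at_imp_continuous_on ballI)
    fix x :: 'a
    define L where "L = norm p * (DIM('a) * norm (x - z) * (2 * S) + DIM('a) * S)"
    have le: "norm (transport A z p x - transport A z p y) \<le> L * norm (x - y)" for y
    proof -
      let ?a = "\<lambda>x t. conn A (z + t *\<^sub>R (x - z)) (x - z)"
      have "norm (transport A z p x - transport A z p y) \<le> norm p * integral {0..1} (\<lambda>t. norm (?a x t - ?a y t))"
        unfolding transport_def
        by (rule spin_path_dist[OF spin_path_transport[OF c] spin_path_transport[OF c]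
              conn_path_continuous[OF c] conn_path_continuous[OF c]])
      also have "\<dots> \<le> norm p * integral {0..1} (\<lambda>t::real. (DIM('a) * norm (x - z) * (2 * S) + DIM('a) * S) * norm (x - y))"
      proof (intro mult_left_mono integral_le integrable_continuous_real)
        show "continuous_on {0..1} (\<lambda>t. norm (?a x t - ?a y t))"
          by (intro continuous_intros conn_path_continuous[OF c])
        fix t :: real assume t: "t \<in> {0..1}"
        have "(z + t *\<^sub>R (x - z)) - (z + t *\<^sub>R (y - z)) = t *\<^sub>R (x - y)" by (simp add: algebra_simps)
        then have n: "norm ((z + t *\<^sub>R (x - z)) - (z + t *\<^sub>R (y - z))) \<le> norm (x - y)"
          using t by (simp add: mult_left_le_one_le)
        have "?a x t - ?a y t = (conn A (z + t *\<^sub>R (x - z)) (x - z) - conn A (z + t *\<^sub>R (y - z)) (x - z))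
            + conn A (z + t *\<^sub>R (y - z)) (x - y)"
          using conn_add[of A "z + t *\<^sub>R (y - z)" "y - z" "x - y"] by simp
        also have "norm \<dots> \<le> DIM('a) * norm (x - z) * (2 * S * norm (x - y)) + DIM('a) * norm (x - y) * S"
        proof (rule norm_triangle_mono)
          show "norm (conn A (z + t *\<^sub>R (x - z)) (x - z) - conn A (z + t *\<^sub>R (y - z)) (x - z))
              \<le> DIM('a) * norm (x - z) * (2 * S * norm (x - y))"
            using S n by (intro conn_diff_le order.trans[OF AS(2)] mult_left_mono) auto
          show "norm (conn A (z + t *\<^sub>R (y - z)) (x - y)) \<le> DIM('a) * norm (x - y) * S"
            unfolding conn_def by (rule norm_sum_Basis_le[OF AS(1)])
        qed
        finally show "norm (?a x t - ?a y t) \<le> (DIM('a) * norm (x - z) * (2 * S) + DIM('a) * S) * norm (x - y)"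
          by (simp add: algebra_simps)
      qed auto
      finally show ?thesis by (simp add: L_def)
    qed
    have "((\<lambda>y. transport A z p y - transport A z p x) \<longlongrightarrow> 0) (at x)"
    proof (rule Lim_null_comparison)
      show "\<forall>\<^sub>F y in at x. norm (transport A z p y - transport A z p x) \<le> L * norm (x - y)"
        using le by (intro always_eventually allI) (simp add: norm_minus_commute)
      show "((\<lambda>y. L * norm (x - y)) \<longlongrightarrow> 0) (at x)" by (auto intro!: tendsto_eq_intros)
    qed
    then show "isCont (transport A z p) x" by (simp add: isCont_def LIM_zero_iff)
  qed
qed

text \<open>The constant \<open>Q\<close> depends on the connection. This is harmless, because \<open>s\<close> tends to \<open>0\<close> while the
  connection is fixed.\<close>

lemma transport_variation:
  fixes z :: "'a::euclidean_space"
  assumes A: "\<And>b. b \<in> Basis \<Longrightarrow> quad_diff (A b) (DA b)"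
    and K: "continuous_on UNIV K" and B: "convex B" "z \<in> B"
    and le: "\<And>b c y. b \<in> Basis \<Longrightarrow> c \<in> Basis \<Longrightarrow> y \<in> B \<Longrightarrow>
      norm (DA b y c - DA c y b - 2 *\<^sub>R cross3 (A c y) (A b y)) \<le> K y"
    and p: "norm p = 1"
  obtains Q where "\<And>x s c. x \<in> B \<Longrightarrow> norm (x - z) \<le> 2 \<Longrightarrow> c \<in> Basis \<Longrightarrow> 0 < s \<Longrightarrow> s \<le> 1 \<Longrightarrow>
    norm (transport A z p (x + s *\<^sub>R c) - transport A z p x - s *\<^sub>R spin (A c x) (transport A z p x))
      \<le> s * (DIM('a) * norm (x - z) * segint K z x) + Q * s\<^sup>2"
proof -
  note c = quad_diff_continuous[OF A]
  have "\<forall>b\<in>Basis. \<exists>C\<ge>0. (\<forall>x. norm (A b x) \<le> C) \<and> (\<forall>x y. norm (A b x - A b y) \<le> 2 * C * norm (x - y))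
      \<and> (\<forall>x k. norm (A b (x + k) - A b x - DA b x k) \<le> C * (norm k)\<^sup>2)"
    using A by (meson quad_diffE)
  then obtain C where C: "\<And>b. b \<in> Basis \<Longrightarrow> C b \<ge> 0" "\<And>b x. b \<in> Basis \<Longrightarrow> norm (A b x) \<le> C b"
    "\<And>b x y. b \<in> Basis \<Longrightarrow> norm (A b x - A b y) \<le> 2 * C b * norm (x - y)"
    "\<And>b x k. b \<in> Basis \<Longrightarrow> norm (A b (x + k) - A b x - DA b x k) \<le> C b * (norm k)\<^sup>2" by metis
  define S where "S = (\<Sum>b\<in>(Basis::'a set). C b)"
  have CS: "C b \<le> S" if "b \<in> Basis" for b unfolding S_def by (rule member_le_sum) (use that C(1) in auto)
  have S: "S \<ge> 0" unfolding S_def using C(1) by (rule sum_nonneg)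
  have AS: "norm (A b x) \<le> S" "norm (A b x - A b y) \<le> 2 * S * norm (x - y)"
      "norm (A b (x + k) - A b x - DA b x k) \<le> S * (norm k)\<^sup>2" if "b \<in> Basis" for b x y k
  proof -
    show "norm (A b x) \<le> S" using C(2)[OF that, of x] CS[OF that] by linarith
    have "2 * C b * norm (x - y) \<le> 2 * S * norm (x - y)" using CS[OF that] by (intro mult_right_mono mult_left_mono) auto
    then show "norm (A b x - A b y) \<le> 2 * S * norm (x - y)" using C(3)[OF that, of x y] by linarith
    have "C b * (norm k)\<^sup>2 \<le> S * (norm k)\<^sup>2" using CS[OF that] by (intro mult_right_mono) auto
    then show "norm (A b (x + k) - A b x - DA b x k) \<le> S * (norm k)\<^sup>2" using C(4)[OF that, of x k] by linarith
  qed
  define D where "D = real DIM('a)"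
  have D: "D \<ge> 0" by (simp add: D_def)
  \<comment> \<open>The first bracket collects the Taylor remainder \<open>E1\<close> and the
    increment \<open>E2\<close>, the second the product of the norms of \<open>?b t - ?a t\<close>
    and \<open>\<alpha> t\<close>. The literal factor 2 next to \<open>D\<close> is the bound on
    \<open>norm (x - z)\<close>.\<close>
  define Q where "Q = (D * 2 * S + 2 * S) + (D * 2 * (2 * S) + S) * S"
  show ?thesis
  proof (rule that[of Q])
    fix x c :: 'a and s :: real
    assume x: "x \<in> B" "norm (x - z) \<le> 2" and cB: "c \<in> Basis" and s: "0 < s" "s \<le> 1"
    let ?\<gamma> = "\<lambda>t. z + t *\<^sub>R (x - z)"
    \<comment> \<open>This segment may leave \<open>B\<close>. Along it only the bounds
      \<open>AS\<close> are applied, which hold in the whole space; the curvature is evaluated on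
      the unperturbed segment.\<close>
    let ?\<gamma>' = "\<lambda>t. z + t *\<^sub>R (x + s *\<^sub>R c - z)"
    let ?a = "\<lambda>t. conn A (?\<gamma> t) (x - z)"
    let ?b = "\<lambda>t. conn A (?\<gamma>' t) (x + s *\<^sub>R c - z)"
    \<comment> \<open>Moving the endpoint by \<open>s *\<^sub>R c\<close> moves the point at time
      \<open>t\<close> by \<open>t\<close> times that vector. The factor \<open>t\<close> is
      supplied by \<open>spin_path_variation\<close>, so \<open>\<alpha>\<close> holds the
      connection in the full direction \<open>s *\<^sub>R c\<close>.\<close>
    define \<alpha> where "\<alpha> t = s *\<^sub>R A c (?\<gamma> t)" for t
    define \<alpha>' where "\<alpha>' t = s *\<^sub>R DA c (?\<gamma> t) (x - z)" for t
    have seg: "?\<gamma> t \<in> B" if "t \<in> {0..1}" for t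
    proof -
      have "?\<gamma> t = (1 - t) *\<^sub>R z + t *\<^sub>R x" by (simp add: algebra_simps)
      then show ?thesis using B x that by (simp add: convexD)
    qed
    have nc: "norm c = 1" using cB by simp
    let ?g = "\<lambda>t. s * (D * norm (x - z) * K (?\<gamma> t)) + Q * s\<^sup>2"
    have "norm (transport_path A z p (x + s *\<^sub>R c) 1 - transport_path A z p x 1 - spin (\<alpha> 1) (transport_path A z p x 1))
        \<le> norm p * integral {0..1} ?g"
    proof (rule spin_path_variation[OF spin_path_transport[OF c] spin_path_transport[OF c], where \<alpha>'=\<alpha>'])
      fix t :: real assume t: "t \<in> {0..1}"
      have d: "(?\<gamma> has_derivative (\<lambda>r. r *\<^sub>R (x - z))) (at t within {0..1})"
        by (auto intro!: derivative_eq_intros)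
      have "((\<lambda>t. A c (?\<gamma> t)) has_derivative (\<lambda>r. DA c (?\<gamma> t) (r *\<^sub>R (x - z)))) (at t within {0..1})"
        by (rule has_derivative_compose[OF d quad_diff_has_derivative[OF A[OF cB]]])
      then have "((\<lambda>t. A c (?\<gamma> t)) has_vector_derivative DA c (?\<gamma> t) (x - z)) (at t within {0..1})"
        by (simp add: has_vector_derivative_def linear_scale[OF quad_diff_linear[OF A[OF cB]]])
      then show "(\<alpha> has_vector_derivative \<alpha>' t) (at t within {0..1})"
        unfolding \<alpha>_def[abs_def] \<alpha>'_def
        by (rule bounded_linear.has_vector_derivative[OF bounded_linear_scaleR_right])
      let ?y = "?\<gamma> t"
      let ?k = "(t * s) *\<^sub>R c"
      have \<gamma>': "?\<gamma>' t = ?y + ?k" by (simp add: algebra_simps)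
      have ts: "0 \<le> t * s" "t * s \<le> s" "norm ?k = t * s"
        using t s nc by (auto simp: mult_left_le_one_le)
      have tss: "(t * s)\<^sup>2 \<le> s\<^sup>2" "s * (t * s) \<le> s\<^sup>2"
        using power_mono[OF ts(2,1), of 2] mult_left_mono[OF ts(2), of s] s by (simp_all add: power2_eq_square)
      have b: "?b t = conn A (?y + ?k) (x - z) + s *\<^sub>R A c (?y + ?k)"
      proof -
        have "x + s *\<^sub>R c - z = (x - z) + s *\<^sub>R c" by simp
        then have "?b t = conn A (?y + ?k) ((x - z) + s *\<^sub>R c)" unfolding \<gamma>' by (rule arg_cong)
        also have "\<dots> = conn A (?y + ?k) (x - z) + s *\<^sub>R A c (?y + ?k)"
          by (simp only: conn_add conn_scaleR_Basis[OF cB])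
        finally show ?thesis .
      qed
      define h where "h = x - z"
      have lin: "linear (DA b ?y)" if "b \<in> Basis" for b by (rule quad_diff_linear[OF A[OF that]])
      \<comment> \<open>\<open>E3\<close> is the curvature contracted with \<open>h\<close> and
        \<open>c\<close>; \<open>E1\<close> and \<open>E2\<close> are of second order in
        \<open>s\<close>. Splitting the variation defect into these three shows that the curvature
        is its only first-order part.\<close>
      define E1 where "E1 = (\<Sum>b\<in>Basis. (h \<bullet> b) *\<^sub>R (A b (?y + ?k) - A b ?y - DA b ?y ?k))"
      define E2 where "E2 = s *\<^sub>R (A c (?y + ?k) - A c ?y)"
      define E3 where "E3 = (\<Sum>b\<in>Basis. (h \<bullet> b) *\<^sub>R (DA b ?y c - DA c ?y b - 2 *\<^sub>R cross3 (A c ?y) (A b ?y)))"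
      have DAh: "DA c ?y h = (\<Sum>b\<in>Basis. (h \<bullet> b) *\<^sub>R DA c ?y b)"
      proof -
        have "DA c ?y h = DA c ?y (\<Sum>b\<in>Basis. (h \<bullet> b) *\<^sub>R b)" by (simp add: euclidean_representation)
        also have "\<dots> = (\<Sum>b\<in>Basis. (h \<bullet> b) *\<^sub>R DA c ?y b)"
          by (simp add: linear_sum[OF lin[OF cB]] linear_scale[OF lin[OF cB]])
        finally show ?thesis .
      qed
      have cr: "cross3 (conn A ?y h) (A c ?y) = - (\<Sum>b\<in>Basis. (h \<bullet> b) *\<^sub>R cross3 (A c ?y) (A b ?y))"
      proof -
        have "linear (\<lambda>a. cross3 (A c ?y) a)"
          by (rule linearI) (simp_all add: cross_add_right cross_mult_right)
        from linear_sum[OF this, of "\<lambda>b. (h \<bullet> b) *\<^sub>R A b ?y" Basis] linear_scale[OF this]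
        have "cross3 (A c ?y) (conn A ?y h) = (\<Sum>b\<in>Basis. (h \<bullet> b) *\<^sub>R cross3 (A c ?y) (A b ?y))"
          by (simp only: conn_def)
        then show ?thesis using cross_skew[of "conn A ?y h" "A c ?y"] by simp
      qed
      have e3: "E3 = (\<Sum>b\<in>Basis. (h \<bullet> b) *\<^sub>R DA b ?y c) - DA c ?y h + 2 *\<^sub>R cross3 (conn A ?y h) (A c ?y)"
        unfolding E3_def DAh cr
        by (simp add: scaleR_diff_right sum_subtractf scaleR_sum_right mult.commute)
      have e1: "E1 = conn A (?y + ?k) h - conn A ?y h - (t * s) *\<^sub>R (\<Sum>b\<in>Basis. (h \<bullet> b) *\<^sub>R DA b ?y c)"
      proof -
        have "(\<Sum>b\<in>Basis. (h \<bullet> b) *\<^sub>R DA b ?y ?k) = (\<Sum>b\<in>Basis. (h \<bullet> b) *\<^sub>R ((t * s) *\<^sub>R DA b ?y c))"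
          by (intro sum.cong refl) (simp add: linear_scale[OF lin])
        then show ?thesis
          unfolding E1_def conn_def
          by (simp add: scaleR_diff_right sum_subtractf scaleR_sum_right mult.commute)
      qed
      have "?b t - ?a t - \<alpha> t - t *\<^sub>R \<alpha>' t + (2 * t) *\<^sub>R cross3 (?a t) (\<alpha> t) = E1 + E2 + (t * s) *\<^sub>R E3"
        unfolding b e1 e3 E2_def \<alpha>_def \<alpha>'_def h_def[symmetric] cross_mult_right
        by (simp add: algebra_simps)
      moreover have "norm E1 \<le> D * norm h * (S * s\<^sup>2)"
        unfolding E1_def D_def
      proof (rule norm_sum_Basis_le)
        fix b :: 'a assume "b \<in> Basis"
        from AS(3)[OF this, of ?y ?k] show "norm (A b (?y + ?k) - A b ?y - DA b ?y ?k) \<le> S * s\<^sup>2"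
          unfolding ts(3) using mult_left_mono[OF tss(1) S] by linarith
      qed
      moreover have "norm E2 \<le> 2 * S * s\<^sup>2"
      proof -
        have "norm (A c (?y + ?k) - A c ?y) \<le> 2 * S * (t * s)"
          using AS(2)[OF cB, of "?y + ?k" ?y] by (simp only: add_diff_cancel_left' ts(3))
        then have "norm E2 \<le> s * (2 * S * (t * s))"
          unfolding E2_def using s by (simp add: mult_left_mono)
        also have "\<dots> = 2 * S * (s * (t * s))" by simp
        also have "\<dots> \<le> 2 * S * s\<^sup>2" using tss(2) S by (intro mult_left_mono) auto
        finally show ?thesis .
      qed
      moreover have "norm ((t * s) *\<^sub>R E3) \<le> s * (D * norm h * K ?y)"
      proof -
        have "norm E3 \<le> D * norm h * K ?y"
          unfolding E3_def D_def by (rule norm_sum_Basis_le) (use le[OF _ cB seg[OF t]] in blast)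
        then have "(t * s) * norm E3 \<le> s * (D * norm h * K ?y)"
          using ts by (intro mult_mono) auto
        then show ?thesis using ts(1) by simp
      qed
      ultimately have n1: "norm (?b t - ?a t - \<alpha> t - t *\<^sub>R \<alpha>' t + (2 * t) *\<^sub>R cross3 (?a t) (\<alpha> t))
          \<le> D * norm h * (S * s\<^sup>2) + 2 * S * s\<^sup>2 + s * (D * norm h * K ?y)"
        by (simp only: norm_triangle_mono)
      have n2: "norm (?b t - ?a t) \<le> D * norm h * (2 * S * s) + S * s"
      proof -
        have "?b t - ?a t = (conn A (?y + ?k) h - conn A ?y h) + s *\<^sub>R A c (?y + ?k)"
          unfolding b h_def by simp
        also have "norm \<dots> \<le> D * norm h * (2 * S * s) + S * s"
        proof (rule norm_triangle_mono)
          show "norm (conn A (?y + ?k) h - conn A ?y h) \<le> D * norm h * (2 * S * s)"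
            unfolding D_def
          proof (rule conn_diff_le)
            fix b :: 'a assume "b \<in> Basis"
            from AS(2)[OF this, of "?y + ?k" ?y] have "norm (A b (?y + ?k) - A b ?y) \<le> 2 * S * (t * s)"
              by (simp only: add_diff_cancel_left' ts(3))
            also have "\<dots> \<le> 2 * S * s" using ts(2) S by (intro mult_left_mono) auto
            finally show "norm (A b (?y + ?k) - A b ?y) \<le> 2 * S * s" .
          qed
          show "norm (s *\<^sub>R A c (?y + ?k)) \<le> S * s"
            using AS(1)[OF cB, of "?y + ?k"] s by (simp add: mult.commute)
        qed
        finally show ?thesis .
      qed
      have n3: "norm (\<alpha> t) \<le> S * s" unfolding \<alpha>_def using AS(1)[OF cB, of ?y] s by (simp add: mult.commute)
      have h2: "D * norm h \<le> D * 2" using x(2) D by (simp add: h_def mult_left_mono)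
      have "D * norm h * (S * s\<^sup>2) \<le> D * 2 * (S * s\<^sup>2)" using h2 S by (intro mult_right_mono) auto
      moreover have "norm (?b t - ?a t) * norm (\<alpha> t) \<le> (D * 2 * (2 * S * s) + S * s) * (S * s)"
      proof (intro mult_mono n3)
        have "D * norm h * (2 * S * s) \<le> D * 2 * (2 * S * s)" using h2 S s by (intro mult_right_mono) auto
        then show "norm (?b t - ?a t) \<le> D * 2 * (2 * S * s) + S * s" using n2 by linarith
        show "0 \<le> D * 2 * (2 * S * s) + S * s" using D S s by simp
      qed auto
      moreover have "D * 2 * (S * s\<^sup>2) + 2 * S * s\<^sup>2 + (D * 2 * (2 * S * s) + S * s) * (S * s) = Q * s\<^sup>2"
        by (simp add: Q_def power2_eq_square algebra_simps)
      ultimately show "norm (?b t - ?a t - \<alpha> t - t *\<^sub>R \<alpha>' t + (2 * t) *\<^sub>R cross3 (?a t) (\<alpha> t))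
          + norm (?b t - ?a t) * norm (\<alpha> t) \<le> ?g t"
        using n1 unfolding h_def by linarith
    next
      show "continuous_on {0..1} ?g" by (intro continuous_intros segint_continuous_path[OF K])
    qed
    also have "norm p * integral {0..1} ?g = s * (D * norm (x - z) * segint K z x) + Q * s\<^sup>2"
    proof -
      have "(\<lambda>t. K (?\<gamma> t)) integrable_on {0..1}"
        by (intro integrable_continuous_real segint_continuous_path[OF K])
      then have "integral {0..1} ?g = integral {0..1} (\<lambda>t. s * (D * norm (x - z) * K (?\<gamma> t))) + integral {0..1} (\<lambda>t::real. Q * s\<^sup>2)"
        by (intro Henstock_Kurzweil_Integration.integral_add integrable_on_mult_right) auto
      then show ?thesis by (simp add: p segint_eq_integral[OF K])
    qed
    finally show "norm (transport A z p (x + s *\<^sub>R c) - transport A z p x - s *\<^sub>R spin (A c x) (transport A z p x))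
      \<le> s * (DIM('a) * norm (x - z) * segint K z x) + Q * s\<^sup>2"
      by (simp add: transport_def \<alpha>_def spin.scaleR_left D_def)
  qed
qed

lemma AE_in_open_exists:
  assumes "AE z in lborel. z \<in> B \<longrightarrow> P z" "open B" "B \<noteq> {}"
  obtains z :: "'a::euclidean_space" where "z \<in> B" "P z"
proof (rule ccontr)
  assume "\<not> thesis"
  with that have np: "\<And>z. z \<in> B \<Longrightarrow> \<not> P z" by blast
  have "AE z in lborel. z \<notin> B" using assms(1) by eventually_elim (use np in blast)
  then have "B \<in> null_sets lborel" using AE_iff_null_sets[of B lborel] assms(2) by simp
  then have "B \<in> null_sets lebesgue" by (rule null_sets_completionI)
  then have "negligible B" by (simp only: negligible_iff_null_sets)
  then show False using open_not_negligible assms(2,3) by blast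
qed

lemma summable_of_nn_integral:
  fixes f :: "nat \<Rightarrow> 'a::euclidean_space \<Rightarrow> real"
  assumes meas [measurable]: "\<And>n. f n \<in> borel_measurable borel" "B \<in> sets borel" and nn: "\<And>n x. 0 \<le> f n x"
    and fin: "(\<Sum>n. \<integral>\<^sup>+x. ennreal (f n x) * indicator B x \<partial>lborel) < \<infinity>"
  shows "AE x in lborel. x \<in> B \<longrightarrow> summable (\<lambda>n. f n x)"
    and "integrable lborel (\<lambda>x. indicator B x * f n x)"
    and "(\<lambda>n. LINT x|lborel. indicator B x * f n x) \<longlonglongrightarrow> 0"
proof -
  have eq: "ennreal (f n x) * indicator B x = ennreal (indicator B x * f n x)" for n x
    by (simp add: indicator_def)
  have "(\<integral>\<^sup>+x. (\<Sum>n. ennreal (f n x) * indicator B x) \<partial>lborel) \<noteq> \<infinity>"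
    using fin by (subst nn_integral_suminf) auto
  then have "AE x in lborel. (\<Sum>n. ennreal (f n x) * indicator B x) \<noteq> \<infinity>"
    by (intro nn_integral_PInf_AE) auto
  then show "AE x in lborel. x \<in> B \<longrightarrow> summable (\<lambda>n. f n x)"
  proof eventually_elim
    case (elim x)
    show ?case
    proof
      assume "x \<in> B"
      with elim have "(\<Sum>n. ennreal (f n x)) \<noteq> top" by simp
      then show "summable (\<lambda>n. f n x)" by (rule summable_suminf_not_top[OF nn])
    qed
  qed
  have fin1: "(\<integral>\<^sup>+x. ennreal (f n x) * indicator B x \<partial>lborel) < \<infinity>" for n
  proof -
    have "(\<integral>\<^sup>+x. ennreal (f n x) * indicator B x \<partial>lborel) \<le> (\<Sum>n. \<integral>\<^sup>+x. ennreal (f n x) * indicator B x \<partial>lborel)"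
      using sum_le_suminf[of "\<lambda>n. \<integral>\<^sup>+x. ennreal (f n x) * indicator B x \<partial>lborel" "{n}"] by simp
    then show ?thesis using fin by (rule order.strict_trans1)
  qed
  show i: "integrable lborel (\<lambda>x. indicator B x * f n x)" for n
  proof (rule integrableI_bounded)
    have "(\<integral>\<^sup>+x. ennreal (norm (indicator B x * f n x)) \<partial>lborel) = (\<integral>\<^sup>+x. ennreal (f n x) * indicator B x \<partial>lborel)"
      unfolding eq using nn by (intro nn_integral_cong) (simp add: abs_mult)
    then show "(\<integral>\<^sup>+x. ennreal (norm (indicator B x * f n x)) \<partial>lborel) < \<infinity>" using fin1 by simp
  qed simp
  have r: "(\<integral>\<^sup>+x. ennreal (f n x) * indicator B x \<partial>lborel) = ennreal (LINT x|lborel. indicator B x * f n x)" for n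
    unfolding eq using i nn by (intro nn_integral_eq_integral) auto
  have "(\<Sum>n. ennreal (LINT x|lborel. indicator B x * f n x)) \<noteq> top"
    using fin unfolding r by simp
  then have "summable (\<lambda>n. LINT x|lborel. indicator B x * f n x)"
    by (rule summable_suminf_not_top[rotated]) (auto intro!: Bochner_Integration.integral_nonneg simp: nn)
  then show "(\<lambda>n. LINT x|lborel. indicator B x * f n x) \<longlonglongrightarrow> 0" by (rule summable_LIMSEQ_zero)
qed

lemma measurable_spin:
  assumes "f \<in> borel_measurable borel" "g \<in> borel_measurable borel"
  shows "(\<lambda>x. spin (f x) (g x)) \<in> borel_measurable borel"
proof -
  have "(\<lambda>y. spin (fst y) (snd y)) \<in> borel_measurable borel"
    by (intro borel_measurable_continuous_onI spin.continuous_on continuous_on_fst continuous_on_snd continuous_on_id)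
  then have "(\<lambda>y. spin (fst y) (snd y)) \<in> borel_measurable (borel \<Otimes>\<^sub>M borel)" by (simp add: borel_prod)
  from measurable_compose[OF _ this, of "\<lambda>x. (f x, g x)" borel] assms show ?thesis by simp
qed

lemma compact_subset_ball_radius:
  fixes S :: "'a::euclidean_space set"
  assumes "compact S" "S \<subseteq> ball 0 1"
  obtains r where "0 \<le> r" "r < 1" "S \<subseteq> cball 0 r"
proof (cases "S = {}")
  case True
  then show ?thesis using that[of 0] by simp
next
  case False
  obtain y where y: "y \<in> S" "\<And>x. x \<in> S \<Longrightarrow> norm x \<le> norm y"
    using continuous_attains_sup[OF assms(1) False continuous_on_norm_id] by auto
  have "norm y < 1" using assms(2) y(1) by auto
  then show ?thesis using y(2) by (intro that[of "norm y"]) auto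
qed

text \<open>The analytic core, free of any formula for the connection. A single function
  \<open>K n\<close> bounds the step from one connection to the next, the curvature, and the failure
  of \<open>U n\<close> to be parallel. The last two bounds are required only inside radius
  \<open>R n\<close>, because mollified fields satisfy the right equations only away from the
  boundary.\<close>

lemma flat_connection_limit:
  fixes A :: "nat \<Rightarrow> 'a::euclidean_space \<Rightarrow> 'a \<Rightarrow> real^3"
  assumes A: "\<And>n b. b \<in> Basis \<Longrightarrow> quad_diff (A n b) (DA n b)"
    and U: "\<And>n. quad_diff (U n) (DU n)"
    and K: "\<And>n. continuous_on UNIV (K n)" "\<And>n x. 0 \<le> K n x"
    and Kdiff: "\<And>n b x. b \<in> Basis \<Longrightarrow> norm x < 1 \<Longrightarrow> norm (A (Suc n) b x - A n b x) \<le> K n x"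
    and Kcurv: "\<And>n b c x. b \<in> Basis \<Longrightarrow> c \<in> Basis \<Longrightarrow> norm x < R n \<Longrightarrow>
      norm (DA n b x c - DA n c x b - 2 *\<^sub>R cross3 (A n c x) (A n b x)) \<le> K n x"
    and Kpar: "\<And>n b x. b \<in> Basis \<Longrightarrow> norm x < R n \<Longrightarrow>
      norm (DU n x b - 2 *\<^sub>R cross3 (A n b x) (U n x)) \<le> K n x"
    and Ksum: "(\<Sum>n. \<integral>\<^sup>+x. ennreal (K n x) * indicator (ball 0 1) x \<partial>lborel) < \<infinity>"
    and R: "R \<longlonglongrightarrow> 1"
    and Ulim: "AE x in lborel. norm x < 1 \<longrightarrow> (\<lambda>n. U n x) \<longlonglongrightarrow> u x \<and> norm (u x) = 1"
    and B [measurable]: "\<And>b. b \<in> Basis \<Longrightarrow> B b \<in> borel_measurable borel"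
    and Bint: "\<And>b. b \<in> Basis \<Longrightarrow> integrable lborel (B b)"
    and Alim: "\<And>b. b \<in> Basis \<Longrightarrow> (\<lambda>n. LINT x|lborel. indicator (ball 0 1) x * norm (A n b x - B b x)) \<longlonglongrightarrow> 0"
    and Aint: "\<And>n b. b \<in> Basis \<Longrightarrow> integrable lborel (\<lambda>x. indicator (ball 0 1) x * norm (A n b x - B b x))"
  obtains v where "v \<in> borel_measurable borel" "\<And>x. norm (v x) \<le> 1"
    "AE x in lborel. norm x < 1 \<longrightarrow> norm (v x) = 1 \<and> hopf3 (v x) = u x"
    "\<And>\<phi> b. test_function (ball 0 1) \<phi> \<Longrightarrow> b \<in> Basis \<Longrightarrow>
      (LINT x|lborel. pderiv_at \<phi> b x *\<^sub>R v x) = - (LINT x|lborel. \<phi> x *\<^sub>R spin (B b x) (v x))"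
proof -
  let ?B = "ball (0::'a) 1"
  define D where "D = real DIM('a)"
  have D: "D \<ge> 0" by (simp add: D_def)

  \<comment> \<open>Choice of the base point\<close>
  have "emeasure lborel ?B < \<infinity>" using emeasure_lborel_ball_finite by simp
  then have "AE z in lborel. z \<in> ?B \<longrightarrow> (\<Sum>n. \<integral>\<^sup>+x. ennreal (segint (K n) z x) * indicator ?B x \<partial>lborel) < \<infinity>"
    by (intro AE_segint_summable K Ksum) auto
  with Ulim have "AE z in lborel. z \<in> ?B \<longrightarrow> (\<Sum>n. \<integral>\<^sup>+x. ennreal (segint (K n) z x) * indicator ?B x \<partial>lborel) < \<infinity>
      \<and> (\<lambda>n. U n z) \<longlonglongrightarrow> u z \<and> norm (u z) = 1"
    by eventually_elim simp
  then obtain z where z: "z \<in> ?B" and "(\<Sum>n. \<integral>\<^sup>+x. ennreal (segint (K n) z x) * indicator ?B x \<partial>lborel) < \<infinity>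
      \<and> (\<lambda>n. U n z) \<longlonglongrightarrow> u z \<and> norm (u z) = 1"
    by (rule AE_in_open_exists) auto
  then have zsum: "(\<Sum>n. \<integral>\<^sup>+x. ennreal (segint (K n) z x) * indicator ?B x \<partial>lborel) < \<infinity>"
    and zU: "(\<lambda>n. U n z) \<longlonglongrightarrow> u z" "norm (u z) = 1" by auto
  obtain p where p: "norm p = 1" "hopf3 p = u z" using hopf3_surj[OF zU(2)] by blast
  define S where "S n x = segint (K n) z x" for n x
  have Sm [measurable]: "S n \<in> borel_measurable borel" for n
    unfolding S_def[abs_def] by (rule segint_measurable[OF K(1)])
  have Snn: "0 \<le> S n x" for n x unfolding S_def by (rule segint_nonneg[OF K(2)])
  have Ssum: "AE x in lborel. x \<in> ?B \<longrightarrow> summable (\<lambda>n. S n x)"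
    and Sint: "\<And>n. integrable lborel (\<lambda>x. indicator ?B x * S n x)"
    and Slim: "(\<lambda>n. LINT x|lborel. indicator ?B x * S n x) \<longlonglongrightarrow> 0"
    using summable_of_nn_integral[of S ?B] Snn zsum[folded S_def] by auto
  have Ac: "continuous_on UNIV (A n b)" if "b \<in> Basis" for n b by (rule quad_diff_continuous[OF A[OF that]])

  \<comment> \<open>Transported spinors and their limit\<close>
  define V where "V n x = transport (A n) z p x" for n x
  have Vc: "continuous_on UNIV (V n)" for n
    unfolding V_def[abs_def] by (rule transport_continuous[OF A])
  have [measurable]: "V n \<in> borel_measurable borel" for n
    by (rule borel_measurable_continuous_onI[OF Vc])
  have Vn: "norm (V n x) = 1" for n x unfolding V_def using norm_transport[OF Ac] p(1) by simp
  have xz: "norm (x - z) \<le> 2" if "x \<in> ?B" for x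
    using norm_triangle_ineq4[of x z] that z by simp
  have DS: "D * norm (x - z) * S n x \<le> 2 * D * S n x" if "x \<in> ?B" for x n
    using mult_right_mono[OF mult_left_mono[OF xz[OF that] D] Snn[of n x]] by (simp add: mult.commute)
  have Vstep: "norm (V (Suc n) x - V n x) \<le> 2 * D * S n x" if "x \<in> ?B" for n x
  proof -
    have "norm (V (Suc n) x - V n x) \<le> norm p * (DIM('a) * norm (x - z) * segint (K n) z x)"
      unfolding V_def
      by (rule transport_dist_connections[OF Ac Ac K(1), where B="?B"]) (use z that Kdiff in auto)
    then have "norm (V (Suc n) x - V n x) \<le> D * norm (x - z) * S n x"
      by (simp only: D_def S_def p(1) mult_1)
    then show ?thesis using DS[OF that, of n] by linarith
  qed
  \<comment> \<open>Testing for the Cauchy property makes \<open>v\<close> Borel on the whole space;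
    the default 0 keeps the norm at most 1 where the sequence diverges.\<close>
  define v where "v x = (if Cauchy (\<lambda>n. V n x) then lim (\<lambda>n. V n x) else 0)" for x
  have vm [measurable]: "v \<in> borel_measurable borel"
    unfolding v_def[abs_def] by measurable
  have Vlim: "AE x in lborel. x \<in> ?B \<longrightarrow> (\<lambda>n. V n x) \<longlonglongrightarrow> v x"
    using Ssum
  proof eventually_elim
    case (elim x)
    show ?case
    proof
      assume x: "x \<in> ?B"
      with elim have s: "summable (\<lambda>n. 2 * D * S n x)" by (intro summable_mult) simp
      have "summable (\<lambda>n. V (Suc n) x - V n x)"
        by (rule summable_comparison_test'[OF s, of 0]) (rule Vstep[OF x])
      then have "(\<lambda>n. \<Sum>i<n. V (Suc i) x - V i x) \<longlonglongrightarrow> (\<Sum>n. V (Suc n) x - V n x)"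
        by (rule summable_LIMSEQ)
      then have "(\<lambda>n. V n x - V 0 x) \<longlonglongrightarrow> (\<Sum>n. V (Suc n) x - V n x)"
        by (simp only: sum_lessThan_telescope[of "\<lambda>i. V i x"])
      then have "(\<lambda>n. (V n x - V 0 x) + V 0 x) \<longlonglongrightarrow> (\<Sum>n. V (Suc n) x - V n x) + V 0 x"
        by (intro tendsto_intros)
      then have "convergent (\<lambda>n. (V n x - V 0 x) + V 0 x)" by (rule convergentI)
      then have "convergent (\<lambda>n. V n x)" by (simp only: diff_add_cancel)
      then show "(\<lambda>n. V n x) \<longlonglongrightarrow> v x"
        by (simp only: v_def convergent_LIMSEQ_iff convergent_Cauchy if_True)
    qed
  qed
  have nv: "norm (v x) \<le> 1" for x
  proof (cases "Cauchy (\<lambda>n. V n x)")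
    case True
    then have "(\<lambda>n. V n x) \<longlonglongrightarrow> v x" by (simp add: v_def Cauchy_convergent convergent_LIMSEQ_iff[symmetric])
    then have "(\<lambda>n. norm (V n x)) \<longlonglongrightarrow> norm (v x)" by (rule tendsto_norm)
    then show ?thesis using LIMSEQ_unique[OF tendsto_const[of 1]] Vn by fastforce
  qed (simp add: v_def)
  \<comment> \<open>A given point, or the support of a test function, may lie outside radius
    \<open>R n\<close> for small \<open>n\<close>. All estimates involving curvature or parallelism
    are therefore eventual.\<close>
  have Rev: "\<forall>\<^sub>F n in sequentially. r < R n" if "r < 1" for r
    using R that by (rule order_tendstoD(1))

  \<comment> \<open>The limit lies over the given map\<close>
  have "AE x in lborel. norm x < 1 \<longrightarrow> norm (v x) = 1 \<and> hopf3 (v x) = u x"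
    using Vlim Ssum Ulim
  proof eventually_elim
    case (elim x)
    show ?case
    proof
      assume n1: "norm x < 1"
      then have x: "x \<in> ?B" by simp
      have lv: "(\<lambda>n. V n x) \<longlonglongrightarrow> v x" using elim x by simp
      have "norm (v x) = 1"
        using LIMSEQ_unique[OF tendsto_norm[OF lv]] Vn by simp
      moreover have "hopf3 (v x) = u x"
      proof -
        have "isCont hopf3 (v x)" by (rule continuous_on_interior[OF continuous_on_hopf3]) (simp only: interior_UNIV UNIV_I)
        then have l1: "(\<lambda>n. U n x - hopf3 (V n x)) \<longlonglongrightarrow> u x - hopf3 (v x)"
          using elim n1 lv by (intro tendsto_diff isCont_tendsto_compose[of _ hopf3]) auto
        have "(\<lambda>n. norm (U n z - u z) + 2 * D * S n x) \<longlonglongrightarrow> norm (u z - u z) + 2 * D * 0"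
          using elim x by (intro tendsto_intros zU summable_LIMSEQ_zero) auto
        then have l2: "(\<lambda>n. norm (U n z - u z) + 2 * D * S n x) \<longlonglongrightarrow> 0" by simp
        have ev: "\<forall>\<^sub>F n in sequentially. norm (U n x - hopf3 (V n x)) \<le> norm (U n z - u z) + 2 * D * S n x"
          using Rev[of "max (norm x) (norm z)"]
        proof (rule eventually_mono)
          show "max (norm x) (norm z) < 1" using x z by simp
          fix n assume "max (norm x) (norm z) < R n"
          then have "norm (U n x - hopf3 (V n x)) \<le> norm (U n z - hopf3 p) + DIM('a) * norm (x - z) * segint (K n) z x"
            unfolding V_def
            by (intro transport_hopf3_le[OF Ac U K(1), where B="ball 0 (R n)"] Kpar) auto
          then have "norm (U n x - hopf3 (V n x)) \<le> norm (U n z - u z) + D * norm (x - z) * S n x"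
            by (simp only: D_def S_def p)
          then show "norm (U n x - hopf3 (V n x)) \<le> norm (U n z - u z) + 2 * D * S n x"
            using DS[OF x, of n] by linarith
        qed
        have "(\<lambda>n. U n x - hopf3 (V n x)) \<longlonglongrightarrow> 0" by (rule Lim_null_comparison[OF ev l2])
        then have "u x - hopf3 (v x) = 0" using l1 LIMSEQ_unique by blast
        then show ?thesis by simp
      qed
      ultimately show "norm (v x) = 1 \<and> hopf3 (v x) = u x" ..
    qed
  qed

  \<comment> \<open>Weak derivatives of the limit\<close>
  moreover have "(LINT x|lborel. pderiv_at \<phi> b x *\<^sub>R v x) = - (LINT x|lborel. \<phi> x *\<^sub>R spin (B b x) (v x))"
    if \<phi>: "test_function ?B \<phi>" and b: "b \<in> Basis" for \<phi> b
  proof -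
    obtain C R0 where C: "C \<ge> 0" "\<And>x. \<bar>\<phi> x\<bar> \<le> C" "\<And>x y. \<bar>\<phi> x - \<phi> y\<bar> \<le> C * norm (x - y)"
      "\<And>x. \<phi> x \<noteq> 0 \<Longrightarrow> norm x \<le> R0" "\<And>x. (\<phi> has_derivative frechet_derivative \<phi> (at x)) (at x)"
      "continuous_on UNIV \<phi>" "\<And>b. b \<in> Basis \<Longrightarrow> continuous_on UNIV (pderiv_at \<phi> b)"
      "\<And>b x. b \<in> Basis \<Longrightarrow> \<bar>pderiv_at \<phi> b x\<bar> \<le> C"
      "\<And>b x. x \<notin> closure {x. \<phi> x \<noteq> 0} \<Longrightarrow> pderiv_at \<phi> b x = 0"
      using \<phi> by (rule test_functionE) (rule that)
    note [measurable] = borel_measurable_continuous_onI[OF C(6)] borel_measurable_continuous_onI[OF C(7)[OF b]] B[OF b]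
      borel_measurable_continuous_onI[OF Ac[OF b]]
    note [measurable] = measurable_spin
    have cl: "compact (closure {x. \<phi> x \<noteq> 0})" "closure {x. \<phi> x \<noteq> 0} \<subseteq> ?B"
      using \<phi> by (simp_all add: test_function_def)
    obtain r where r: "0 \<le> r" "r < 1" "closure {x. \<phi> x \<noteq> 0} \<subseteq> cball 0 r"
      by (rule compact_subset_ball_radius[OF cl])
    have \<phi>r: "norm x \<le> r" if "\<phi> x \<noteq> 0" for x using r(3) closure_subset[of "{x. \<phi> x \<noteq> 0}"] that by auto
    have \<phi>B: "x \<in> ?B" if "\<phi> x \<noteq> 0" for x using \<phi>r[OF that] r(2) by simp
    have \<phi>'B: "x \<in> ?B" if "pderiv_at \<phi> b x \<noteq> 0" for x using C(9)[of x b] cl(2) that by blast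
    have Bf: "emeasure lborel ?B < \<infinity>" using emeasure_lborel_ball_finite by simp
    have lim1: "(\<lambda>n. LINT x|lborel. pderiv_at \<phi> b x *\<^sub>R V n x) \<longlonglongrightarrow> (LINT x|lborel. pderiv_at \<phi> b x *\<^sub>R v x)"
    proof (rule integral_dominated_convergence)
      show "integrable lborel (\<lambda>x::'a. C * indicator ?B x)"
        using Bf by (intro integrable_mult_right integrable_real_indicator) auto
      show "AE x in lborel. (\<lambda>n. pderiv_at \<phi> b x *\<^sub>R V n x) \<longlonglongrightarrow> pderiv_at \<phi> b x *\<^sub>R v x"
        using Vlim
      proof eventually_elim
        case (elim x)
        then show ?case using \<phi>'B[of x] by (cases "pderiv_at \<phi> b x = 0") (auto intro!: tendsto_intros)
      qed
      show "AE x in lborel. norm (pderiv_at \<phi> b x *\<^sub>R V n x) \<le> C * indicator ?B x" for n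
      proof (rule AE_I2)
        fix x
        show "norm (pderiv_at \<phi> b x *\<^sub>R V n x) \<le> C * indicator ?B x"
          using \<phi>'B[of x] C(8)[OF b, of x] by (cases "pderiv_at \<phi> b x = 0") (auto simp: Vn C(1))
      qed
    qed simp_all
    have iB: "integrable lborel (\<lambda>x. norm (B b x))" using Bint[OF b] by simp
    have lim2: "(\<lambda>n. LINT x|lborel. \<phi> x *\<^sub>R spin (B b x) (V n x)) \<longlonglongrightarrow> (LINT x|lborel. \<phi> x *\<^sub>R spin (B b x) (v x))"
    proof (rule integral_dominated_convergence)
      show "integrable lborel (\<lambda>x. C * norm (B b x))" using iB by simp
      show "AE x in lborel. (\<lambda>n. \<phi> x *\<^sub>R spin (B b x) (V n x)) \<longlonglongrightarrow> \<phi> x *\<^sub>R spin (B b x) (v x)"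
        using Vlim
      proof eventually_elim
        case (elim x)
        then show ?case using \<phi>B[of x] by (cases "\<phi> x = 0") (auto intro!: tendsto_intros spin.tendsto)
      qed
      show "AE x in lborel. norm (\<phi> x *\<^sub>R spin (B b x) (V n x)) \<le> C * norm (B b x)" for n
        using C(2) by (intro AE_I2) (simp add: norm_spin Vn mult_right_mono)
    qed simp_all
    have iBV: "integrable lborel (\<lambda>x. \<phi> x *\<^sub>R spin (B b x) (V n x))" for n
      by (rule Bochner_Integration.integrable_bound[of _ "\<lambda>x. C * norm (B b x)"])
        (use iB C(1,2) in \<open>auto simp: norm_spin Vn intro!: mult_right_mono\<close>)
    have iAV: "integrable lborel (\<lambda>x. \<phi> x *\<^sub>R spin (A n b x) (V n x))" for n
    proof -
      obtain CA where "\<And>x. norm (A n b x) \<le> CA" using A[OF b, of n] by (rule quad_diffE) blast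
      then have "norm (\<phi> x *\<^sub>R spin (A n b x) (V n x)) \<le> C * CA" for x
        using mult_mono[OF C(2)[of x], of "norm (A n b x)" CA] C(1) by (simp add: norm_spin Vn)
      then show ?thesis by (rule integrable_bounded_support[rotated, of _ _ R0]) (use C(4) in auto)
    qed
    \<comment> \<open>Replacing \<open>A n\<close> by its limit costs at most the L^1 distance of
      the two, because \<open>\<phi>\<close> is bounded and every \<open>V n x\<close> is a unit
      vector.\<close>
    have lim3: "(\<lambda>n. LINT x|lborel. \<phi> x *\<^sub>R spin (A n b x) (V n x)) \<longlonglongrightarrow> (LINT x|lborel. \<phi> x *\<^sub>R spin (B b x) (v x))"
    proof -
      have le: "norm ((LINT x|lborel. \<phi> x *\<^sub>R spin (A n b x) (V n x)) - (LINT x|lborel. \<phi> x *\<^sub>R spin (B b x) (V n x)))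
          \<le> C * (LINT x|lborel. indicator ?B x * norm (A n b x - B b x))" for n
      proof -
        have "(LINT x|lborel. \<phi> x *\<^sub>R spin (A n b x) (V n x)) - (LINT x|lborel. \<phi> x *\<^sub>R spin (B b x) (V n x))
            = (LINT x|lborel. \<phi> x *\<^sub>R spin (A n b x) (V n x) - \<phi> x *\<^sub>R spin (B b x) (V n x))"
          using iAV iBV by simp
        also have "norm \<dots> \<le> (LINT x|lborel. C * (indicator ?B x * norm (A n b x - B b x)))"
        proof (rule norm_integral_le_AE)
          show "integrable lborel (\<lambda>x. C * (indicator ?B x * norm (A n b x - B b x)))" using Aint[OF b] by simp
          show "AE x in lborel. norm (\<phi> x *\<^sub>R spin (A n b x) (V n x) - \<phi> x *\<^sub>R spin (B b x) (V n x))
              \<le> C * (indicator ?B x * norm (A n b x - B b x))"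
          proof (rule AE_I2)
            fix x
            have "norm (\<phi> x *\<^sub>R spin (A n b x) (V n x) - \<phi> x *\<^sub>R spin (B b x) (V n x)) = \<bar>\<phi> x\<bar> * norm (A n b x - B b x)"
              by (simp add: norm_spin Vn flip: scaleR_diff_right spin.diff_left)
            then show "norm (\<phi> x *\<^sub>R spin (A n b x) (V n x) - \<phi> x *\<^sub>R spin (B b x) (V n x))
              \<le> C * (indicator ?B x * norm (A n b x - B b x))"
              using \<phi>B[of x] C(2)[of x] C(1) by (cases "\<phi> x = 0") (auto simp: mult_right_mono)
          qed
        qed
        finally show ?thesis by simp
      qed
      have "(\<lambda>n. C * (LINT x|lborel. indicator ?B x * norm (A n b x - B b x))) \<longlonglongrightarrow> C * 0"
        by (intro tendsto_intros Alim b)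
      then have "(\<lambda>n. (LINT x|lborel. \<phi> x *\<^sub>R spin (A n b x) (V n x)) - (LINT x|lborel. \<phi> x *\<^sub>R spin (B b x) (V n x))) \<longlonglongrightarrow> 0"
        by (intro Lim_null_comparison[OF always_eventually[OF allI[OF le]]]) simp
      from tendsto_add[OF this lim2] show ?thesis by simp
    qed
    \<comment> \<open>The variation estimate with the curvature bound makes \<open>V n\<close>
      almost parallel in its endpoint. The total error is a segment integral of \<open>K n\<close>,
      averaged over endpoints, which tends to 0 for the chosen \<open>z\<close>.\<close>
    have ev: "\<forall>\<^sub>F n in sequentially. norm ((LINT x|lborel. pderiv_at \<phi> b x *\<^sub>R V n x) + (LINT x|lborel. \<phi> x *\<^sub>R spin (A n b x) (V n x)))
        \<le> C * (2 * D) * (LINT x|lborel. indicator ?B x * S n x)"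
      using Rev[of "max r (norm z)"]
    proof (rule eventually_mono)
      show "max r (norm z) < 1" using r z by simp
      fix n assume n: "max r (norm z) < R n"
      obtain CA where CA: "\<And>x. norm (A n b x) \<le> CA" using A[OF b, of n] by (rule quad_diffE) blast
      \<comment> \<open>A convex set that contains \<open>z\<close> and the support of
        \<open>\<phi>\<close> and on which the curvature bound is available.\<close>
      let ?B' = "ball (0::'a) (min 1 (R n))"
      obtain Q where Q: "\<And>x s c. x \<in> ?B' \<Longrightarrow> norm (x - z) \<le> 2 \<Longrightarrow> c \<in> Basis \<Longrightarrow> 0 < s \<Longrightarrow> s \<le> 1 \<Longrightarrow>
        norm (V n (x + s *\<^sub>R c) - V n x - s *\<^sub>R spin (A n c x) (V n x))
          \<le> s * (DIM('a) * norm (x - z) * segint (K n) z x) + Q * s\<^sup>2"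
      proof -
        have "z \<in> ?B'" using n z by simp
        have curv: "norm (DA n b y c - DA n c y b - 2 *\<^sub>R cross3 (A n c y) (A n b y)) \<le> K n y"
          if "b \<in> Basis" "c \<in> Basis" "y \<in> ?B'" for b c y
          using that by (intro Kcurv) auto
        show ?thesis
          by (rule transport_variation[OF A K(1) convex_ball \<open>z \<in> ?B'\<close> curv p(1)])
            (assumption+, rule that, simp only: V_def)
      qed
      have iE: "integrable lborel (\<lambda>x. \<bar>\<phi> x\<bar> * (2 * D * S n x))"
      proof (rule Bochner_Integration.integrable_bound)
        show "integrable lborel (\<lambda>x. C * (2 * D) * (indicator ?B x * S n x))" using Sint by simp
        show "AE x in lborel. norm (\<bar>\<phi> x\<bar> * (2 * D * S n x)) \<le> norm (C * (2 * D) * (indicator ?B x * S n x))"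
        proof (rule AE_I2)
          fix x
          have "\<bar>\<phi> x\<bar> * (2 * D * S n x) \<le> C * (2 * D * S n x)" using C(2) D Snn by (intro mult_right_mono) auto
          then show "norm (\<bar>\<phi> x\<bar> * (2 * D * S n x)) \<le> norm (C * (2 * D) * (indicator ?B x * S n x))"
            using \<phi>B[of x] C(1) D Snn[of n x] by (cases "\<phi> x = 0") (auto simp: abs_mult)
        qed
      qed simp
      have "norm ((LINT x|lborel. pderiv_at \<phi> b x *\<^sub>R V n x) + (LINT x|lborel. \<phi> x *\<^sub>R spin (A n b x) (V n x)))
          \<le> (LINT x|lborel. \<bar>\<phi> x\<bar> * (2 * D * S n x))"
      proof (rule approximate_integration_by_parts[OF \<phi> b])
        show "norm (V n x) \<le> 1" for x by (simp add: Vn)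
        show "norm (spin (A n b x) (V n x)) \<le> CA" for x using CA by (simp add: norm_spin Vn)
        fix x s assume x: "\<phi> x \<noteq> 0" and s: "0 < s" "s \<le> (1::real)"
        have "x \<in> ?B'" using \<phi>r[OF x] r(2) n by simp
        then have "norm (V n (x + s *\<^sub>R b) - V n x - s *\<^sub>R spin (A n b x) (V n x))
            \<le> s * (D * norm (x - z) * S n x) + Q * s\<^sup>2"
          using Q[OF _ xz[OF \<phi>B[OF x]] b s] by (simp add: D_def S_def)
        also have "\<dots> \<le> s * (2 * D * S n x) + Q * s\<^sup>2"
          using DS[OF \<phi>B[OF x], of n] s by (intro add_right_mono mult_left_mono) auto
        finally show "norm (V n (x + s *\<^sub>R b) - V n x - s *\<^sub>R spin (A n b x) (V n x)) \<le> s * (2 * D * S n x) + Q * s\<^sup>2" .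
      qed (use iE in auto)
      also have "\<dots> \<le> (LINT x|lborel. C * (2 * D) * (indicator ?B x * S n x))"
      proof (rule integral_mono[OF iE])
        show "integrable lborel (\<lambda>x. C * (2 * D) * (indicator ?B x * S n x))" using Sint by simp
        fix x
        have "\<bar>\<phi> x\<bar> * (2 * D * S n x) \<le> C * (2 * D * S n x)" using C(2) D Snn by (intro mult_right_mono) auto
        then show "\<bar>\<phi> x\<bar> * (2 * D * S n x) \<le> C * (2 * D) * (indicator ?B x * S n x)"
          using \<phi>B[of x] C(1) D Snn[of n x] by (cases "\<phi> x = 0") auto
      qed
      finally show "norm ((LINT x|lborel. pderiv_at \<phi> b x *\<^sub>R V n x) + (LINT x|lborel. \<phi> x *\<^sub>R spin (A n b x) (V n x)))
        \<le> C * (2 * D) * (LINT x|lborel. indicator ?B x * S n x)" by simp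
    qed
    have "(\<lambda>n. C * (2 * D) * (LINT x|lborel. indicator ?B x * S n x)) \<longlonglongrightarrow> C * (2 * D) * 0"
      by (intro tendsto_intros Slim)
    then have "(\<lambda>n. (LINT x|lborel. pderiv_at \<phi> b x *\<^sub>R V n x) + (LINT x|lborel. \<phi> x *\<^sub>R spin (A n b x) (V n x))) \<longlonglongrightarrow> 0"
      by (intro Lim_null_comparison[OF ev]) simp
    then have "(LINT x|lborel. pderiv_at \<phi> b x *\<^sub>R v x) + (LINT x|lborel. \<phi> x *\<^sub>R spin (B b x) (v x)) = 0"
      using LIMSEQ_unique[OF tendsto_add[OF lim1 lim3]] by blast
    then show ?thesis by (simp add: add_eq_0_iff)
  qed
  ultimately show ?thesis using that[OF vm nv] by blast
qed

section \<open>Borel representatives of Sobolev data\<close>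

lemma lebesgue_measurable_AE_eq:
  fixes F G :: "'a::euclidean_space \<Rightarrow> 'b::topological_space"
  assumes G: "G \<in> borel_measurable borel" and eq: "AE x in lborel. F x = G x"
  shows "F \<in> borel_measurable lebesgue"
proof (rule measurableI)
  fix S :: "'b set" assume S: "S \<in> sets borel"
  have "G -` S \<inter> space lebesgue \<in> sets lebesgue"
    using measurable_sets[OF measurable_completion[of G lborel borel] S] G by simp
  then have mG: "G -` S \<inter> space lebesgue \<in> sets lebesgue" .
  have ae: "AE x in lebesgue. x \<in> G -` S \<inter> space lebesgue \<longleftrightarrow> x \<in> F -` S \<inter> space lebesgue"
    using AE_completion[OF eq] by eventually_elim simp
  show "F -` S \<inter> space lebesgue \<in> sets lebesgue"
    by (rule completion.in_sets_AE[OF ae mG]) simp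
qed simp

text \<open>The bridge between the definitions, stated with integrals over \<open>\<Omega>\<close>
  for the completed measure, and the proof, which integrates Borel functions over the whole space.
  Measurability of \<open>F\<close> comes from completeness.\<close>

lemma set_integral_lebesgue_eq:
  fixes F G :: "'a::euclidean_space \<Rightarrow> 'b::euclidean_space"
  assumes G: "G \<in> borel_measurable borel" and eq: "AE x in lborel. indicator \<Omega> x *\<^sub>R F x = G x"
  shows "(LINT x:\<Omega>|lebesgue. F x) = (LINT x|lborel. G x)"
    and "set_integrable lebesgue \<Omega> F \<longleftrightarrow> integrable lborel G"
proof -
  have m: "(\<lambda>x. indicator \<Omega> x *\<^sub>R F x) \<in> borel_measurable lebesgue"
    by (rule lebesgue_measurable_AE_eq[OF G eq])
  have G1: "G \<in> borel_measurable lborel" using G by simp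
  note G' = measurable_completion[OF G1] G1
  have ae: "AE x in lebesgue. indicator \<Omega> x *\<^sub>R F x = G x" by (rule AE_completion[OF eq])
  show "(LINT x:\<Omega>|lebesgue. F x) = (LINT x|lborel. G x)"
    unfolding set_lebesgue_integral_def integral_cong_AE[OF m G'(1) ae] by (rule integral_completion[OF G'(2)])
  show "set_integrable lebesgue \<Omega> F \<longleftrightarrow> integrable lborel G"
    unfolding set_integrable_def integrable_cong_AE[OF m G'(1) ae] by (rule integrable_completion[OF G'(2)])
qed

text \<open>The representative carries the indicator of \<open>\<Omega>\<close>, so it vanishes
  outside at every point. Later pointwise bounds rely on this.\<close>

lemma borel_representative:
  fixes f :: "'a::euclidean_space \<Rightarrow> 'b::euclidean_space"
  assumes f: "set_borel_measurable lebesgue \<Omega> f" and \<Omega>: "\<Omega> \<in> sets borel"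
  obtains g where "g \<in> borel_measurable borel" "AE x in lborel. indicator \<Omega> x *\<^sub>R f x = g x" "\<And>x. x \<notin> \<Omega> \<Longrightarrow> g x = 0"
proof -
  let ?F = "\<lambda>x. indicator \<Omega> x *\<^sub>R f x"
  have m: "(\<lambda>x. ?F x \<bullet> b) \<in> borel_measurable lebesgue" for b
    using f unfolding set_borel_measurable_def by (intro borel_measurable_inner borel_measurable_const)
  have "\<forall>b. \<exists>h. h \<in> borel_measurable lborel \<and> (AE x in lborel. ?F x \<bullet> b = h x)"
    using completion_ex_borel_measurable_real[OF m] by blast
  then obtain h where h: "\<And>b. h b \<in> borel_measurable lborel" "\<And>b. AE x in lborel. ?F x \<bullet> b = h b x"
    by metis
  define g where "g x = indicator \<Omega> x *\<^sub>R (\<Sum>b\<in>Basis. h b x *\<^sub>R b)" for x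
  have [measurable]: "h b \<in> borel_measurable borel" for b using h(1)[of b] by simp
  have [measurable]: "\<Omega> \<in> sets borel" by fact
  show ?thesis
  proof (rule that[of g])
    show "g \<in> borel_measurable borel" unfolding g_def[abs_def] by measurable
    have "AE x in lborel. \<forall>b\<in>(Basis::'b set). ?F x \<bullet> b = h b x" by (rule AE_finite_allI[OF finite_Basis]) (rule h(2))
    then show "AE x in lborel. ?F x = g x"
    proof eventually_elim
      case (elim x)
      have "(\<Sum>b\<in>Basis. h b x *\<^sub>R b) = (\<Sum>b\<in>Basis. (?F x \<bullet> b) *\<^sub>R b)" using elim by (intro sum.cong) auto
      also have "\<dots> = ?F x" by (rule euclidean_representation)
      finally show ?case by (simp add: g_def indicator_def)
    qed
    show "g x = 0" if "x \<notin> \<Omega>" for x using that by (simp add: g_def)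
  qed
qed

lemma L2_on_representative:
  fixes f :: "'a::euclidean_space \<Rightarrow> 'b::euclidean_space"
  assumes f: "L2_on \<Omega> f" and \<Omega>: "\<Omega> \<in> sets borel"
  obtains g where "g \<in> borel_measurable borel" "AE x in lborel. indicator \<Omega> x *\<^sub>R f x = g x" "\<And>x. x \<notin> \<Omega> \<Longrightarrow> g x = 0"
    "integrable lborel (\<lambda>x. (norm (g x))\<^sup>2)"
proof -
  obtain g where g: "g \<in> borel_measurable borel" "AE x in lborel. indicator \<Omega> x *\<^sub>R f x = g x" "\<And>x. x \<notin> \<Omega> \<Longrightarrow> g x = 0"
    using f \<Omega> unfolding L2_on_def by (elim conjE) (rule borel_representative, assumption+, rule that)
  have [measurable]: "g \<in> borel_measurable borel" by fact
  have "AE x in lborel. indicator \<Omega> x *\<^sub>R (norm (f x))\<^sup>2 = (norm (g x))\<^sup>2"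
    using g(2)
  proof eventually_elim
    case (elim x)
    show ?case unfolding elim[symmetric] by (simp add: indicator_def)
  qed
  then have "integrable lborel (\<lambda>x. (norm (g x))\<^sup>2)"
    using f set_integral_lebesgue_eq(2)[of "\<lambda>x. (norm (g x))\<^sup>2" \<Omega> "\<lambda>x. (norm (f x))\<^sup>2"] by (simp add: L2_on_def)
  with g show ?thesis by (rule that)
qed

lemma integrable_of_square:
  fixes g :: "'a::euclidean_space \<Rightarrow> 'b::euclidean_space"
  assumes [measurable]: "g \<in> borel_measurable borel" "\<Omega> \<in> sets borel" and "emeasure lborel \<Omega> < \<infinity>"
    and z: "\<And>x. x \<notin> \<Omega> \<Longrightarrow> g x = 0" and sq: "integrable lborel (\<lambda>x. (norm (g x))\<^sup>2)"
  shows "integrable lborel g"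
proof (rule Bochner_Integration.integrable_bound)
  show "integrable lborel (\<lambda>x. indicator \<Omega> x + (norm (g x))\<^sup>2)"
    using assms by (intro Bochner_Integration.integrable_add integrable_real_indicator sq) auto
  show "AE x in lborel. norm (g x) \<le> norm (indicator \<Omega> x + (norm (g x))\<^sup>2)"
  proof (rule AE_I2)
    fix x
    have "norm (g x) \<le> 1 + (norm (g x))\<^sup>2"
    proof -
      have "2 * norm (g x) \<le> (norm (g x))\<^sup>2 + 1" using sum_squares_bound[of "norm (g x)" 1] by simp
      moreover have "0 \<le> (norm (g x))\<^sup>2" by simp
      ultimately show ?thesis by linarith
    qed
    then show "norm (g x) \<le> norm (indicator \<Omega> x + (norm (g x))\<^sup>2)"
      using z[of x] by (cases "x \<in> \<Omega>") auto
  qed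
qed simp

lemma test_function_measurable:
  fixes \<phi> :: "'a::euclidean_space \<Rightarrow> real"
  assumes "test_function \<Omega> \<phi>"
  shows "\<phi> \<in> borel_measurable borel" and "b \<in> Basis \<Longrightarrow> pderiv_at \<phi> b \<in> borel_measurable borel"
  using assms
  by (auto elim!: test_functionE intro: borel_measurable_continuous_onI)

lemma has_weak_pderiv_representative:
  fixes u v :: "'a::euclidean_space \<Rightarrow> 'b::euclidean_space"
  assumes w: "has_weak_pderiv \<Omega> b u v" and \<phi>: "test_function \<Omega> \<phi>" and b: "b \<in> Basis"
    and u: "u' \<in> borel_measurable borel" "AE x in lborel. indicator \<Omega> x *\<^sub>R u x = u' x"
    and v: "v' \<in> borel_measurable borel" "AE x in lborel. indicator \<Omega> x *\<^sub>R v x = v' x"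
  shows "(LINT x|lborel. pderiv_at \<phi> b x *\<^sub>R u' x) = - (LINT x|lborel. \<phi> x *\<^sub>R v' x)"
proof -
  have [measurable]: "u' \<in> borel_measurable borel" "v' \<in> borel_measurable borel" "\<phi> \<in> borel_measurable borel"
    "pderiv_at \<phi> b \<in> borel_measurable borel"
    using u v test_function_measurable[OF \<phi>] b by auto
  have "(LINT x:\<Omega>|lebesgue. pderiv_at \<phi> b x *\<^sub>R u x) = (LINT x|lborel. pderiv_at \<phi> b x *\<^sub>R u' x)"
  proof (rule set_integral_lebesgue_eq(1))
    show "AE x in lborel. indicator \<Omega> x *\<^sub>R pderiv_at \<phi> b x *\<^sub>R u x = pderiv_at \<phi> b x *\<^sub>R u' x"
      using u(2)
    proof eventually_elim
      case (elim x)
      show ?case unfolding elim[symmetric] by (rule scaleR_left_commute)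
    qed
  qed measurable
  moreover have "(LINT x:\<Omega>|lebesgue. \<phi> x *\<^sub>R v x) = (LINT x|lborel. \<phi> x *\<^sub>R v' x)"
  proof (rule set_integral_lebesgue_eq(1))
    show "AE x in lborel. indicator \<Omega> x *\<^sub>R \<phi> x *\<^sub>R v x = \<phi> x *\<^sub>R v' x"
      using v(2)
    proof eventually_elim
      case (elim x)
      show ?case unfolding elim[symmetric] by (rule scaleR_left_commute)
    qed
  qed measurable
  ultimately show ?thesis using w \<phi> unfolding has_weak_pderiv_def by simp
qed

text \<open>Local integrability speaks only about compact subsets. The ball is exhausted by
  concentric closed balls, which are empty as long as their radius is negative.\<close>

lemma set_borel_measurable_locally:
  fixes v :: "'a::euclidean_space \<Rightarrow> 'b::euclidean_space"
  assumes "v locally_integrable_on ball a r"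
  shows "set_borel_measurable lebesgue (ball a r) v"
proof -
  define C where "C n = cball a (r - 1 / real (Suc n))" for n
  have C: "C n \<subseteq> ball a r" for n
  proof
    fix x assume "x \<in> C n"
    moreover have "r - 1 / real (Suc n) < r" by simp
    ultimately show "x \<in> ball a r" unfolding C_def mem_cball mem_ball by linarith
  qed
  have m: "(\<lambda>x. indicator (C n) x *\<^sub>R v x) \<in> borel_measurable lebesgue" for n
  proof -
    have "compact (C n)" by (simp add: C_def)
    with C[of n] assms have "set_integrable lebesgue (C n) v" unfolding locally_integrable_on_def by blast
    then show ?thesis unfolding set_integrable_def by (rule borel_measurable_integrable)
  qed
  have "(\<lambda>n. indicator (C n) x *\<^sub>R v x) \<longlonglongrightarrow> indicator (ball a r) x *\<^sub>R v x" for x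
  proof (cases "x \<in> ball a r")
    case True
    have "(\<lambda>n. 1 / real (Suc n)) \<longlonglongrightarrow> 0"
      using LIMSEQ_inverse_real_of_nat by (simp add: inverse_eq_divide)
    then have "\<forall>\<^sub>F n in sequentially. 1 / real (Suc n) < r - dist a x"
      using True by (intro order_tendstoD(2)) auto
    then have "\<forall>\<^sub>F n in sequentially. indicator (C n) x *\<^sub>R v x = indicator (ball a r) x *\<^sub>R v x"
    proof eventually_elim
      case (elim n)
      then have "x \<in> C n" unfolding C_def mem_cball by linarith
      then show ?case using True by simp
    qed
    then show ?thesis by (rule tendsto_eventually)
  next
    case False
    then have "x \<notin> C n" for n using C by blast
    then show ?thesis using False by simp
  qed
  then show ?thesis
    unfolding set_borel_measurable_def by (intro borel_measurable_LIMSEQ_metric[OF m]) auto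
qed

lemma AE_ball_of_smaller_balls:
  assumes "\<And>s. s < r \<Longrightarrow> AE x in lborel. x \<in> ball a s \<longrightarrow> P x"
  shows "AE x in lborel. x \<in> ball a r \<longrightarrow> P x"
proof -
  have "AE x in lborel. \<forall>n. x \<in> ball a (r - 1 / real (Suc n)) \<longrightarrow> P x"
    using assms by (subst AE_all_countable) auto
  then show ?thesis
  proof eventually_elim
    case (elim x)
    show ?case
    proof
      assume "x \<in> ball a r"
      then obtain n where "inverse (real (Suc n)) < r - dist a x"
        using reals_Archimedean[of "r - dist a x"] by auto
      then have "1 / real (Suc n) < r - dist a x" by (simp only: inverse_eq_divide)
      then have "x \<in> ball a (r - 1 / real (Suc n))" unfolding mem_ball by linarith
      then show "P x" using elim by blast
    qed
  qed
qed

text \<open>The pullback is formed with derivatives picked by \<open>SOME\<close>, which need not be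
  the square integrable ones. Uniqueness identifies the two almost everywhere: tested against a
  mollifier, both give the same value.\<close>

lemma weak_pderiv_unique:
  fixes u v v' :: "'a::euclidean_space \<Rightarrow> 'b::euclidean_space"
  assumes v: "has_weak_pderiv (ball a r) b u v" and v': "has_weak_pderiv (ball a r) b u v'" and b: "b \<in> Basis"
  shows "AE x in lborel. x \<in> ball a r \<longrightarrow> v x = v' x"
proof (rule AE_ball_of_smaller_balls)
  fix s assume s: "s < r"
  have u: "set_borel_measurable lebesgue (ball a r) u" "set_borel_measurable lebesgue (ball a r) v"
      "set_borel_measurable lebesgue (ball a r) v'"
    using v v' by (auto simp: has_weak_pderiv_def intro: set_borel_measurable_locally)
  obtain U where U: "U \<in> borel_measurable borel" "AE x in lborel. indicator (ball a r) x *\<^sub>R u x = U x" "\<And>x. x \<notin> ball a r \<Longrightarrow> U x = 0"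
    by (rule borel_representative[OF u(1)]) auto
  obtain V where V: "V \<in> borel_measurable borel" "AE x in lborel. indicator (ball a r) x *\<^sub>R v x = V x" "\<And>x. x \<notin> ball a r \<Longrightarrow> V x = 0"
    by (rule borel_representative[OF u(2)]) auto
  obtain V' where V': "V' \<in> borel_measurable borel" "AE x in lborel. indicator (ball a r) x *\<^sub>R v' x = V' x" "\<And>x. x \<notin> ball a r \<Longrightarrow> V' x = 0"
    by (rule borel_representative[OF u(3)]) auto
  have [measurable]: "V \<in> borel_measurable borel" "V' \<in> borel_measurable borel" by fact+
  let ?C = "cball a s"
  have CB: "?C \<subseteq> ball a r" using s by auto
  have loc: "integrable lborel (\<lambda>x. indicator ?C x *\<^sub>R W x)"
    if w: "has_weak_pderiv (ball a r) b u w" and W: "W \<in> borel_measurable borel" "AE x in lborel. indicator (ball a r) x *\<^sub>R w x = W x" for w W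
  proof -
    have [measurable]: "W \<in> borel_measurable borel" by fact
    have "AE x in lborel. indicator ?C x *\<^sub>R w x = indicator ?C x *\<^sub>R W x"
      using W(2)
    proof eventually_elim
      case (elim x)
      show ?case
      proof (cases "x \<in> ?C")
        case True
        then have "x \<in> ball a r" using CB by blast
        then show ?thesis using elim by simp
      qed simp
    qed
    note ae = this
    have m: "(\<lambda>x. indicator ?C x *\<^sub>R W x) \<in> borel_measurable borel"
      using W(1) by (intro borel_measurable_scaleR borel_measurable_indicator) auto
    have "set_integrable lebesgue ?C w"
      using w CB compact_cball[of a s] unfolding has_weak_pderiv_def locally_integrable_on_def by blast
    then show ?thesis by (rule iffD1[OF set_integral_lebesgue_eq(2)[OF m ae]])
  qed
  \<comment> \<open>Both derivatives are only locally integrable. The cut-off to a smaller closed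
    ball makes the difference integrable on the whole space, as \<open>AE_zero_of_conv\<close>
    requires.\<close>
  define f where "f x = indicator ?C x *\<^sub>R V x - indicator ?C x *\<^sub>R V' x" for x
  have I: "integrable lborel (\<lambda>x. indicator ?C x *\<^sub>R V x)" "integrable lborel (\<lambda>x. indicator ?C x *\<^sub>R V' x)"
    by (rule loc[OF v V(1,2)], rule loc[OF v' V'(1,2)])
  have "AE x in lborel. x \<in> ball a s \<longrightarrow> f x = 0"
  proof (rule AE_zero_of_conv)
    show "integrable lborel f" unfolding f_def by (intro Bochner_Integration.integrable_diff I)
    fix e x assume e: "(e::real) > 0" and sub: "cball x e \<subseteq> ball a s"
    let ?\<phi> = "\<lambda>y. mollifier e (x - y)"
    have \<phi>: "test_function (ball a r) ?\<phi>"
      by (rule kernel_test_function_real[OF kernel_mollifier[OF e] order.trans[OF sub subset_ball]]) (use s in simp)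
    have red: "conv (\<lambda>x. indicator ?C x *\<^sub>R W x) (mollifier e) x = (LINT y|lborel. ?\<phi> y *\<^sub>R W y)" for W :: "'a \<Rightarrow> 'b"
      unfolding conv_def
    proof (intro Bochner_Integration.integral_cong refl)
      fix y
      show "?\<phi> y *\<^sub>R indicator ?C y *\<^sub>R W y = ?\<phi> y *\<^sub>R W y"
      proof (cases "e < norm (x - y)")
        case True
        then show ?thesis using kernelD(2)[OF kernel_mollifier[OF e] True] by simp
      next
        case False
        then have "y \<in> cball x e" by (simp add: dist_norm)
        then have "y \<in> ?C" using sub by auto
        then show ?thesis by simp
      qed
    qed
    have "(LINT y|lborel. ?\<phi> y *\<^sub>R V y) = (LINT y|lborel. ?\<phi> y *\<^sub>R V' y)"
      using has_weak_pderiv_representative[OF v \<phi> b U(1,2) V(1,2)]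
        has_weak_pderiv_representative[OF v' \<phi> b U(1,2) V'(1,2)] by simp
    then show "conv f (mollifier e) x = 0"
      unfolding f_def conv_diff[OF kernel_mollifier[OF e] I] red by simp
  qed simp
  with V(2) V'(2) show "AE x in lborel. x \<in> ball a s \<longrightarrow> v x = v' x"
  proof eventually_elim
    case (elim x)
    show ?case
    proof
      assume x: "x \<in> ball a s"
      then have "x \<in> ball a r" "x \<in> ?C" using s by auto
      then show "v x = v' x" using elim x by (simp add: f_def)
    qed
  qed
qed

section \<open>Pointwise identities for the limit connection\<close>

text \<open>Both factors are tangent to the sphere at \<open>w\<close>, so their product is normal
  to it.\<close>

lemma cross3_parallel:
  assumes w: "norm w = 1" and d: "w \<bullet> d = 0" and d': "w \<bullet> d' = 0"
  shows "cross3 d' d = (w \<bullet> cross3 d' d) *\<^sub>R w"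
proof -
  let ?z = "cross3 d' d"
  have ww: "w \<bullet> w = 1" using w by (simp add: norm_eq_1)
  have "cross3 w ?z = 0" by (simp add: Lagrange d d')
  then have "cross3 w (cross3 w ?z) = 0" by simp
  then have "(w \<bullet> ?z) *\<^sub>R w - (w \<bullet> w) *\<^sub>R ?z = 0" by (simp only: Lagrange[of w w ?z])
  then show ?thesis by (simp add: ww)
qed

text \<open>On tangent vectors \<open>(w \<times> d) \<times> w = d\<close>, while the term along
  \<open>w\<close> is annihilated by the product with \<open>w\<close>. So \<open>u\<close> is
  parallel whatever the coefficient \<open>s\<close> of \<open>\<eta>\<close>.\<close>

lemma limit_connection_parallel:
  assumes w: "norm w = 1" and d: "w \<bullet> d = 0"
  shows "d - 2 *\<^sub>R cross3 ((1/2) *\<^sub>R cross3 w d - (1/2) *\<^sub>R (s *\<^sub>R w)) w = 0"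
proof -
  have ww: "w \<bullet> w = 1" using w by (simp add: norm_eq_1)
  have "cross3 (cross3 w d) w = d"
    using cross_skew[of "cross3 w d" w] by (simp add: Lagrange[of w w d] d ww)
  then show ?thesis
    by (simp add: Cross3.left_diff_distrib cross_mult_left scaleR_diff_right)
qed

text \<open>Here \<open>d\<close>, \<open>d'\<close> are two partial derivatives of
  \<open>u\<close>, \<open>s\<close>, \<open>s'\<close> the matching coefficients of
  \<open>\<eta>\<close>, and the scalar multiplying \<open>w\<close> in the second term stands for
  the corresponding entry of \<open>d\<eta>\<close>. The bracket produces half of
  \<open>cross3 d' d\<close> and cancels the terms with \<open>s\<close> and \<open>s'\<close>; the
  other half is cancelled by \<open>d\<eta>\<close>.\<close>

lemma limit_connection_flat:
  assumes w: "norm w = 1" and d: "w \<bullet> d = 0" and d': "w \<bullet> d' = 0"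
  shows "cross3 d' d - (1/2) *\<^sub>R ((w \<bullet> cross3 d' d) *\<^sub>R w) - (1/2) *\<^sub>R (s *\<^sub>R d' - s' *\<^sub>R d)
    - 2 *\<^sub>R cross3 ((1/2) *\<^sub>R cross3 w d' - (1/2) *\<^sub>R (s' *\<^sub>R w)) ((1/2) *\<^sub>R cross3 w d - (1/2) *\<^sub>R (s *\<^sub>R w)) = 0"
proof -
  have ww: "w \<bullet> w = 1" using w by (simp add: norm_eq_1)
  define al where "al = w \<bullet> cross3 d' d"
  have p: "cross3 d' d = al *\<^sub>R w" unfolding al_def by (rule cross3_parallel[OF assms])
  have c1: "cross3 (cross3 w d') w = d'"
    using cross_skew[of "cross3 w d'" w] by (simp add: Lagrange[of w w d'] d' ww)
  have c2: "cross3 w (cross3 w d) = - d" by (simp add: Lagrange[of w w d] d ww)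
  have c3: "cross3 (cross3 w d') (cross3 w d) = al *\<^sub>R w"
  proof -
    have "cross3 (cross3 w d') (cross3 w d) = (cross3 w d' \<bullet> d) *\<^sub>R w - (cross3 w d' \<bullet> w) *\<^sub>R d"
      by (rule Lagrange)
    also have "cross3 w d' \<bullet> d = cross3 d' d \<bullet> w" by (rule cross_triple)
    also have "\<dots> = al" by (simp add: p ww)
    also have "cross3 w d' \<bullet> w = 0" by (rule dot_cross_self)
    finally show ?thesis by simp
  qed
  have c4: "cross3 ((1/2) *\<^sub>R cross3 w d' - (1/2) *\<^sub>R (s' *\<^sub>R w)) ((1/2) *\<^sub>R cross3 w d - (1/2) *\<^sub>R (s *\<^sub>R w))
      = (1/4) *\<^sub>R (al *\<^sub>R w - s *\<^sub>R d' + s' *\<^sub>R d)"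
    by (simp add: Cross3.left_diff_distrib Cross3.right_diff_distrib cross_mult_left cross_mult_right
        c1 c2 c3 scaleR_diff_right scaleR_add_right)
  show ?thesis
    unfolding al_def[symmetric] c4 unfolding p by (simp add: vec_eq_iff field_simps)
qed

section \<open>Mollified Sobolev data\<close>

lemma test_function_eq_0_outside:
  assumes "test_function \<Omega> \<phi>" "x \<notin> \<Omega>"
  shows "\<phi> x = 0"
  using assms closure_subset[of "{x. \<phi> x \<noteq> 0}"] by (auto simp: test_function_def)

lemma pderiv_eq_0_outside:
  fixes \<phi> :: "'a::euclidean_space \<Rightarrow> real"
  assumes "test_function \<Omega> \<phi>" "x \<notin> \<Omega>"
  shows "pderiv_at \<phi> b x = 0"
proof -
  have "x \<notin> closure {x. \<phi> x \<noteq> 0}" using assms by (auto simp: test_function_def)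
  then show ?thesis using assms(1) by (elim test_functionE) blast
qed

text \<open>The approximate rule with first-order error 0: the Taylor remainder enters only through
  \<open>Q\<close>.\<close>

lemma quad_diff_by_parts:
  fixes f :: "'a::euclidean_space \<Rightarrow> 'b::euclidean_space"
  assumes \<phi>: "test_function \<Omega> \<phi>" and b: "b \<in> Basis" and f: "quad_diff f f'"
    and m: "(\<lambda>x. f' x b) \<in> borel_measurable borel"
  shows "(LINT x|lborel. pderiv_at \<phi> b x *\<^sub>R f x) = - (LINT x|lborel. \<phi> x *\<^sub>R f' x b)"
proof -
  obtain C where C: "C \<ge> 0" "\<And>x. norm (f x) \<le> C" "\<And>x k. norm (f' x k) \<le> C * norm k"
    "\<And>x k. norm (f (x + k) - f x - f' x k) \<le> C * (norm k)\<^sup>2" "\<And>x y. norm (f x - f y) \<le> 2 * C * norm (x - y)"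
    using f by (rule quad_diffE) (rule that)
  have "norm ((LINT x|lborel. pderiv_at \<phi> b x *\<^sub>R f x) + (LINT x|lborel. \<phi> x *\<^sub>R f' x b)) \<le> (LINT x|lborel. \<bar>\<phi> x\<bar> * 0)"
  proof (rule approximate_integration_by_parts[OF \<phi> b, where Q=C])
    show "f \<in> borel_measurable borel" by (rule borel_measurable_continuous_onI[OF quad_diff_continuous[OF f]])
    show "norm (f x) \<le> C" for x by (rule C(2))
    show "(\<lambda>x. f' x b) \<in> borel_measurable borel" by (rule m)
    show "norm (f' x b) \<le> C" for x using C(3)[of x b] b by simp
    show "norm (f (x + s *\<^sub>R b) - f x - s *\<^sub>R f' x b) \<le> s * 0 + C * s\<^sup>2" for x s
      using C(4)[of x "s *\<^sub>R b"] b by (simp add: linear_scale[OF quad_diff_linear[OF f]])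
  qed simp_all
  then have "(LINT x|lborel. pderiv_at \<phi> b x *\<^sub>R f x) + (LINT x|lborel. \<phi> x *\<^sub>R f' x b) = 0" by simp
  then show ?thesis by (rule eq_neg_iff_add_eq_0[THEN iffD2])
qed

text \<open>Test with the reflected kernel. The sign from differentiating \<open>x - y\<close>
  cancels the sign in the definition of the weak derivative, so the derivative passes from the
  kernel to \<open>D\<close>.\<close>

lemma conv_weak_derivative:
  fixes w D :: "'a::euclidean_space \<Rightarrow> 'b::euclidean_space"
  assumes weak: "\<And>\<phi>. test_function \<Omega> \<phi> \<Longrightarrow> (LINT x|lborel. pderiv_at \<phi> b x *\<^sub>R w x) = - (LINT x|lborel. \<phi> x *\<^sub>R D x)"
    and k: "smooth_kernel e k" and sub: "cball x e \<subseteq> \<Omega>"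
  shows "conv w (pderiv_at k b) x = conv D k x"
  using weak[OF kernel_test_function_real[OF k sub]]
  unfolding pderiv_at_reflect[OF k] conv_def by simp

lemma L1_limit_integral:
  fixes s :: "nat \<Rightarrow> 'a \<Rightarrow> 'b::{banach, second_countable_topology}"
  assumes "\<And>n. integrable M (s n)" "integrable M f" "(\<lambda>n. LINT x|M. norm (s n x - f x)) \<longlonglongrightarrow> 0"
  shows "(\<lambda>n. LINT x|M. s n x) \<longlonglongrightarrow> (LINT x|M. f x)"
proof (rule LIM_zero_cancel, rule Lim_null_comparison[OF always_eventually[OF allI] assms(3)])
  fix n
  have "(LINT x|M. s n x) - (LINT x|M. f x) = (LINT x|M. s n x - f x)" using assms by simp
  also have "norm \<dots> \<le> (LINT x|M. norm (s n x - f x))" by simp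
  finally show "norm ((LINT x|M. s n x) - (LINT x|M. f x)) \<le> (LINT x|M. norm (s n x - f x))" .
qed

lemma integrable_Pair:
  fixes f :: "'a \<Rightarrow> 'b::euclidean_space" and g :: "'a \<Rightarrow> 'c::euclidean_space"
  assumes "integrable M f" "integrable M g"
  shows "integrable M (\<lambda>x. (f x, g x))"
proof -
  have "integrable M (\<lambda>x. (f x, 0 :: 'c) + (0 :: 'b, g x))"
    by (intro Bochner_Integration.integrable_add
        integrable_bounded_linear[OF bounded_linear_Pair[OF bounded_linear_ident bounded_linear_zero] assms(1)]
        integrable_bounded_linear[OF bounded_linear_Pair[OF bounded_linear_zero bounded_linear_ident] assms(2)])
  then show ?thesis by simp
qed

lemma mollifier_radius:
  assumes "norm (x::'a::real_normed_vector) < 1 - e"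
  shows "cball x e \<subseteq> ball 0 1"
proof
  fix y assume "y \<in> cball x e"
  then have "norm (y - x) \<le> e" by (simp add: dist_norm norm_minus_commute)
  then show "y \<in> ball 0 1" using norm_triangle_sub[of y x] assms by simp
qed

lemma norm_conv_mollifier_le_1:
  fixes w :: "'a::euclidean_space \<Rightarrow> 'b::{banach, second_countable_topology}"
  assumes e: "e > 0" and w: "AE x in lborel. norm (w x) \<le> 1"
  shows "norm (conv w (mollifier e) x) \<le> 1"
proof -
  have "norm (conv w (mollifier e) x) \<le> (LINT y|lborel. mollifier e (x - y))"
    unfolding conv_def
  proof (rule norm_integral_le_AE)
    show "integrable lborel (\<lambda>y. mollifier e (x - y))"
      using not_integrable_integral_eq integral_kernel_reflect[OF e, of x] by fastforce
    show "AE y in lborel. norm (mollifier e (x - y) *\<^sub>R w y) \<le> mollifier e (x - y)"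
      using w by eventually_elim (simp add: mollifier_nonneg[OF e] mult_left_le)
  qed
  then show ?thesis by (simp add: integral_kernel_reflect[OF e])
qed

text \<open>The weak form of differentiating \<open>|w|^2 = 1\<close>. The product rule is applied
  to mollifications, and the limit is taken under domination by the mollified
  \<open>norm (D x)\<close>, since \<open>w\<close> is bounded and \<open>D\<close> merely
  integrable. Mollifiers as test functions then localise the identity.\<close>

lemma weak_derivative_orthogonal:
  fixes w D :: "'a::euclidean_space \<Rightarrow> 'b::euclidean_space"
  assumes weak: "\<And>\<phi>. test_function (ball 0 1) \<phi> \<Longrightarrow> (LINT x|lborel. pderiv_at \<phi> b x *\<^sub>R w x) = - (LINT x|lborel. \<phi> x *\<^sub>R D x)"
    and b: "b \<in> Basis" and wi: "integrable lborel w" and Di: "integrable lborel D"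
    and w1: "AE x in lborel. norm (w x) = indicator (ball 0 1) x"
  shows "AE x in lborel. x \<in> ball 0 1 \<longrightarrow> w x \<bullet> D x = 0"
proof (rule AE_zero_of_conv)
  have [measurable]: "w \<in> borel_measurable borel" "D \<in> borel_measurable borel" using wi Di by auto
  have wle: "AE x in lborel. norm (w x) \<le> 1" using w1 by eventually_elim (simp add: indicator_def)
  have nD: "integrable lborel (\<lambda>x. norm (D x))" using Di by simp
  show wDi: "integrable lborel (\<lambda>x. w x \<bullet> D x)"
  proof (rule Bochner_Integration.integrable_bound[OF nD])
    show "AE x in lborel. norm (w x \<bullet> D x) \<le> norm (norm (D x))"
      using wle
    proof eventually_elim
      case (elim x)
      show ?case using Cauchy_Schwarz_ineq2[of "w x" "D x"] mult_right_mono[OF elim, of "norm (D x)"] by simp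
    qed
  qed simp
  fix e :: real and x0 :: 'a assume e: "e > 0" and sub: "cball x0 e \<subseteq> ball 0 1"
  define \<phi> where "\<phi> y = mollifier e (x0 - y)" for y
  have \<phi>: "test_function (ball 0 1) \<phi>"
    unfolding \<phi>_def by (rule kernel_test_function_real[OF kernel_mollifier[OF e] sub])
  obtain C R where C: "C \<ge> 0" "\<And>x. \<bar>\<phi> x\<bar> \<le> C" "\<And>x y. \<bar>\<phi> x - \<phi> y\<bar> \<le> C * norm (x - y)"
    "\<And>x. \<phi> x \<noteq> 0 \<Longrightarrow> norm x \<le> R" "\<And>x. (\<phi> has_derivative frechet_derivative \<phi> (at x)) (at x)"
    "continuous_on UNIV \<phi>" "\<And>b. b \<in> Basis \<Longrightarrow> continuous_on UNIV (pderiv_at \<phi> b)"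
    "\<And>b x. b \<in> Basis \<Longrightarrow> \<bar>pderiv_at \<phi> b x\<bar> \<le> C"
    "\<And>b x. x \<notin> closure {x. \<phi> x \<noteq> 0} \<Longrightarrow> pderiv_at \<phi> b x = 0"
    using \<phi> by (rule test_functionE) (rule that)
  note [measurable] = test_function_measurable(1)[OF \<phi>] test_function_measurable(2)[OF \<phi> b]
  \<comment> \<open>The test function is supported strictly inside the ball. There the derivative of
    the mollified \<open>w\<close> is the mollified \<open>D\<close> once the radius is below
    \<open>1 - \<rho>\<close>.\<close>
  obtain \<rho> where \<rho>: "0 \<le> \<rho>" "\<rho> < 1" "cball x0 e \<subseteq> cball 0 \<rho>"
    by (rule compact_subset_ball_radius[OF compact_cball sub])
  define \<epsilon> where "\<epsilon> n = 1 / real (Suc n)" for n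
  have \<epsilon>: "\<And>n. \<epsilon> n > 0" "\<epsilon> \<longlonglongrightarrow> 0"
    unfolding \<epsilon>_def using LIMSEQ_inverse_real_of_nat by (simp_all add: inverse_eq_divide)
  \<comment> \<open>Mollifying the tuple yields one subsequence along which all components converge
    almost everywhere, including the dominating function.\<close>
  define W where "W x = (w x, D x, norm (D x))" for x
  have Wi: "integrable lborel W" unfolding W_def by (intro integrable_Pair wi Di nD)
  obtain r where r: "strict_mono (r :: nat \<Rightarrow> nat)" "AE x in lborel. (\<lambda>n. conv W (mollifier (\<epsilon> (r n))) x) \<longlonglongrightarrow> W x"
    by (rule conv_tendsto_AE_subseq[OF Wi \<epsilon>])
  define \<delta> where "\<delta> n = \<epsilon> (r n)" for n
  have \<delta>: "\<And>n. \<delta> n > 0" "\<delta> \<longlonglongrightarrow> 0"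
    unfolding \<delta>_def using \<epsilon>(1) LIMSEQ_subseq_LIMSEQ[OF \<epsilon>(2) r(1)] by (auto simp: o_def)
  define k where "k n = (mollifier (\<delta> n) :: 'a \<Rightarrow> real)" for n
  have k: "smooth_kernel (\<delta> n) (k n)" for n unfolding k_def by (rule kernel_mollifier[OF \<delta>(1)])
  define Uc where "Uc n = conv w (k n)" for n
  define Dc where "Dc n = conv D (k n)" for n
  define hn where "hn n = conv (\<lambda>x. norm (D x)) (k n)" for n
  have [measurable]: "Uc n \<in> borel_measurable borel" "Dc n \<in> borel_measurable borel" "hn n \<in> borel_measurable borel" for n
    unfolding Uc_def Dc_def hn_def by (rule conv_measurable[OF k], fact)+
  have comp: "fst (conv W (k n) x) = Uc n x" "fst (snd (conv W (k n) x)) = Dc n x" "snd (snd (conv W (k n) x)) = hn n x" for n x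
    unfolding Uc_def Dc_def hn_def
    using conv_bounded_linear[OF k Wi bounded_linear_fst]
      conv_bounded_linear[OF k Wi bounded_linear_compose[OF bounded_linear_fst bounded_linear_snd]]
      conv_bounded_linear[OF k Wi bounded_linear_compose[OF bounded_linear_snd bounded_linear_snd]]
    by (simp_all add: W_def)
  have lims: "AE x in lborel. (\<lambda>n. Uc n x) \<longlonglongrightarrow> w x \<and> (\<lambda>n. Dc n x) \<longlonglongrightarrow> D x \<and> (\<lambda>n. hn n x) \<longlonglongrightarrow> norm (D x)"
    using r(2)
  proof eventually_elim
    case (elim x)
    then have l: "(\<lambda>n. conv W (k n) x) \<longlonglongrightarrow> W x" by (simp add: k_def \<delta>_def)
    show ?case
      using tendsto_fst[OF l] tendsto_fst[OF tendsto_snd[OF l]] tendsto_snd[OF tendsto_snd[OF l]]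
      unfolding comp by (simp add: W_def)
  qed
  have Uc1: "norm (Uc n x) \<le> 1" for n x unfolding Uc_def k_def by (rule norm_conv_mollifier_le_1[OF \<delta>(1) wle])
  have hL1: "(\<lambda>n. LINT x|lborel. norm (hn n x - norm (D x))) \<longlonglongrightarrow> 0"
    unfolding hn_def k_def by (rule conv_tendsto_L1[OF nD \<delta>])
  have hi: "integrable lborel (hn n)" for n unfolding hn_def k_def by (rule integrable_conv[OF \<delta>(1) nD])
  have Dh: "norm (Dc n x) \<le> hn n x" for n x
    unfolding Dc_def hn_def by (rule norm_conv_le[OF k Di nD]) (simp_all add: k_def mollifier_nonneg \<delta>)
  have l1: "AE x in lborel. (\<lambda>n. \<phi> x * (Uc n x \<bullet> Dc n x)) \<longlonglongrightarrow> \<phi> x * (w x \<bullet> D x)"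
    using lims by eventually_elim (auto intro!: tendsto_intros)
  have l2: "AE x in lborel. (\<lambda>n. hn n x) \<longlonglongrightarrow> norm (D x)" using lims by eventually_elim simp
  have bd: "AE x in lborel. norm (\<phi> x * (Uc n x \<bullet> Dc n x)) \<le> C * hn n x" for n
  proof (rule AE_I2)
    fix x
    have "\<bar>Uc n x \<bullet> Dc n x\<bar> \<le> norm (Uc n x) * norm (Dc n x)" by (rule Cauchy_Schwarz_ineq2)
    also have "\<dots> \<le> 1 * hn n x" by (intro mult_mono Uc1 Dh) auto
    finally show "norm (\<phi> x * (Uc n x \<bullet> Dc n x)) \<le> C * hn n x"
      using C(1,2) by (simp add: abs_mult mult_mono)
  qed
  have m1: "(\<lambda>x. \<phi> x * (Uc n x \<bullet> Dc n x)) \<in> borel_measurable lborel" for n by simp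
  have m2: "(\<lambda>x. \<phi> x * (w x \<bullet> D x)) \<in> borel_measurable lborel" by simp
  note L = L1_convergence_of_dominated[OF m1 m2 hi nD l1 l2 hL1 bd C(1)]
  have lim2: "(\<lambda>n. LINT x|lborel. \<phi> x * (Uc n x \<bullet> Dc n x)) \<longlonglongrightarrow> (LINT x|lborel. \<phi> x * (w x \<bullet> D x))"
    by (rule L1_limit_integral[OF L(2,1,3)])
  have lim1: "(\<lambda>n. LINT x|lborel. pderiv_at \<phi> b x * (Uc n x \<bullet> Uc n x)) \<longlonglongrightarrow> (LINT x|lborel. pderiv_at \<phi> b x * (w x \<bullet> w x))"
  proof (rule integral_dominated_convergence)
    show "integrable lborel (\<lambda>x::'a. C * indicator (ball 0 1) x)"
      using emeasure_lborel_ball_finite by (intro integrable_mult_right integrable_real_indicator) auto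
    show "AE x in lborel. (\<lambda>n. pderiv_at \<phi> b x * (Uc n x \<bullet> Uc n x)) \<longlonglongrightarrow> pderiv_at \<phi> b x * (w x \<bullet> w x)"
      using lims by eventually_elim (auto intro!: tendsto_intros)
    show "AE x in lborel. norm (pderiv_at \<phi> b x * (Uc n x \<bullet> Uc n x)) \<le> C * indicator (ball 0 1) x" for n
    proof (rule AE_I2)
      fix x
      have "\<bar>Uc n x \<bullet> Uc n x\<bar> \<le> 1"
        using Uc1[of n x] power_mono[of "norm (Uc n x)" 1 2] by (simp flip: power2_norm_eq_inner)
      then have "norm (pderiv_at \<phi> b x * (Uc n x \<bullet> Uc n x)) \<le> C * 1"
        unfolding real_norm_def abs_mult by (intro mult_mono C(8)[OF b]) (use C(1) in auto)
      then show "norm (pderiv_at \<phi> b x * (Uc n x \<bullet> Uc n x)) \<le> C * indicator (ball 0 1) x"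
        using pderiv_eq_0_outside[OF \<phi>, of x b] by (cases "x \<in> ball 0 1") (auto simp: indicator_def)
    qed
  qed simp_all
  \<comment> \<open>The derivative of \<open>\<phi>\<close> vanishes outside the ball, and inside
    \<open>|w|^2 = 1\<close>. What remains is the integral of a derivative of a test function, which
    integration by parts against the constant 1 shows to be 0.\<close>
  have "(LINT x|lborel. pderiv_at \<phi> b x * (w x \<bullet> w x)) = (LINT x|lborel. pderiv_at \<phi> b x * 1)"
  proof (rule integral_cong_AE)
    show "AE x in lborel. pderiv_at \<phi> b x * (w x \<bullet> w x) = pderiv_at \<phi> b x * 1"
      using w1
    proof eventually_elim
      case (elim x)
      show ?case
        using elim pderiv_eq_0_outside[OF \<phi>, of x b]
        by (cases "x \<in> ball 0 1") (auto simp: norm_eq_1)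
    qed
  qed simp_all
  also have "\<dots> = 0"
  proof -
    have "quad_diff (\<lambda>_::'a. 1::real) (\<lambda>_ _. 0)"
      by (rule quad_diffI[of _ _ 1 0 0]) (auto intro: linearI)
    from quad_diff_by_parts[OF \<phi> b this] show ?thesis by simp
  qed
  finally have lhs0: "(LINT x|lborel. pderiv_at \<phi> b x * (w x \<bullet> w x)) = 0" .
  have ev: "\<forall>\<^sub>F n in sequentially. (LINT x|lborel. pderiv_at \<phi> b x * (Uc n x \<bullet> Uc n x))
      = - (2 * (LINT x|lborel. \<phi> x * (Uc n x \<bullet> Dc n x)))"
  proof -
    have "\<forall>\<^sub>F n in sequentially. \<delta> n < 1 - \<rho>" using \<rho>(2) \<delta>(2) by (intro order_tendstoD(2)) auto
    then show ?thesis
    proof eventually_elim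
      case (elim n)
      have qU: "quad_diff (Uc n) (\<lambda>x h. conv w (pderiv_at (k n) h) x)"
        unfolding Uc_def by (rule quad_diff_conv[OF k wi])
      have qUU: "quad_diff (\<lambda>x. Uc n x \<bullet> Uc n x)
          (\<lambda>x h. Uc n x \<bullet> conv w (pderiv_at (k n) h) x + conv w (pderiv_at (k n) h) x \<bullet> Uc n x)"
        by (rule quad_diff_bilinear[OF bounded_bilinear_inner qU qU])
      have [measurable]: "conv w (pderiv_at (k n) b) \<in> borel_measurable borel"
        by (rule conv_measurable[OF kernel_pderiv[OF k] wi])
      have "(LINT x|lborel. pderiv_at \<phi> b x *\<^sub>R (Uc n x \<bullet> Uc n x))
          = - (LINT x|lborel. \<phi> x *\<^sub>R (Uc n x \<bullet> conv w (pderiv_at (k n) b) x + conv w (pderiv_at (k n) b) x \<bullet> Uc n x))"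
        by (rule quad_diff_by_parts[OF \<phi> b qUU]) measurable
      also have "(LINT x|lborel. \<phi> x *\<^sub>R (Uc n x \<bullet> conv w (pderiv_at (k n) b) x + conv w (pderiv_at (k n) b) x \<bullet> Uc n x))
          = (LINT x|lborel. 2 * (\<phi> x * (Uc n x \<bullet> Dc n x)))"
      proof (intro Bochner_Integration.integral_cong refl)
        fix x
        show "\<phi> x *\<^sub>R (Uc n x \<bullet> conv w (pderiv_at (k n) b) x + conv w (pderiv_at (k n) b) x \<bullet> Uc n x)
            = 2 * (\<phi> x * (Uc n x \<bullet> Dc n x))"
        proof (cases "\<phi> x = 0")
          case False
          then have "\<not> e < norm (x0 - x)" using kernelD(2)[OF kernel_mollifier[OF e], of "x0 - x"] by (auto simp: \<phi>_def)
          then have "x \<in> cball x0 e" by (simp add: dist_norm)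
          then have "norm x \<le> \<rho>" using \<rho>(3) by auto
          then have "cball x (\<delta> n) \<subseteq> ball 0 1" using elim by (intro mollifier_radius) linarith
          then have cb: "cball x (\<delta> n) \<subseteq> ball 0 1" .
          have "conv w (pderiv_at (k n) b) x = Dc n x"
            unfolding Dc_def by (rule conv_weak_derivative[OF weak k cb])
          then show ?thesis by (simp add: inner_commute)
        qed simp
      qed
      finally show ?case by simp
    qed
  qed
  have "(\<lambda>n. LINT x|lborel. pderiv_at \<phi> b x * (Uc n x \<bullet> Uc n x)) \<longlonglongrightarrow> - (2 * (LINT x|lborel. \<phi> x * (w x \<bullet> D x)))"
  proof (rule Lim_transform_eventually)
    show "(\<lambda>n. - (2 * (LINT x|lborel. \<phi> x * (Uc n x \<bullet> Dc n x)))) \<longlonglongrightarrow> - (2 * (LINT x|lborel. \<phi> x * (w x \<bullet> D x)))"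
      by (intro tendsto_intros lim2)
    show "\<forall>\<^sub>F n in sequentially. - (2 * (LINT x|lborel. \<phi> x * (Uc n x \<bullet> Dc n x)))
        = (LINT x|lborel. pderiv_at \<phi> b x * (Uc n x \<bullet> Uc n x))"
      using ev by (rule eventually_mono) (rule sym)
  qed
  from LIMSEQ_unique[OF this lim1] have "- (2 * (LINT x|lborel. \<phi> x * (w x \<bullet> D x))) = 0" by (simp only: lhs0)
  then show "conv (\<lambda>x. w x \<bullet> D x) (mollifier e) x0 = 0" by (simp add: conv_def \<phi>_def)
qed simp

text \<open>Testing with a reflected kernel times the \<open>m\<close>-th coordinate form isolates
  one entry of the 2-form: \<open>m = 3\<close>, 2, 1 give the index pairs 12, 13, 23. The remaining
  pairs follow by antisymmetry.\<close>

lemma conv_exterior_derivative: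
  fixes \<eta> :: form1 and \<alpha> :: form2
  assumes dist: "\<And>\<phi>::form1. test_function \<Omega> \<phi> \<Longrightarrow>
      (LINT x|lborel. wedge12 \<eta> (ext_deriv \<phi>) x) = (LINT x|lborel. wedge21 \<alpha> \<phi> x)"
    and anti: "\<And>x j l. \<alpha> x $ j $ l = - \<alpha> x $ l $ j"
    and \<eta>: "integrable lborel \<eta>" and k: "smooth_kernel e k" and sub: "cball x e \<subseteq> \<Omega>"
  shows "conv (\<lambda>y. \<eta> y $ l) (pderiv_at k (axis j 1)) x - conv (\<lambda>y. \<eta> y $ j) (pderiv_at k (axis l 1)) x
    = conv (\<lambda>y. \<alpha> y $ j $ l) k x"
proof -
  define d where "d i y = pderiv_at k (axis i 1) (x - y)" for i :: 3 and y
  have \<eta>i: "integrable lborel (\<lambda>y. \<eta> y $ i)" for i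
    by (rule integrable_bounded_linear[OF bounded_linear_vec_nth \<eta>])
  have di: "integrable lborel (\<lambda>y. d i y * \<eta> y $ j)" for i j
    using conv_integrable[OF kernel_pderiv[OF k] \<eta>i, of x "axis i 1" j] by (simp add: d_def)
  have ext: "ext_deriv (\<lambda>y. k (x - y) *\<^sub>R axis m 1) y $ j $ l
      = (if l = m then - d j y else 0) - (if j = m then - d l y else 0)" for m j l :: 3 and y
  proof -
    have 1: "pderiv_at (\<lambda>y. (k (x - y) *\<^sub>R axis m (1::real)) $ l) (axis j 1) y = (if l = m then - d j y else 0)" for l j :: 3
    proof (cases "l = m")
      case True
      then show ?thesis by (simp add: pderiv_at_reflect[OF k] d_def)
    next
      case False
      then show ?thesis by (simp add: axis_def frechet_derivative_const)
    qed
    show ?thesis by (simp only: ext_deriv_def vec_lambda_beta 1)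
  qed
  have W: "(LINT y|lborel. wedge12 \<eta> (ext_deriv (\<lambda>y. k (x - y) *\<^sub>R axis m 1)) y)
      = (LINT y|lborel. wedge21 \<alpha> (\<lambda>y. k (x - y) *\<^sub>R axis m 1) y)" for m :: 3
    by (rule dist[OF kernel_test_function[OF k sub]])
  have c: "conv (\<lambda>y. \<eta> y $ i) (pderiv_at k (axis j 1)) x = (LINT y|lborel. d j y * \<eta> y $ i)" for i j :: 3
    by (simp add: conv_def d_def)
  have c': "conv (\<lambda>y. \<alpha> y $ i $ j) k x = (LINT y|lborel. k (x - y) * \<alpha> y $ i $ j)" for i j :: 3
    by (simp add: conv_def)
  have "(LINT y|lborel. d 1 y * \<eta> y $ 2 - d 2 y * \<eta> y $ 1) = (LINT y|lborel. k (x - y) * \<alpha> y $ 1 $ 2)"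
    using W[of 3] unfolding wedge12_def wedge21_def ext by (simp add: axis_def mult.commute)
  then have 12: "(LINT y|lborel. d 1 y * \<eta> y $ 2) - (LINT y|lborel. d 2 y * \<eta> y $ 1) = (LINT y|lborel. k (x - y) * \<alpha> y $ 1 $ 2)"
    by (simp only: Bochner_Integration.integral_diff[OF di di])
  have "(LINT y|lborel. d 3 y * \<eta> y $ 1 - d 1 y * \<eta> y $ 3) = - (LINT y|lborel. k (x - y) * \<alpha> y $ 1 $ 3)"
    using W[of 2] unfolding wedge12_def wedge21_def ext by (simp add: axis_def mult.commute)
  then have 13: "(LINT y|lborel. d 1 y * \<eta> y $ 3) - (LINT y|lborel. d 3 y * \<eta> y $ 1) = (LINT y|lborel. k (x - y) * \<alpha> y $ 1 $ 3)"
    by (simp only: Bochner_Integration.integral_diff[OF di di])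
  have "(LINT y|lborel. d 2 y * \<eta> y $ 3 - d 3 y * \<eta> y $ 2) = (LINT y|lborel. k (x - y) * \<alpha> y $ 2 $ 3)"
    using W[of 1] unfolding wedge12_def wedge21_def ext by (simp add: axis_def mult.commute)
  then have 23: "(LINT y|lborel. d 2 y * \<eta> y $ 3) - (LINT y|lborel. d 3 y * \<eta> y $ 2) = (LINT y|lborel. k (x - y) * \<alpha> y $ 2 $ 3)"
    by (simp only: Bochner_Integration.integral_diff[OF di di])
  have flip: "(LINT y|lborel. k (x - y) * \<alpha> y $ i $ j) = - (LINT y|lborel. k (x - y) * \<alpha> y $ j $ i)" for i j
    by (subst anti) simp
  have diag: "(LINT y|lborel. k (x - y) * \<alpha> y $ i $ i) = 0" for i using flip[of i i] by simp
  show ?thesis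
    unfolding c c'
    using 12 13 23 flip[of 2 1] flip[of 3 1] flip[of 3 2] diag exhaust_3[of j] exhaust_3[of l] by auto
qed

lemma bounded_bilinear_cross3: "bounded_bilinear cross3"
  using bilinear_cross bilinear_conv_bounded_bilinear by blast

lemma norm_cross3_le: "norm (cross3 a b) \<le> norm a * norm b"
proof -
  have "(norm (cross3 a b))\<^sup>2 \<le> (norm a * norm b)\<^sup>2"
    using norm_cross_dot[of a b] zero_le_power2[of "a \<bullet> b"] by linarith
  then show ?thesis by (rule power2_le_imp_le) simp
qed

lemma Basis_real_vec: "b \<in> (Basis :: (real^'n) set) \<longleftrightarrow> (\<exists>j. b = axis j 1)"
  by (auto simp: Basis_vec_def)

text \<open>Converts basis vectors, by which connections are indexed in the general lemmas, to the
  coordinate indices of forms.\<close>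

definition basis_index :: "real^'n \<Rightarrow> 'n" where
  "basis_index b = (THE j. b = axis j 1)"

lemma basis_index_axis: "basis_index (axis j 1) = j"
  unfolding basis_index_def by (rule the_equality) (auto simp: axis_eq_axis)

section \<open>The lift of a map into the sphere\<close>

text \<open>The arguments stand for \<open>u\<close>, its derivatives, \<open>\<eta>\<close> and \<open>d\<eta>\<close> at a point. \<open>hopf_conn\<close> is the
  connection \<open>A\<close>; \<open>hopf_curv\<close> is its curvature, and \<open>hopf_par\<close> the covariant derivative of \<open>u\<close>.\<close>

definition hopf_conn :: "real^3 \<Rightarrow> real^3^3 \<Rightarrow> real^3 \<Rightarrow> 3 \<Rightarrow> real^3" where
  "hopf_conn p M s j = (1/2) *\<^sub>R cross3 p (M $ j) - (1/2) *\<^sub>R (s $ j *\<^sub>R p)"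

definition hopf_curv :: "real^3 \<Rightarrow> real^3^3 \<Rightarrow> real^3 \<Rightarrow> real^3^3 \<Rightarrow> 3 \<Rightarrow> 3 \<Rightarrow> real^3" where
  "hopf_curv p M s N j l = cross3 (M $ l) (M $ j) - (1/2) *\<^sub>R (N $ l $ j *\<^sub>R p)
    - (1/2) *\<^sub>R (s $ j *\<^sub>R M $ l - s $ l *\<^sub>R M $ j) - 2 *\<^sub>R cross3 (hopf_conn p M s l) (hopf_conn p M s j)"

definition hopf_par :: "real^3 \<Rightarrow> real^3^3 \<Rightarrow> real^3 \<Rightarrow> 3 \<Rightarrow> real^3" where
  "hopf_par p M s j = M $ j - 2 *\<^sub>R cross3 (hopf_conn p M s j) p"

lemma norm_hopf_conn_le:
  assumes "norm p \<le> 1"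
  shows "norm (hopf_conn p M s j) \<le> (1/2) * norm M + (1/2) * norm s"
proof -
  have "norm (cross3 p (M $ j)) \<le> 1 * norm M"
    by (rule order.trans[OF norm_cross3_le]) (intro mult_mono assms Finite_Cartesian_Product.norm_nth_le, auto)
  moreover have "norm (s $ j *\<^sub>R p) \<le> norm s * 1"
    unfolding norm_scaleR using component_le_norm_cart[of s j] assms by (intro mult_mono) auto
  ultimately show ?thesis
    unfolding hopf_conn_def by (intro order.trans[OF norm_triangle_ineq4]) simp
qed

text \<open>One number \<open>H\<close> above the norms and their squares also bounds all products,
  by the inequality between arithmetic and geometric mean. The four terms of the curvature
  contribute \<open>H\<close>, \<open>2 * H\<close>, \<open>H\<close> and \<open>2 * H\<close>. The
  weaker hypothesis on \<open>N\<close> reflects that this matrix has nine entries, each bounded by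
  \<open>H\<close>.\<close>

lemma hopf_bounds:
  assumes p: "norm p \<le> 1" and M: "norm M \<le> H" "(norm M)\<^sup>2 \<le> H" and s: "norm s \<le> H" "(norm s)\<^sup>2 \<le> H" and N: "norm N \<le> 3 * H"
  shows "norm (hopf_conn p M s j) \<le> H" "norm (hopf_curv p M s N j l) \<le> 6 * H" "norm (hopf_par p M s j) \<le> 3 * H"
proof -
  have Mj: "norm (M $ j) \<le> norm M" for j by (rule Finite_Cartesian_Product.norm_nth_le)
  have sj: "\<bar>s $ j\<bar> \<le> norm s" for j by (rule component_le_norm_cart)
  have "norm (N $ l $ j) \<le> norm N"
    by (rule order.trans[OF Finite_Cartesian_Product.norm_nth_le Finite_Cartesian_Product.norm_nth_le])
  then have Nlj: "\<bar>N $ l $ j\<bar> \<le> 3 * H" using N by simp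
  have H0: "0 \<le> H" using M(1) norm_ge_zero order.trans by blast
  note A = norm_hopf_conn_le[OF p, of M s]
  show A1: "norm (hopf_conn p M s j) \<le> H" using A[of j] M(1) s(1) by linarith
  have prod: "a * b \<le> H" if "0 \<le> a" "0 \<le> b" "a\<^sup>2 \<le> H" "b\<^sup>2 \<le> H" for a b
    using sum_squares_bound[of a b] that by linarith
  have MM: "norm M * norm M \<le> H" using M(2) by (simp add: power2_eq_square)
  have sM: "norm s * norm M \<le> H" by (rule prod) (use M s in auto)
  have ss: "norm s * norm s \<le> H" using s(2) by (simp add: power2_eq_square)
  have c1: "norm (cross3 (M $ l) (M $ j)) \<le> H"
    by (rule order.trans[OF norm_cross3_le order.trans[OF mult_mono[OF Mj Mj] MM]]) auto
  have c2: "norm ((1/2) *\<^sub>R (N $ l $ j *\<^sub>R p)) \<le> 2 * H"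
  proof -
    have "\<bar>N $ l $ j\<bar> * norm p \<le> (3 * H) * 1" using Nlj p H0 by (intro mult_mono) auto
    then show ?thesis using H0 by simp
  qed
  have c3: "norm ((1/2) *\<^sub>R (s $ j *\<^sub>R M $ l - s $ l *\<^sub>R M $ j)) \<le> H"
  proof -
    have "norm (s $ j *\<^sub>R M $ l) \<le> H" for j l
      unfolding norm_scaleR by (rule order.trans[OF mult_mono[OF sj Mj] sM]) auto
    then have "norm (s $ j *\<^sub>R M $ l - s $ l *\<^sub>R M $ j) \<le> H + H"
      by (intro order.trans[OF norm_triangle_ineq4] add_mono)
    then show ?thesis by simp
  qed
  have c4: "norm (2 *\<^sub>R cross3 (hopf_conn p M s l) (hopf_conn p M s j)) \<le> 2 * H"
  proof -
    have "norm (cross3 (hopf_conn p M s l) (hopf_conn p M s j))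
        \<le> ((1/2) * norm M + (1/2) * norm s) * ((1/2) * norm M + (1/2) * norm s)"
      by (rule order.trans[OF norm_cross3_le mult_mono[OF A A]]) auto
    also have "\<dots> = (1/4) * (norm M * norm M) + (1/2) * (norm s * norm M) + (1/4) * (norm s * norm s)"
      by (simp add: algebra_simps)
    also have "\<dots> \<le> H" using MM sM ss by linarith
    finally show ?thesis by simp
  qed
  show "norm (hopf_curv p M s N j l) \<le> 6 * H"
    unfolding hopf_curv_def
    using norm_triangle_ineq4 c1 c2 c3 c4
    by (smt (verit))
  have "norm (cross3 (hopf_conn p M s j) p) \<le> H * 1"
    by (rule order.trans[OF norm_cross3_le mult_mono[OF A1 p]]) (use H0 in auto)
  then have "norm (2 *\<^sub>R cross3 (hopf_conn p M s j) p) \<le> 2 * H" by simp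
  moreover have "norm (M $ j) \<le> H" using Mj[of j] M(1) by linarith
  ultimately show "norm (hopf_par p M s j) \<le> 3 * H"
    unfolding hopf_par_def using norm_triangle_ineq4[of "M $ j" "2 *\<^sub>R cross3 (hopf_conn p M s j) p"] by linarith
qed

text \<open>All three expressions are polynomial in arguments that are kept independent, so
  mollified data and their limits enter the same formula. Flatness of the limit becomes convergence
  of the curvature to 0.\<close>

lemma tendsto_hopf:
  assumes "(p \<longlongrightarrow> p') F" "(M \<longlongrightarrow> M') F" "(s \<longlongrightarrow> s') F" "(N \<longlongrightarrow> N') F"
  shows "((\<lambda>x. hopf_conn (p x) (M x) (s x) j) \<longlongrightarrow> hopf_conn p' M' s' j) F"
    "((\<lambda>x. hopf_curv (p x) (M x) (s x) (N x) j l) \<longlongrightarrow> hopf_curv p' M' s' N' j l) F"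
    "((\<lambda>x. hopf_par (p x) (M x) (s x) j) \<longlongrightarrow> hopf_par p' M' s' j) F"
proof -
  show c: "((\<lambda>x. hopf_conn (p x) (M x) (s x) j) \<longlongrightarrow> hopf_conn p' M' s' j) F" for j
    unfolding hopf_conn_def
    by (intro tendsto_intros bounded_bilinear.tendsto[OF bounded_bilinear_cross3] assms)
  show "((\<lambda>x. hopf_curv (p x) (M x) (s x) (N x) j l) \<longlongrightarrow> hopf_curv p' M' s' N' j l) F"
    "((\<lambda>x. hopf_par (p x) (M x) (s x) j) \<longlongrightarrow> hopf_par p' M' s' j) F"
    unfolding hopf_curv_def hopf_par_def
    by (intro tendsto_intros bounded_bilinear.tendsto[OF bounded_bilinear_cross3] assms c)+
qed

lemma continuous_hopf:
  assumes "continuous_on S p" "continuous_on S M" "continuous_on S s" "continuous_on S N"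
  shows "continuous_on S (\<lambda>x. hopf_conn (p x) (M x) (s x) j)"
    "continuous_on S (\<lambda>x. hopf_curv (p x) (M x) (s x) (N x) j l)"
    "continuous_on S (\<lambda>x. hopf_par (p x) (M x) (s x) j)"
  using assms unfolding continuous_on_def by (auto intro!: tendsto_hopf)

lemma measurable_hopf:
  assumes "p \<in> borel_measurable borel" "M \<in> borel_measurable borel" "s \<in> borel_measurable borel" "N \<in> borel_measurable borel"
  shows "(\<lambda>x. hopf_conn (p x) (M x) (s x) j) \<in> borel_measurable borel"
    "(\<lambda>x. hopf_curv (p x) (M x) (s x) (N x) j l) \<in> borel_measurable borel"
    "(\<lambda>x. hopf_par (p x) (M x) (s x) j) \<in> borel_measurable borel"
proof -
  have q: "(\<lambda>x. (p x, M x, s x, N x)) \<in> borel_measurable borel"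
    using assms by (intro borel_measurable_Pair)
  have c: "continuous_on UNIV (\<lambda>(q::(real^3) \<times> (real^3^3) \<times> (real^3) \<times> (real^3^3)). fst q)"
    "continuous_on UNIV (\<lambda>(q::(real^3) \<times> (real^3^3) \<times> (real^3) \<times> (real^3^3)). fst (snd q))"
    "continuous_on UNIV (\<lambda>(q::(real^3) \<times> (real^3^3) \<times> (real^3) \<times> (real^3^3)). fst (snd (snd q)))"
    "continuous_on UNIV (\<lambda>(q::(real^3) \<times> (real^3^3) \<times> (real^3) \<times> (real^3^3)). snd (snd (snd q)))"
    by (intro continuous_intros)+
  show "(\<lambda>x. hopf_conn (p x) (M x) (s x) j) \<in> borel_measurable borel"
    "(\<lambda>x. hopf_curv (p x) (M x) (s x) (N x) j l) \<in> borel_measurable borel"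
    "(\<lambda>x. hopf_par (p x) (M x) (s x) j) \<in> borel_measurable borel"
    using measurable_compose[OF q borel_measurable_continuous_onI[OF continuous_hopf(1)[OF c]]]
      measurable_compose[OF q borel_measurable_continuous_onI[OF continuous_hopf(2)[OF c]]]
      measurable_compose[OF q borel_measurable_continuous_onI[OF continuous_hopf(3)[OF c]]] by simp_all
qed

lemma hopf_conn_0: "hopf_conn 0 0 0 j = 0" "hopf_curv 0 0 0 0 j l = 0" "hopf_par 0 0 0 j = 0"
  by (simp_all add: hopf_conn_def hopf_curv_def hopf_par_def)

lemma strict_mono_fast_subseq:
  fixes T :: "nat \<Rightarrow> real"
  assumes "T \<longlonglongrightarrow> 0"
  obtains q where "strict_mono (q :: nat \<Rightarrow> nat)" "\<And>n. T (q n) < (1/2) ^ n"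
proof -
  have "\<forall>n. \<exists>N. \<forall>m\<ge>N. T m < (1/2) ^ n"
  proof
    fix n :: nat
    have "\<forall>\<^sub>F m in sequentially. T m < (1/2) ^ n" using assms by (intro order_tendstoD(2)) auto
    then show "\<exists>N. \<forall>m\<ge>N. T m < (1/2) ^ n" unfolding eventually_sequentially .
  qed
  then obtain N where N: "\<And>n m. N n \<le> m \<Longrightarrow> T m < (1/2) ^ n" by metis
  define q where "q n = n + (\<Sum>i\<le>n. N i)" for n
  show ?thesis
  proof (rule that[of q])
    show "strict_mono q" unfolding strict_mono_Suc_iff by (simp add: q_def)
    show "T (q n) < (1/2) ^ n" for n
      using member_le_sum[of n "{..n}" N] by (intro N) (simp add: q_def)
  qed
qed

lemma sum_vec_norm_square: "(norm (M::real^'n^'m))\<^sup>2 = (\<Sum>j\<in>UNIV. (norm (M $ j))\<^sup>2)"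
  by (simp add: power2_norm_eq_inner inner_vec_def)

text \<open>The theorem for Borel data that vanish outside the ball. The extension by zero lets
  everything be mollified on the whole space; the price is that the differential equations hold only
  at distance more than the mollification radius from the boundary.\<close>

lemma hopf_lift_of_representatives:
  fixes w e :: "real^3 \<Rightarrow> real^3" and M :: "real^3 \<Rightarrow> real^3^3"
  assumes weak: "\<And>j \<phi>. test_function (ball 0 1) \<phi> \<Longrightarrow>
      (LINT x|lborel. pderiv_at \<phi> (axis j 1) x *\<^sub>R w x) = - (LINT x|lborel. \<phi> x *\<^sub>R (M x $ j))"
    and dist: "\<And>\<phi>::form1. test_function (ball 0 1) \<phi> \<Longrightarrow>
      (LINT x|lborel. wedge12 e (ext_deriv \<phi>) x)
        = (LINT x|lborel. wedge21 (\<lambda>x. \<chi> j l. w x \<bullet> cross3 (M x $ j) (M x $ l)) \<phi> x)"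
    and meas [measurable]: "w \<in> borel_measurable borel" "M \<in> borel_measurable borel" "e \<in> borel_measurable borel"
    and w1: "AE x in lborel. norm (w x) = indicator (ball 0 1) x"
    and zero: "\<And>x. x \<notin> ball 0 1 \<Longrightarrow> w x = 0" "\<And>x. x \<notin> ball 0 1 \<Longrightarrow> M x = 0" "\<And>x. x \<notin> ball 0 1 \<Longrightarrow> e x = 0"
    and M2: "integrable lborel (\<lambda>x. (norm (M x))\<^sup>2)" and e2: "integrable lborel (\<lambda>x. (norm (e x))\<^sup>2)"
  obtains v where "v \<in> borel_measurable borel" "\<And>x. norm (v x) \<le> 1"
    "AE x in lborel. norm x < 1 \<longrightarrow> norm (v x) = 1 \<and> hopf3 (v x) = w x"
    "\<And>\<phi> j. test_function (ball 0 1) \<phi> \<Longrightarrow>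
      (LINT x|lborel. pderiv_at \<phi> (axis j 1) x *\<^sub>R v x)
        = - (LINT x|lborel. \<phi> x *\<^sub>R spin (hopf_conn (w x) (M x) (e x) j) (v x))"
proof -

  \<comment> \<open>Integrability and the dominating function\<close>
  define \<alpha> :: "real^3 \<Rightarrow> real^3^3" where "\<alpha> x = (\<chi> j l. w x \<bullet> cross3 (M x $ j) (M x $ l))" for x
  \<comment> \<open>The indicator turns control of squares into control of first powers, through
    \<open>t \<le> 1 + t\<^sup>2\<close> inside the ball; outside, the data vanish.\<close>
  define H where "H x = indicator (ball 0 1) x + (norm (M x))\<^sup>2 + (norm (e x))\<^sup>2" for x :: "real^3"
  have fin: "emeasure lborel (ball (0::real^3) 1) < \<infinity>" using emeasure_lborel_ball_finite by simp
  have Hi: "integrable lborel H"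
    unfolding H_def using fin by (intro Bochner_Integration.integrable_add integrable_real_indicator M2 e2) auto
  have [measurable]: "H \<in> borel_measurable borel" using Hi by simp
  have Mi: "integrable lborel M" by (rule integrable_of_square[OF meas(2) _ fin zero(2) M2]) auto
  have ei: "integrable lborel e" by (rule integrable_of_square[OF meas(3) _ fin zero(3) e2]) auto
  have w1': "AE x in lborel. norm (w x) \<le> 1" using w1 by eventually_elim (simp add: indicator_def)
  have wi: "integrable lborel w"
  proof (rule Bochner_Integration.integrable_bound)
    show "integrable lborel (indicator (ball (0::real^3) 1) :: _ \<Rightarrow> real)" using fin by (intro integrable_real_indicator) auto
    show "AE x in lborel. norm (w x) \<le> norm (indicator (ball 0 1) x :: real)" using w1 by eventually_elim simp
  qed simp
  have le1: "t \<le> 1 + t\<^sup>2" for t :: real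
  proof -
    have "2 * t \<le> t\<^sup>2 + 1" using sum_squares_bound[of t 1] by simp
    then show ?thesis using zero_le_power2[of t] by linarith
  qed
  have HM: "norm (M x) \<le> H x" "(norm (M x))\<^sup>2 \<le> H x" for x
  proof -
    have "(norm (M x))\<^sup>2 \<le> H x" unfolding H_def by (simp add: add_increasing add_increasing2)
    moreover have "norm (M x) \<le> H x"
    proof (cases "x \<in> ball 0 1")
      case True
      then have "H x = 1 + (norm (M x))\<^sup>2 + (norm (e x))\<^sup>2" by (simp add: H_def)
      then show ?thesis using le1[of "norm (M x)"] zero_le_power2[of "norm (e x)"] by linarith
    next
      case False
      then show ?thesis using zero(2)[OF False] by (simp add: H_def)
    qed
    ultimately show "norm (M x) \<le> H x" "(norm (M x))\<^sup>2 \<le> H x" by simp_all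
  qed
  have He: "norm (e x) \<le> H x" "(norm (e x))\<^sup>2 \<le> H x" for x
  proof -
    have "(norm (e x))\<^sup>2 \<le> H x" unfolding H_def by (simp add: add_increasing add_increasing2)
    moreover have "norm (e x) \<le> H x"
    proof (cases "x \<in> ball 0 1")
      case True
      then have "H x = 1 + (norm (M x))\<^sup>2 + (norm (e x))\<^sup>2" by (simp add: H_def)
      then show ?thesis using le1[of "norm (e x)"] zero_le_power2[of "norm (M x)"] by linarith
    next
      case False
      then show ?thesis using zero(3)[OF False] by (simp add: H_def)
    qed
    ultimately show "norm (e x) \<le> H x" "(norm (e x))\<^sup>2 \<le> H x" by simp_all
  qed
  have \<alpha>jl: "\<alpha> x $ j $ l = w x \<bullet> cross3 (M x $ j) (M x $ l)" for x j l by (simp add: \<alpha>_def)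
  have \<alpha>anti: "\<alpha> x $ j $ l = - \<alpha> x $ l $ j" for x j l
    unfolding \<alpha>jl using cross_skew[of "M x $ j" "M x $ l"] by (metis inner_minus_right)
  have [measurable]: "\<alpha> \<in> borel_measurable borel"
  proof -
    have q: "(\<lambda>x. (w x, M x)) \<in> borel_measurable borel" by (intro borel_measurable_Pair meas)
    have c: "continuous_on UNIV (\<lambda>q::(real^3) \<times> (real^3^3). \<chi> j l. fst q \<bullet> cross3 (snd q $ j) (snd q $ l))"
      by (intro continuous_on_vec_lambda continuous_on_inner continuous_on_cross continuous_intros)
    show ?thesis
      using measurable_compose[OF q borel_measurable_continuous_onI[OF c]] by (simp add: \<alpha>_def[abs_def])
  qed
  \<comment> \<open>Each of the nine entries is at most \<open>(norm (M x))\<^sup>2\<close>, and the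
    root of nine gives the constant 3.\<close>
  have \<alpha>b: "AE x in lborel. norm (\<alpha> x) \<le> 3 * (norm (M x))\<^sup>2"
    using w1'
  proof eventually_elim
    case (elim x)
    let ?q = "(norm (M x))\<^sup>2"
    have 1: "\<bar>\<alpha> x $ j $ l\<bar> \<le> ?q" for j l
    proof -
      have "\<bar>\<alpha> x $ j $ l\<bar> \<le> norm (w x) * norm (cross3 (M x $ j) (M x $ l))"
        unfolding \<alpha>jl by (rule Cauchy_Schwarz_ineq2)
      also have "\<dots> \<le> 1 * (norm (M x) * norm (M x))"
        by (intro mult_mono elim order.trans[OF norm_cross3_le] Finite_Cartesian_Product.norm_nth_le) auto
      finally show ?thesis by (simp add: power2_eq_square)
    qed
    have "(norm (\<alpha> x))\<^sup>2 = (\<Sum>j\<in>UNIV. \<Sum>l\<in>UNIV. (\<alpha> x $ j $ l)\<^sup>2)"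
      unfolding sum_vec_norm_square power2_norm_eq_inner inner_vec_def inner_real_def
      by (simp add: power2_eq_square)
    also have "\<dots> \<le> (\<Sum>j\<in>(UNIV::3 set). \<Sum>l\<in>(UNIV::3 set). ?q\<^sup>2)"
    proof (intro sum_mono)
      show "(\<alpha> x $ j $ l)\<^sup>2 \<le> ?q\<^sup>2" for j l
        using power_mono[OF 1[of j l] abs_ge_zero, of 2] by (simp only: power2_abs)
    qed
    also have "\<dots> = (3 * ?q)\<^sup>2" by (simp add: power_mult_distrib)
    finally show ?case by (rule power2_le_imp_le) simp
  qed
  have \<alpha>i: "integrable lborel \<alpha>"
    by (rule Bochner_Integration.integrable_bound[of _ "\<lambda>x. 3 * (norm (M x))\<^sup>2"]) (use M2 \<alpha>b in auto)
  have \<alpha>H: "AE x in lborel. norm (\<alpha> x) \<le> 3 * H x" using \<alpha>b by eventually_elim (use HM(2) in \<open>fastforce intro: order.trans\<close>)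
  have Mji: "integrable lborel (\<lambda>x. M x $ j)" for j by (rule integrable_bounded_linear[OF bounded_linear_vec_nth Mi])
  have orth: "AE x in lborel. x \<in> ball 0 1 \<longrightarrow> w x \<bullet> M x $ j = 0" for j
    by (rule weak_derivative_orthogonal[where b="axis j 1", OF weak _ wi Mji w1]) (auto simp: Basis_real_vec)
  \<comment> \<open>Joint mollification, so that one subsequence gives convergence almost everywhere
    for every field and for the dominating function.\<close>
  define W where "W x = (w x, M x, e x, \<alpha> x, H x)" for x
  have Wi: "integrable lborel W" unfolding W_def by (intro integrable_Pair wi Mi ei \<alpha>i Hi)
  define \<epsilon> where "\<epsilon> n = 1 / real (Suc n)" for n
  have \<epsilon>: "\<And>n. \<epsilon> n > 0" "\<epsilon> \<longlonglongrightarrow> 0"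
    unfolding \<epsilon>_def using LIMSEQ_inverse_real_of_nat by (simp_all add: inverse_eq_divide)
  obtain r where r: "strict_mono (r :: nat \<Rightarrow> nat)" "AE x in lborel. (\<lambda>n. conv W (mollifier (\<epsilon> (r n))) x) \<longlonglongrightarrow> W x"
    by (rule conv_tendsto_AE_subseq[OF Wi \<epsilon>])
  define \<delta> where "\<delta> n = \<epsilon> (r n)" for n
  have \<delta>: "\<And>n. \<delta> n > 0" "\<delta> \<longlonglongrightarrow> 0"
    unfolding \<delta>_def using \<epsilon>(1) LIMSEQ_subseq_LIMSEQ[OF \<epsilon>(2) r(1)] by (auto simp: o_def)
  define k where "k n = (mollifier (\<delta> n) :: real^3 \<Rightarrow> real)" for n
  have k: "smooth_kernel (\<delta> n) (k n)" for n unfolding k_def by (rule kernel_mollifier[OF \<delta>(1)])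
  have k0: "0 \<le> k n x" for n x unfolding k_def by (rule mollifier_nonneg[OF \<delta>(1)])

  \<comment> \<open>Mollified fields and their bounds\<close>
  define wc where "wc n = conv w (k n)" for n
  define Mc where "Mc n = conv M (k n)" for n
  define ec where "ec n = conv e (k n)" for n
  define ac where "ac n = conv \<alpha> (k n)" for n
  define Hc where "Hc n = conv H (k n)" for n
  have comp: "fst (conv W (k n) x) = wc n x" "fst (snd (conv W (k n) x)) = Mc n x"
    "fst (snd (snd (conv W (k n) x))) = ec n x" "fst (snd (snd (snd (conv W (k n) x)))) = ac n x"
    "snd (snd (snd (snd (conv W (k n) x)))) = Hc n x" for n x
    unfolding wc_def Mc_def ec_def ac_def Hc_def
    using conv_bounded_linear[OF k Wi bounded_linear_fst]
      conv_bounded_linear[OF k Wi bounded_linear_compose[OF bounded_linear_fst bounded_linear_snd]]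
      conv_bounded_linear[OF k Wi bounded_linear_compose[OF bounded_linear_fst bounded_linear_compose[OF bounded_linear_snd bounded_linear_snd]]]
      conv_bounded_linear[OF k Wi bounded_linear_compose[OF bounded_linear_fst bounded_linear_compose[OF bounded_linear_snd bounded_linear_compose[OF bounded_linear_snd bounded_linear_snd]]]]
      conv_bounded_linear[OF k Wi bounded_linear_compose[OF bounded_linear_snd bounded_linear_compose[OF bounded_linear_snd bounded_linear_compose[OF bounded_linear_snd bounded_linear_snd]]]]
    by (simp_all add: W_def)
  have lims: "AE x in lborel. (\<lambda>n. wc n x) \<longlonglongrightarrow> w x \<and> (\<lambda>n. Mc n x) \<longlonglongrightarrow> M x \<and> (\<lambda>n. ec n x) \<longlonglongrightarrow> e x
      \<and> (\<lambda>n. ac n x) \<longlonglongrightarrow> \<alpha> x \<and> (\<lambda>n. Hc n x) \<longlonglongrightarrow> H x"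
    using r(2)
  proof eventually_elim
    case (elim x)
    then have l: "(\<lambda>n. conv W (k n) x) \<longlonglongrightarrow> W x" by (simp add: k_def \<delta>_def)
    note l1 = tendsto_snd[OF l]
    note l2 = tendsto_snd[OF l1]
    note l3 = tendsto_snd[OF l2]
    show ?case
      using tendsto_fst[OF l] tendsto_fst[OF l1] tendsto_fst[OF l2] tendsto_fst[OF l3] tendsto_snd[OF l3]
      unfolding comp by (simp add: W_def)
  qed
  have qw: "quad_diff (wc n) (\<lambda>x h. conv w (pderiv_at (k n) h) x)" for n unfolding wc_def by (rule quad_diff_conv[OF k wi])
  have qM: "quad_diff (Mc n) (\<lambda>x h. conv M (pderiv_at (k n) h) x)" for n unfolding Mc_def by (rule quad_diff_conv[OF k Mi])
  have qe: "quad_diff (ec n) (\<lambda>x h. conv e (pderiv_at (k n) h) x)" for n unfolding ec_def by (rule quad_diff_conv[OF k ei])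
  have qa: "quad_diff (ac n) (\<lambda>x h. conv \<alpha> (pderiv_at (k n) h) x)" for n unfolding ac_def by (rule quad_diff_conv[OF k \<alpha>i])
  note cont = quad_diff_continuous[OF qw] quad_diff_continuous[OF qM] quad_diff_continuous[OF qe] quad_diff_continuous[OF qa]
  have mc: "wc n \<in> borel_measurable borel" "Mc n \<in> borel_measurable borel" "ec n \<in> borel_measurable borel"
    "ac n \<in> borel_measurable borel" for n
    by (rule borel_measurable_continuous_onI[OF cont(1)] borel_measurable_continuous_onI[OF cont(2)]
        borel_measurable_continuous_onI[OF cont(3)] borel_measurable_continuous_onI[OF cont(4)])+
  have b1: "norm (wc n x) \<le> 1" for n x unfolding wc_def k_def by (rule norm_conv_mollifier_le_1[OF \<delta>(1) w1'])
  have cmono: "conv f (k n) x \<le> Hc n x" if f: "integrable lborel f" "\<And>x. \<bar>f x\<bar> \<le> H x" for f :: "real^3 \<Rightarrow> real" and n x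
  proof -
    have "norm (conv f (k n) x) \<le> conv H (k n) x" by (rule norm_conv_le[OF k f(1) Hi k0]) (use f(2) in simp)
    then show ?thesis by (simp add: Hc_def)
  qed
  have bM: "norm (Mc n x) \<le> Hc n x" "(norm (Mc n x))\<^sup>2 \<le> Hc n x" for n x
  proof -
    show "norm (Mc n x) \<le> Hc n x"
      unfolding Mc_def Hc_def by (rule norm_conv_le[OF k Mi Hi k0]) (use HM(1) in simp)
    have "(norm (Mc n x))\<^sup>2 \<le> conv (\<lambda>x. (norm (M x))\<^sup>2) (k n) x"
      unfolding Mc_def k_def by (rule norm_conv_square_le[OF \<delta>(1) Mi M2])
    also have "\<dots> \<le> Hc n x" by (rule cmono[OF M2]) (use HM(2) in simp)
    finally show "(norm (Mc n x))\<^sup>2 \<le> Hc n x" .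
  qed
  have be: "norm (ec n x) \<le> Hc n x" "(norm (ec n x))\<^sup>2 \<le> Hc n x" for n x
  proof -
    show "norm (ec n x) \<le> Hc n x"
      unfolding ec_def Hc_def by (rule norm_conv_le[OF k ei Hi k0]) (use He(1) in simp)
    have "(norm (ec n x))\<^sup>2 \<le> conv (\<lambda>x. (norm (e x))\<^sup>2) (k n) x"
      unfolding ec_def k_def by (rule norm_conv_square_le[OF \<delta>(1) ei e2])
    also have "\<dots> \<le> Hc n x" by (rule cmono[OF e2]) (use He(2) in simp)
    finally show "(norm (ec n x))\<^sup>2 \<le> Hc n x" .
  qed
  have ba: "norm (ac n x) \<le> 3 * Hc n x" for n x
  proof -
    have H3: "integrable lborel (\<lambda>x. 3 * H x)" using Hi by simp
    have "norm (ac n x) \<le> conv (\<lambda>x. 3 * H x) (k n) x"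
      unfolding ac_def by (rule norm_conv_le[OF k \<alpha>i H3 k0 \<alpha>H])
    also have "\<dots> = 3 * Hc n x"
      using conv_bounded_linear[OF k Hi bounded_linear_mult_right[of 3]] by (simp add: Hc_def)
    finally show ?thesis .
  qed
  note bounds = hopf_bounds[OF b1 bM be ba]

  \<comment> \<open>Connection, curvature and covariant derivative of the mollified fields\<close>
  define A where "A n j x = hopf_conn (wc n x) (Mc n x) (ec n x) j" for n j x
  \<comment> \<open>The mollified \<open>\<alpha>\<close> stands in place of the exterior derivative
    of the mollified \<open>e\<close>. Hence \<open>P\<close> is defined and dominated everywhere,
    and is the true curvature of \<open>A n\<close> only at distance more than
    \<open>\<delta> n\<close> from the boundary.\<close>
  define P where "P n j l x = hopf_curv (wc n x) (Mc n x) (ec n x) (ac n x) j l" for n j l x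
  define G where "G n j x = hopf_par (wc n x) (Mc n x) (ec n x) j" for n j x
  define B where "B j x = hopf_conn (w x) (M x) (e x) j" for j x
  have HcL1: "(\<lambda>n. LINT x|lborel. norm (Hc n x - H x)) \<longlonglongrightarrow> 0"
    unfolding Hc_def k_def by (rule conv_tendsto_L1[OF Hi \<delta>])
  have Hci: "integrable lborel (Hc n)" for n unfolding Hc_def k_def by (rule integrable_conv[OF \<delta>(1) Hi])
  have limH: "AE x in lborel. (\<lambda>n. Hc n x) \<longlonglongrightarrow> H x" using lims by eventually_elim simp
  have limA: "AE x in lborel. (\<lambda>n. A n j x) \<longlonglongrightarrow> B j x" for j
    using lims unfolding A_def B_def by eventually_elim (intro tendsto_hopf(1), auto)
  have limP: "AE x in lborel. (\<lambda>n. P n j l x) \<longlonglongrightarrow> 0" for j l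
    using lims orth[of j] orth[of l] w1
  proof eventually_elim
    case (elim x)
    have "(\<lambda>n. P n j l x) \<longlonglongrightarrow> hopf_curv (w x) (M x) (e x) (\<alpha> x) j l"
      unfolding P_def using elim by (intro tendsto_hopf(2)) auto
    also have "hopf_curv (w x) (M x) (e x) (\<alpha> x) j l = 0"
    proof (cases "x \<in> ball 0 1")
      case True
      then have "norm (w x) = 1" "w x \<bullet> M x $ j = 0" "w x \<bullet> M x $ l = 0" using elim by auto
      from limit_connection_flat[OF this, of "e x $ j" "e x $ l"]
      show ?thesis by (simp only: hopf_curv_def hopf_conn_def \<alpha>jl)
    next
      case False
      moreover have "\<alpha> x = 0"
        unfolding \<alpha>_def zero(1)[OF False] inner_zero_left by (simp add: vec_eq_iff)
      ultimately show ?thesis using zero by (simp add: hopf_conn_0)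
    qed
    finally show ?case .
  qed
  have limG: "AE x in lborel. (\<lambda>n. G n j x) \<longlonglongrightarrow> 0" for j
    using lims orth[of j] w1
  proof eventually_elim
    case (elim x)
    have "(\<lambda>n. G n j x) \<longlonglongrightarrow> hopf_par (w x) (M x) (e x) j"
      unfolding G_def using elim by (intro tendsto_hopf(3)[where N="\<lambda>_. 0" and N'=0]) auto
    also have "hopf_par (w x) (M x) (e x) j = 0"
    proof (cases "x \<in> ball 0 1")
      case True
      then have "norm (w x) = 1" "w x \<bullet> M x $ j = 0" using elim by auto
      from limit_connection_parallel[OF this, of "e x $ j"]
      show ?thesis by (simp only: hopf_par_def hopf_conn_def)
    qed (simp add: zero hopf_conn_0)
    finally show ?case .
  qed
  have mA: "A n j \<in> borel_measurable lborel" and mP: "P n j l \<in> borel_measurable lborel"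
    and mG: "G n j \<in> borel_measurable lborel" for n j l
    unfolding A_def P_def G_def using measurable_hopf[OF mc] by simp_all
  have mB: "B j \<in> borel_measurable borel" for j
    unfolding B_def by (rule measurable_hopf(1)[OF meas(1,2,3) meas(2)])
  have mB': "B j \<in> borel_measurable lborel" for j using mB by simp
  have bA: "AE x in lborel. norm (A n j x) \<le> 1 * Hc n x" for n j
    unfolding A_def by (rule AE_I2) (use bounds(1) in simp)
  have bP: "AE x in lborel. norm (P n j l x) \<le> 6 * Hc n x" for n j l
    unfolding P_def by (rule AE_I2) (rule bounds(2))
  have bG: "AE x in lborel. norm (G n j x) \<le> 3 * Hc n x" for n j
    unfolding G_def by (rule AE_I2) (rule bounds(3))
  have m0: "(\<lambda>_. 0::real^3) \<in> borel_measurable lborel" by simp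
  note L1A = L1_convergence_of_dominated[OF mA mB' Hci Hi limA limH HcL1 bA zero_le_one]
  note L1P' = L1_convergence_of_dominated[OF mP m0 Hci Hi limP limH HcL1 bP zero_le_numeral]
  note L1G' = L1_convergence_of_dominated[OF mG m0 Hci Hi limG limH HcL1 bG zero_le_numeral]
  note L1P = L1P'(2) L1P'(3)[unfolded diff_zero]
  note L1G = L1G'(2) L1G'(3)[unfolded diff_zero]

  \<comment> \<open>A subsequence with summable errors\<close>
  define T where "T n = (\<Sum>j\<in>UNIV. LINT x|lborel. norm (A n j x - B j x))
      + ((\<Sum>j\<in>UNIV. \<Sum>l\<in>UNIV. LINT x|lborel. norm (P n j l x)) + (\<Sum>j\<in>UNIV. LINT x|lborel. norm (G n j x)))" for n
  have "T \<longlonglongrightarrow> (\<Sum>j\<in>(UNIV::3 set). 0) + ((\<Sum>j\<in>(UNIV::3 set). \<Sum>l\<in>(UNIV::3 set). 0) + (\<Sum>j\<in>(UNIV::3 set). 0))"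
    unfolding T_def by (intro tendsto_add tendsto_sum L1A(3) L1P(2) L1G(2))
  then have "T \<longlonglongrightarrow> 0" by simp
  then obtain q where q: "strict_mono (q :: nat \<Rightarrow> nat)" "\<And>n. T (q n) < (1/2) ^ n"
    by (rule strict_mono_fast_subseq) (rule that)
  \<comment> \<open>The increments of the connection are measured between successive members of the
    subsequence. Passing through the limit \<open>B\<close> bounds the integral of
    \<open>K n\<close> by \<open>T (q (Suc n)) + T (q n)\<close>, which is summable.\<close>
  define K where "K n x = (\<Sum>j\<in>UNIV. norm (A (q (Suc n)) j x - A (q n) j x))
      + ((\<Sum>j\<in>UNIV. \<Sum>l\<in>UNIV. norm (P (q n) j l x)) + (\<Sum>j\<in>UNIV. norm (G (q n) j x)))" for n x
  have cA: "continuous_on UNIV (A n j)" and cP: "continuous_on UNIV (P n j l)" and cG: "continuous_on UNIV (G n j)" for n j l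
    unfolding A_def P_def G_def by (rule continuous_hopf[OF cont])+
  have Kc: "continuous_on UNIV (K n)" for n
    unfolding K_def by (intro continuous_intros cA cP cG)
  have Knn: "0 \<le> K n x" for n x unfolding K_def by (intro add_nonneg_nonneg sum_nonneg norm_ge_zero)
  have KA: "norm (A (q (Suc n)) j x - A (q n) j x) \<le> K n x" for n j x
  proof -
    have "norm (A (q (Suc n)) j x - A (q n) j x) \<le> (\<Sum>j\<in>UNIV. norm (A (q (Suc n)) j x - A (q n) j x))"
      by (rule member_le_sum) auto
    also have "\<dots> \<le> K n x" unfolding K_def by (simp add: add_nonneg_nonneg sum_nonneg)
    finally show ?thesis .
  qed
  have KP: "norm (P (q n) j l x) \<le> K n x" for n j l x
  proof -
    have "norm (P (q n) j l x) \<le> (\<Sum>l\<in>UNIV. norm (P (q n) j l x))" by (rule member_le_sum) auto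
    also have "\<dots> \<le> (\<Sum>j\<in>UNIV. \<Sum>l\<in>UNIV. norm (P (q n) j l x))"
      by (rule member_le_sum[of j UNIV "\<lambda>j. \<Sum>l\<in>UNIV. norm (P (q n) j l x)"]) (auto intro: sum_nonneg)
    also have "\<dots> \<le> K n x" unfolding K_def by (simp add: add_increasing add_increasing2 sum_nonneg)
    finally show ?thesis .
  qed
  have KG: "norm (G (q n) j x) \<le> K n x" for n j x
  proof -
    have "norm (G (q n) j x) \<le> (\<Sum>j\<in>UNIV. norm (G (q n) j x))" by (rule member_le_sum) auto
    also have "\<dots> \<le> K n x" unfolding K_def by (simp add: add_increasing sum_nonneg)
    finally show ?thesis .
  qed
  have iAA: "integrable lborel (\<lambda>x. norm (A (q (Suc n)) j x - A (q n) j x))" for n j using L1A(2) by simp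
  have iP: "integrable lborel (\<lambda>x. norm (P n j l x))" for n j l using L1P(1) by simp
  have iG: "integrable lborel (\<lambda>x. norm (G n j x))" for n j using L1G(1) by simp
  have Ki: "integrable lborel (K n)" for n
    unfolding K_def by (intro Bochner_Integration.integrable_add Bochner_Integration.integrable_sum iAA iP iG)
  have Kint: "(LINT x|lborel. K n x) \<le> 2 * (1/2) ^ n" for n
  proof -
    have "(LINT x|lborel. K n x) = (\<Sum>j\<in>UNIV. LINT x|lborel. norm (A (q (Suc n)) j x - A (q n) j x))
      + ((\<Sum>j\<in>UNIV. \<Sum>l\<in>UNIV. LINT x|lborel. norm (P (q n) j l x)) + (\<Sum>j\<in>UNIV. LINT x|lborel. norm (G (q n) j x)))"
      unfolding K_def
      by (simp only: Bochner_Integration.integral_add Bochner_Integration.integral_sum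
          Bochner_Integration.integrable_add Bochner_Integration.integrable_sum iAA iP iG)
    also have "(\<Sum>j\<in>UNIV. LINT x|lborel. norm (A (q (Suc n)) j x - A (q n) j x))
        \<le> (\<Sum>j\<in>UNIV. (LINT x|lborel. norm (A (q (Suc n)) j x - B j x)) + (LINT x|lborel. norm (A (q n) j x - B j x)))"
    proof (rule sum_mono)
      fix j
      have "(LINT x|lborel. norm (A (q (Suc n)) j x - A (q n) j x))
          \<le> (LINT x|lborel. norm (A (q (Suc n)) j x - B j x) + norm (A (q n) j x - B j x))"
      proof (rule integral_mono[OF iAA])
        show "integrable lborel (\<lambda>x. norm (A (q (Suc n)) j x - B j x) + norm (A (q n) j x - B j x))" using L1A by simp
        show "norm (A (q (Suc n)) j x - A (q n) j x) \<le> norm (A (q (Suc n)) j x - B j x) + norm (A (q n) j x - B j x)" for x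
          using norm_triangle_ineq4[of "A (q (Suc n)) j x - B j x" "A (q n) j x - B j x"] by simp
      qed
      also have "\<dots> = (LINT x|lborel. norm (A (q (Suc n)) j x - B j x)) + (LINT x|lborel. norm (A (q n) j x - B j x))"
        using L1A by simp
      finally show "(LINT x|lborel. norm (A (q (Suc n)) j x - A (q n) j x)) \<le> \<dots>" .
    qed
    also have "\<dots> = (\<Sum>j\<in>UNIV. LINT x|lborel. norm (A (q (Suc n)) j x - B j x)) + (\<Sum>j\<in>UNIV. LINT x|lborel. norm (A (q n) j x - B j x))"
      by (rule sum.distrib)
    also have "(\<Sum>j\<in>UNIV. LINT x|lborel. norm (A (q (Suc n)) j x - B j x)) \<le> T (q (Suc n))"
      unfolding T_def by (simp add: add_nonneg_nonneg sum_nonneg Bochner_Integration.integral_nonneg)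
    finally have "(LINT x|lborel. K n x) \<le> T (q (Suc n)) + T (q n)"
      unfolding T_def[of "q n"] by linarith
    also have "\<dots> \<le> (1/2) ^ Suc n + (1/2) ^ n" using q(2)[of n] q(2)[of "Suc n"] by linarith
    also have "\<dots> \<le> 2 * (1/2) ^ n" by simp
    finally show ?thesis .
  qed
  have Ksum: "(\<Sum>n. \<integral>\<^sup>+x. ennreal (K n x) * indicator (ball 0 1) x \<partial>lborel) < \<infinity>"
  proof -
    have "(\<integral>\<^sup>+x. ennreal (K n x) * indicator (ball 0 1) x \<partial>lborel) \<le> ennreal (2 * (1/2) ^ n)" for n
    proof -
      have "(\<integral>\<^sup>+x. ennreal (K n x) * indicator (ball 0 1) x \<partial>lborel) \<le> (\<integral>\<^sup>+x. ennreal (K n x) \<partial>lborel)"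
        by (rule nn_integral_mono) (simp add: indicator_def)
      also have "\<dots> = ennreal (LINT x|lborel. K n x)"
        using Ki Knn by (intro nn_integral_eq_integral) auto
      also have "\<dots> \<le> ennreal (2 * (1/2) ^ n)" by (rule ennreal_leI[OF Kint])
      finally show ?thesis .
    qed
    then have "(\<Sum>n. \<integral>\<^sup>+x. ennreal (K n x) * indicator (ball 0 1) x \<partial>lborel) \<le> (\<Sum>n. ennreal (2 * (1/2) ^ n))"
      by (intro suminf_le) auto
    also have "\<dots> = ennreal (\<Sum>n. 2 * (1/2) ^ n)"
      by (rule suminf_ennreal2) (auto intro!: summable_mult summable_geometric)
    also have "\<dots> < \<infinity>" by simp
    finally show ?thesis .
  qed

  \<comment> \<open>Structure equations away from the boundary\<close>
  define dw where "dw n x h = conv w (pderiv_at (k n) h) x" for n x h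
  define dM where "dM n x h = conv M (pderiv_at (k n) h) x" for n x h
  define de where "de n x h = conv e (pderiv_at (k n) h) x" for n x h
  \<comment> \<open>The order of factors is that of the product rule
    \<open>quad_diff_bilinear\<close>, and the difference in \<open>hopf_conn\<close> appears as a
    sum with scalar \<open>- (1/2)\<close> to match \<open>quad_diff_add\<close>.\<close>
  define DA where "DA n j x h = (1/2) *\<^sub>R (cross3 (wc n x) (dM n x h $ j) + cross3 (dw n x h) (Mc n x $ j))
      + (- (1/2)) *\<^sub>R ((ec n x $ j) *\<^sub>R dw n x h + (de n x h $ j) *\<^sub>R wc n x)" for n j x h
  have qA: "quad_diff (A n j) (DA n j)" for n j
  proof -
    have "quad_diff (\<lambda>x. (1/2) *\<^sub>R cross3 (wc n x) (Mc n x $ j) + (- (1/2)) *\<^sub>R (ec n x $ j *\<^sub>R wc n x)) (DA n j)"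
      unfolding DA_def dw_def dM_def de_def
      by (intro quad_diff_add quad_diff_bounded_linear[OF bounded_linear_scaleR_right]
          quad_diff_bilinear[OF bounded_bilinear_cross3] quad_diff_bilinear[OF bounded_bilinear_scaleR]
          quad_diff_bounded_linear[OF bounded_linear_vec_nth] qw qM qe)
    then show ?thesis by (simp add: A_def[abs_def] hopf_conn_def)
  qed
  have good: "cball x (\<delta> n) \<subseteq> ball 0 1" if "norm x < 1 - \<delta> n" for n x
    using that by (rule mollifier_radius)
  have dwM: "dw n x (axis j 1) = Mc n x $ j" if "norm x < 1 - \<delta> n" for n x j
  proof -
    have "dw n x (axis j 1) = conv (\<lambda>x. M x $ j) (k n) x"
      unfolding dw_def by (rule conv_weak_derivative[OF weak k good[OF that]])
    also have "\<dots> = Mc n x $ j"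
      unfolding Mc_def by (rule conv_bounded_linear[OF k Mi bounded_linear_vec_nth, symmetric])
    finally show ?thesis .
  qed
  \<comment> \<open>Both sides are convolutions of \<open>w\<close> with a mixed second derivative
    of the mollifier; one derivative is moved from the kernel to \<open>w\<close> and back.\<close>
  have dMsym: "dM n x (axis l 1) $ j = dM n x (axis j 1) $ l" if "norm x < 1 - \<delta> n" for n x j l
  proof -
    have "dM n x (axis l 1) $ j = conv w (pderiv_at (pderiv_at (k n) (axis l 1)) (axis j 1)) x" for j l
    proof -
      have kd: "smooth_kernel (\<delta> n) (pderiv_at (k n) (axis l 1))" by (rule kernel_pderiv[OF k])
      have "dM n x (axis l 1) $ j = conv (\<lambda>x. M x $ j) (pderiv_at (k n) (axis l 1)) x"
        unfolding dM_def by (rule conv_bounded_linear[OF kd Mi bounded_linear_vec_nth])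
      also have "\<dots> = conv w (pderiv_at (pderiv_at (k n) (axis l 1)) (axis j 1)) x"
        by (rule conv_weak_derivative[OF weak kd good[OF that], symmetric])
      finally show ?thesis .
    qed
    moreover have "pderiv_at (pderiv_at (k n) (axis l 1)) (axis j 1) = pderiv_at (pderiv_at (k n) (axis j 1)) (axis l 1)"
      unfolding k_def by (rule ext) (rule pderiv_mollifier_commute[OF \<delta>(1)])
    ultimately show ?thesis by simp
  qed
  have dea: "de n x (axis l 1) $ j - de n x (axis j 1) $ l = ac n x $ l $ j" if "norm x < 1 - \<delta> n" for n x j l
  proof -
    have c1: "de n x (axis l 1) $ j = conv (\<lambda>x. e x $ j) (pderiv_at (k n) (axis l 1)) x" for j l
      unfolding de_def by (rule conv_bounded_linear[OF kernel_pderiv[OF k] ei bounded_linear_vec_nth])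
    have c2: "ac n x $ l $ j = conv (\<lambda>x. \<alpha> x $ l $ j) (k n) x"
      unfolding ac_def
      by (rule conv_bounded_linear[OF k \<alpha>i bounded_linear_compose[OF bounded_linear_vec_nth bounded_linear_vec_nth]])
    show ?thesis
      unfolding c1 c2
      by (rule conv_exterior_derivative[OF dist[folded \<alpha>_def] \<alpha>anti ei k good[OF that]])
  qed
  \<comment> \<open>Symmetry of \<open>dM\<close> cancels the terms \<open>cross3 (wc n x)\<close>,
    the two products of first derivatives are opposite and merge into one, and the derivatives of
    \<open>e\<close> occur only in the combination equal to \<open>ac\<close>.\<close>
  have curv: "DA n j x (axis l 1) - DA n l x (axis j 1) - 2 *\<^sub>R cross3 (A n l x) (A n j x) = P n j l x"
    if x: "norm x < 1 - \<delta> n" for n x j l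
  proof -
    have s: "cross3 (Mc n x $ j) (Mc n x $ l) = - cross3 (Mc n x $ l) (Mc n x $ j)" by (rule cross_skew)
    have a: "ac n x $ l $ j = de n x (axis l 1) $ j - de n x (axis j 1) $ l" using dea[OF x] by simp
    show ?thesis
      unfolding DA_def P_def hopf_curv_def A_def[symmetric] dwM[OF x] dMsym[OF x, of l j] s a
      by (simp add: vec_eq_iff field_simps)
  qed
  have par: "dw n x (axis j 1) - 2 *\<^sub>R cross3 (A n j x) (wc n x) = G n j x"
    if x: "norm x < 1 - \<delta> n" for n x j
    unfolding dwM[OF x] G_def hopf_par_def A_def ..

  \<comment> \<open>Passage to the limit\<close>
  have \<delta>q: "(\<lambda>n. \<delta> (q n)) \<longlonglongrightarrow> 0" using LIMSEQ_subseq_LIMSEQ[OF \<delta>(2) q(1)] by (simp add: o_def)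
  let ?i = "basis_index :: real^3 \<Rightarrow> 3"
  obtain v where v: "v \<in> borel_measurable borel" "\<And>x. norm (v x) \<le> 1"
    "AE x in lborel. norm x < 1 \<longrightarrow> norm (v x) = 1 \<and> hopf3 (v x) = w x"
    "\<And>\<phi> b. test_function (ball 0 1) \<phi> \<Longrightarrow> b \<in> Basis \<Longrightarrow>
      (LINT x|lborel. pderiv_at \<phi> b x *\<^sub>R v x) = - (LINT x|lborel. \<phi> x *\<^sub>R spin (B (?i b) x) (v x))"
  proof (rule flat_connection_limit[where A="\<lambda>n b. A (q n) (?i b)" and DA="\<lambda>n b. DA (q n) (?i b)"
        and U="\<lambda>n. wc (q n)" and DU="\<lambda>n. dw (q n)" and K=K and R="\<lambda>n. 1 - \<delta> (q n)" and u=w and B="\<lambda>b. B (?i b)"])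
    show "quad_diff (A (q n) (?i b)) (DA (q n) (?i b))" for n b by (rule qA)
    show "quad_diff (wc (q n)) (dw (q n))" for n using qw[of "q n"] by (simp add: dw_def[abs_def])
    show "continuous_on UNIV (K n)" "0 \<le> K n x" for n x by (rule Kc, rule Knn)
    show "norm (A (q (Suc n)) (?i b) x - A (q n) (?i b) x) \<le> K n x" for n b x by (rule KA)
    show "norm (DA (q n) (?i b) x c - DA (q n) (?i c) x b - 2 *\<^sub>R cross3 (A (q n) (?i c) x) (A (q n) (?i b) x)) \<le> K n x"
      if h: "b \<in> Basis" "c \<in> Basis" "norm x < 1 - \<delta> (q n)" for n b c x
    proof -
      obtain j l where "b = axis j 1" "c = axis l 1" using h(1,2) by (auto simp: Basis_real_vec)
      then show ?thesis using KP[of n j l x] curv[OF h(3), of j l] by (simp add: basis_index_axis)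
    qed
    show "norm (dw (q n) x b - 2 *\<^sub>R cross3 (A (q n) (?i b) x) (wc (q n) x)) \<le> K n x"
      if h: "b \<in> Basis" "norm x < 1 - \<delta> (q n)" for n b x
    proof -
      obtain j where "b = axis j 1" using h(1) by (auto simp: Basis_real_vec)
      then show ?thesis using KG[of n j x] par[OF h(2), of j] by (simp add: basis_index_axis)
    qed
    show "(\<Sum>n. \<integral>\<^sup>+x. ennreal (K n x) * indicator (ball 0 1) x \<partial>lborel) < \<infinity>" by (rule Ksum)
    show "(\<lambda>n. 1 - \<delta> (q n)) \<longlonglongrightarrow> 1" using tendsto_diff[OF tendsto_const[of 1] \<delta>q] by simp
    show "AE x in lborel. norm x < 1 \<longrightarrow> (\<lambda>n. wc (q n) x) \<longlonglongrightarrow> w x \<and> norm (w x) = 1"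
      using lims w1
    proof eventually_elim
      case (elim x)
      have "(\<lambda>n. wc n x) \<longlonglongrightarrow> w x" using elim by simp
      from LIMSEQ_subseq_LIMSEQ[OF this q(1)] show ?case using elim by (simp add: o_def)
    qed
    show "B (?i b) \<in> borel_measurable borel" for b by (rule mB)
    show "integrable lborel (B (?i b))" for b by (rule L1A(1))
    have iAB: "integrable lborel (\<lambda>x. norm (A n j x - B j x))" for n j using L1A by simp
    show iAB': "integrable lborel (\<lambda>x. indicator (ball 0 1) x * norm (A (q n) (?i b) x - B (?i b) x))" for n b
      using integrable_mult_indicator[OF _ iAB, of "ball 0 1" "q n" "?i b"] by simp
    show "(\<lambda>n. LINT x|lborel. indicator (ball 0 1) x * norm (A (q n) (?i b) x - B (?i b) x)) \<longlonglongrightarrow> 0" for b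
    proof (rule tendsto_sandwich[OF _ _ tendsto_const])
      show "(\<lambda>n. LINT x|lborel. norm (A (q n) (?i b) x - B (?i b) x)) \<longlonglongrightarrow> 0"
        using LIMSEQ_subseq_LIMSEQ[OF L1A(3) q(1)] by (simp add: o_def)
      show "\<forall>\<^sub>F n in sequentially. 0 \<le> (LINT x|lborel. indicator (ball 0 1) x * norm (A (q n) (?i b) x - B (?i b) x))"
        by (intro always_eventually allI Bochner_Integration.integral_nonneg) simp
      show "\<forall>\<^sub>F n in sequentially. (LINT x|lborel. indicator (ball 0 1) x * norm (A (q n) (?i b) x - B (?i b) x))
          \<le> (LINT x|lborel. norm (A (q n) (?i b) x - B (?i b) x))"
        by (intro always_eventually allI integral_mono iAB iAB') (simp add: indicator_def)
    qed
  qed (rule that)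
  show ?thesis
  proof (rule that[OF v(1-3)])
    fix \<phi> :: "real^3 \<Rightarrow> real" and j :: 3 assume \<phi>: "test_function (ball 0 1) \<phi>"
    have "axis j (1::real) \<in> Basis" by (auto simp: Basis_real_vec)
    from v(4)[OF \<phi> this] show "(LINT x|lborel. pderiv_at \<phi> (axis j 1) x *\<^sub>R v x)
        = - (LINT x|lborel. \<phi> x *\<^sub>R spin (hopf_conn (w x) (M x) (e x) j) (v x))"
      by (simp add: basis_index_axis B_def)
  qed
qed

lemma Ck_bounded_linear:
  assumes "bounded_linear T"
  shows "Ck k f \<Longrightarrow> Ck k (\<lambda>x. T (f x))"
proof (induction k arbitrary: f)
  case 0
  then show ?case using bounded_linear.continuous_on[OF assms] by simp
next
  case (Suc k)
  have d: "((\<lambda>x. T (f x)) has_derivative (\<lambda>h. T (frechet_derivative f (at x) h))) (at x)" for x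
    using Suc.prems by (intro bounded_linear.has_derivative[OF assms]) (simp add: frechet_derivative_works)
  have "frechet_derivative (\<lambda>x. T (f x)) (at x) = (\<lambda>h. T (frechet_derivative f (at x) h))" for x
    by (rule frechet_derivative_at[OF d, symmetric])
  moreover have "(\<lambda>x. T (f x)) differentiable (at x)" for x using d by (rule differentiableI)
  ultimately show ?case using Suc.IH Suc.prems by simp
qed

text \<open>Applied to coordinate projections: the coefficients of a test 1-form are scalar test
  functions.\<close>

lemma test_function_bounded_linear:
  assumes T: "bounded_linear T" and \<phi>: "test_function \<Omega> \<phi>"
  shows "test_function \<Omega> (\<lambda>x. T (\<phi> x))"
proof -
  have "{x. T (\<phi> x) \<noteq> 0} \<subseteq> {x. \<phi> x \<noteq> 0}"
    using linear_0[OF bounded_linear.linear[OF T]] by auto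
  then have sub: "closure {x. T (\<phi> x) \<noteq> 0} \<subseteq> closure {x. \<phi> x \<noteq> 0}" by (rule closure_mono)
  have "bounded (closure {x. T (\<phi> x) \<noteq> 0})"
    using \<phi> bounded_subset[OF compact_imp_bounded sub] by (simp add: test_function_def)
  then have "compact (closure {x. T (\<phi> x) \<noteq> 0})" by (simp add: compact_eq_bounded_closed)
  moreover have "closure {x. T (\<phi> x) \<noteq> 0} \<subseteq> \<Omega>" using sub \<phi> by (auto simp: test_function_def)
  moreover have "smooth (\<lambda>x. T (\<phi> x))" using \<phi> unfolding test_function_def smooth_def by (blast intro: Ck_bounded_linear[OF T])
  ultimately show ?thesis by (simp add: test_function_def)
qed

lemma omega_S2_eq_triple: "omega_S2 p v w = p \<bullet> cross3 v w"
  by (simp add: omega_S2_def inner_vec_def sum_3 cross_components algebra_simps)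

lemma measurable_vec_nth: "f \<in> borel_measurable borel \<Longrightarrow> (\<lambda>x. f x $ i) \<in> borel_measurable borel"
  for f :: "'a::euclidean_space \<Rightarrow> 'b::euclidean_space^'n"
  by (erule measurable_compose) (intro borel_measurable_continuous_onI linear_continuous_on bounded_linear_vec_nth)

lemma L2_on_bounded_by:
  fixes f :: "'a::euclidean_space \<Rightarrow> 'b::euclidean_space"
  assumes f: "f \<in> borel_measurable borel" and \<Omega>: "\<Omega> \<in> sets borel" and g: "integrable lborel g"
    and le: "AE x in lborel. x \<in> \<Omega> \<longrightarrow> (norm (f x))\<^sup>2 \<le> g x"
  shows "L2_on \<Omega> f"
proof -
  have [measurable]: "f \<in> borel_measurable borel" "\<Omega> \<in> sets borel" by fact+
  have "(\<lambda>x. indicator \<Omega> x *\<^sub>R f x) \<in> borel_measurable lebesgue"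
    by (rule lebesgue_measurable_AE_eq[of "\<lambda>x. indicator \<Omega> x *\<^sub>R f x"]) auto
  moreover have "integrable lborel (\<lambda>x. indicator \<Omega> x *\<^sub>R (norm (f x))\<^sup>2)"
    by (rule Bochner_Integration.integrable_bound[OF g]) (use le in \<open>auto elim!: eventually_mono simp: indicator_def\<close>)
  then have "set_integrable lebesgue \<Omega> (\<lambda>x. (norm (f x))\<^sup>2)"
    by (subst set_integral_lebesgue_eq(2)[of "\<lambda>x. indicator \<Omega> x *\<^sub>R (norm (f x))\<^sup>2"]) auto
  ultimately show ?thesis by (simp add: L2_on_def set_borel_measurable_def)
qed

lemma set_integrable_lebesgue_of_integrable:
  fixes f :: "'a::euclidean_space \<Rightarrow> 'b::euclidean_space"
  assumes f: "f \<in> borel_measurable borel" and K: "K \<in> sets borel" and g: "integrable lborel g"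
    and le: "AE x in lborel. x \<in> K \<longrightarrow> norm (f x) \<le> g x"
  shows "set_integrable lebesgue K f"
proof -
  have [measurable]: "f \<in> borel_measurable borel" "K \<in> sets borel" by fact+
  have "integrable lborel (\<lambda>x. indicator K x *\<^sub>R f x)"
    by (rule Bochner_Integration.integrable_bound[OF g]) (use le in \<open>auto elim!: eventually_mono simp: indicator_def\<close>)
  then show ?thesis
    by (subst set_integral_lebesgue_eq(2)[of "\<lambda>x. indicator K x *\<^sub>R f x"]) auto
qed

theorem theorem1p1:
  fixes u :: "real^3 \<Rightarrow> real^3"
  assumes "W12_sphere B3 u"
    and "\<exists>\<eta>::form1. L2_on B3 \<eta> \<and> distrib_ext_deriv B3 \<eta> (pullback_omega_S2 B3 u)"
  shows "\<exists>u_hat :: real^3 \<Rightarrow> complex \<times> complex. W12_sphere B3 u_hat \<and>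
           (AE x in lebesgue. x \<in> B3 \<longrightarrow> u x = CR_to_R3 (hopf (u_hat x)))"
proof -
  obtain \<eta> :: form1 where \<eta>: "L2_on B3 \<eta>" "distrib_ext_deriv B3 \<eta> (pullback_omega_S2 B3 u)"
    using assms(2) by blast
  have uL: "L2_on B3 u" and uS: "AE x in lebesgue. x \<in> B3 \<longrightarrow> u x \<in> sphere 0 1"
    using assms(1) by (simp_all add: W12_sphere_def W12_def)
  have ax: "axis j (1::real) \<in> (Basis :: (real^3) set)" for j by (auto simp: Basis_real_vec)
  have Bb: "B3 \<in> sets borel" by simp
  have fin: "emeasure lborel B3 < \<infinity>" using emeasure_lborel_ball_finite by simp
  have "\<forall>j. \<exists>v. has_weak_pderiv B3 (axis j 1) u v \<and> L2_on B3 v"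
    using assms(1) ax by (auto simp: W12_sphere_def W12_def)
  then obtain V where V: "\<And>j. has_weak_pderiv B3 (axis j 1) u (V j)" "\<And>j. L2_on B3 (V j)" by metis

  \<comment> \<open>Borel representatives of the Sobolev data\<close>
  obtain w where w: "w \<in> borel_measurable borel" "AE x in lborel. indicator B3 x *\<^sub>R u x = w x" "\<And>x. x \<notin> B3 \<Longrightarrow> w x = 0"
    "integrable lborel (\<lambda>x. (norm (w x))\<^sup>2)"
    by (rule L2_on_representative[OF uL Bb]) (rule that)
  obtain e where e: "e \<in> borel_measurable borel" "AE x in lborel. indicator B3 x *\<^sub>R \<eta> x = e x" "\<And>x. x \<notin> B3 \<Longrightarrow> e x = 0"
    "integrable lborel (\<lambda>x. (norm (e x))\<^sup>2)"
    by (rule L2_on_representative[OF \<eta>(1) Bb]) (rule that)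
  have "\<forall>j. \<exists>g. g \<in> borel_measurable borel \<and> (AE x in lborel. indicator B3 x *\<^sub>R V j x = g x) \<and> (\<forall>x. x \<notin> B3 \<longrightarrow> g x = 0)
      \<and> integrable lborel (\<lambda>x. (norm (g x))\<^sup>2)"
  proof
    fix j
    obtain g where g: "g \<in> borel_measurable borel" "AE x in lborel. indicator B3 x *\<^sub>R V j x = g x"
      "\<And>x. x \<notin> B3 \<Longrightarrow> g x = 0" "integrable lborel (\<lambda>x. (norm (g x))\<^sup>2)"
      by (rule L2_on_representative[OF V(2) Bb]) (rule that)
    show "\<exists>g. g \<in> borel_measurable borel \<and> (AE x in lborel. indicator B3 x *\<^sub>R V j x = g x) \<and> (\<forall>x. x \<notin> B3 \<longrightarrow> g x = 0)
      \<and> integrable lborel (\<lambda>x. (norm (g x))\<^sup>2)"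
      by (intro exI[of _ g] conjI allI impI g)
  qed
  from choice[OF this] obtain m where "\<forall>j. m j \<in> borel_measurable borel \<and> (AE x in lborel. indicator B3 x *\<^sub>R V j x = m j x)
      \<and> (\<forall>x. x \<notin> B3 \<longrightarrow> m j x = 0) \<and> integrable lborel (\<lambda>x. (norm (m j x))\<^sup>2)" ..
  then have m: "\<And>j. m j \<in> borel_measurable borel" "\<And>j. AE x in lborel. indicator B3 x *\<^sub>R V j x = m j x"
    "\<And>j x. x \<notin> B3 \<Longrightarrow> m j x = 0" "\<And>j. integrable lborel (\<lambda>x. (norm (m j x))\<^sup>2)" by simp_all
  \<comment> \<open>Row \<open>j\<close> is the \<open>j\<close>-th weak derivative of
    \<open>u\<close>.\<close>
  define M :: "real^3 \<Rightarrow> real^3^3" where "M x = (\<chi> j. m j x)" for x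
  have Mj: "M x $ j = m j x" for x j by (simp add: M_def)
  have Mm: "M \<in> borel_measurable borel"
  proof -
    have "M = (\<lambda>x. \<Sum>j\<in>UNIV. axis j (m j x))"
      by (simp add: fun_eq_iff vec_eq_iff Mj axis_def)
    moreover have "(\<lambda>x. axis j (m j x) :: real^3^3) \<in> borel_measurable borel" for j
    proof -
      have "continuous_on UNIV (\<lambda>y. axis j y :: real^3^3)"
        unfolding axis_def
      proof (rule continuous_on_vec_lambda)
        show "continuous_on UNIV (\<lambda>y. if i = j then y else 0 :: real^3)" for i
          by (cases "i = j") (simp_all add: continuous_on_id)
      qed
      from measurable_compose[OF m(1) borel_measurable_continuous_onI[OF this]] show ?thesis .
    qed
    ultimately show ?thesis by simp
  qed
  note [measurable] = w(1) e(1) Mm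
  have w1: "AE x in lborel. norm (w x) = indicator B3 x"
    using w(2) uS[unfolded AE_completion_iff]
  proof eventually_elim
    case (elim x)
    then show ?case by (auto simp: indicator_def w(3) split: if_splits)
  qed
  have M0: "M x = 0" if "x \<notin> B3" for x using m(3)[OF that] by (simp add: vec_eq_iff[of "M x"] Mj)
  have M2: "integrable lborel (\<lambda>x. (norm (M x))\<^sup>2)"
    unfolding sum_vec_norm_square Mj by (intro Bochner_Integration.integrable_sum m(4))
  have weak: "(LINT x|lborel. pderiv_at \<phi> (axis j 1) x *\<^sub>R w x) = - (LINT x|lborel. \<phi> x *\<^sub>R (M x $ j))"
    if "test_function B3 \<phi>" for j \<phi>
    unfolding Mj by (rule has_weak_pderiv_representative[OF V(1) that ax w(1,2) m(1,2)])
  \<comment> \<open>Uniqueness of weak derivatives replaces the arbitrary choice inside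
    \<open>pullback_omega_S2\<close> by the square integrable derivatives in
    \<open>M\<close>.\<close>
  have pull: "AE x in lborel. x \<in> B3 \<longrightarrow> pullback_omega_S2 B3 u x = (\<chi> j l. w x \<bullet> cross3 (M x $ j) (M x $ l))"
  proof -
    have "AE x in lborel. \<forall>j\<in>(UNIV::3 set). x \<in> B3 \<longrightarrow> V j x = weak_pderiv B3 (axis j 1) u x"
    proof (rule AE_finite_allI)
      fix j :: 3
      have "has_weak_pderiv B3 (axis j 1) u (weak_pderiv B3 (axis j 1) u)"
        unfolding weak_pderiv_def by (rule someI[of "has_weak_pderiv B3 (axis j 1) u", OF V(1)])
      then show "AE x in lborel. x \<in> B3 \<longrightarrow> V j x = weak_pderiv B3 (axis j 1) u x"
        by (rule weak_pderiv_unique[OF V(1) _ ax])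
    qed simp
    moreover have "AE x in lborel. \<forall>j\<in>(UNIV::3 set). indicator B3 x *\<^sub>R V j x = m j x"
      by (rule AE_finite_allI) (use m(2) in auto)
    ultimately show ?thesis
      using w(2)
    proof eventually_elim
      case (elim x)
      show ?case
      proof
        assume x: "x \<in> B3"
        have "weak_pderiv B3 (axis j 1) u x = m j x" for j using elim x by (metis UNIV_I indicator_simps(1) scaleR_one)
        moreover have "u x = w x" using elim x by simp
        ultimately show "pullback_omega_S2 B3 u x = (\<chi> j l. w x \<bullet> cross3 (M x $ j) (M x $ l))"
          by (simp add: pullback_omega_S2_def omega_S2_eq_triple Mj)
      qed
    qed
  qed
  have dist: "(LINT x|lborel. wedge12 e (ext_deriv \<phi>) x)
        = (LINT x|lborel. wedge21 (\<lambda>x. \<chi> j l. w x \<bullet> cross3 (M x $ j) (M x $ l)) \<phi> x)"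
    if \<phi>: "test_function B3 \<phi>" for \<phi> :: form1
  proof -
    \<comment> \<open>Coefficientwise test functions make the entries of
      \<open>ext_deriv \<phi>\<close> Borel, so that the integrals can be moved to
      \<open>lborel\<close>.\<close>
    have \<phi>l: "test_function B3 (\<lambda>x. \<phi> x $ l)" for l
      by (rule test_function_bounded_linear[OF bounded_linear_vec_nth \<phi>])
    note [measurable] = test_function_measurable(1)[OF \<phi>l] test_function_measurable(2)[OF \<phi>l ax]
    have [measurable]: "(\<lambda>x. ext_deriv \<phi> x $ j $ l) \<in> borel_measurable borel" for j l
      unfolding ext_deriv_def vec_lambda_beta by measurable
    have [measurable]: "(\<lambda>x. e x $ i) \<in> borel_measurable borel" "(\<lambda>x. M x $ i) \<in> borel_measurable borel" for i
      by (rule measurable_vec_nth, fact)+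
    have [measurable]: "(\<lambda>x. cross3 (M x $ j) (M x $ l)) \<in> borel_measurable borel" for j l
    proof -
      have "continuous_on UNIV (\<lambda>q::(real^3) \<times> (real^3). cross3 (fst q) (snd q))"
        by (intro continuous_on_cross continuous_intros)
      from measurable_compose[OF borel_measurable_Pair borel_measurable_continuous_onI[OF this],
          of "\<lambda>x. M x $ j" borel "\<lambda>x. M x $ l"] show ?thesis by simp
    qed
    have "(LINT x:B3|lebesgue. wedge12 \<eta> (ext_deriv \<phi>) x) = (LINT x|lborel. wedge12 e (ext_deriv \<phi>) x)"
    proof (rule set_integral_lebesgue_eq(1))
      show "wedge12 e (ext_deriv \<phi>) \<in> borel_measurable borel" unfolding wedge12_def[abs_def] by measurable
      show "AE x in lborel. indicator B3 x *\<^sub>R wedge12 \<eta> (ext_deriv \<phi>) x = wedge12 e (ext_deriv \<phi>) x"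
        using e(2)
      proof eventually_elim
        case (elim x)
        then show ?case using e(3)[of x] by (cases "x \<in> B3") (simp_all add: wedge12_def)
      qed
    qed
    moreover have "(LINT x:B3|lebesgue. wedge21 (pullback_omega_S2 B3 u) \<phi> x)
        = (LINT x|lborel. wedge21 (\<lambda>x. \<chi> j l. w x \<bullet> cross3 (M x $ j) (M x $ l)) \<phi> x)"
    proof (rule set_integral_lebesgue_eq(1))
      show "wedge21 (\<lambda>x. \<chi> j l. w x \<bullet> cross3 (M x $ j) (M x $ l)) \<phi> \<in> borel_measurable borel"
        unfolding wedge21_def[abs_def] vec_lambda_beta by measurable
      show "AE x in lborel. indicator B3 x *\<^sub>R wedge21 (pullback_omega_S2 B3 u) \<phi> x
          = wedge21 (\<lambda>x. \<chi> j l. w x \<bullet> cross3 (M x $ j) (M x $ l)) \<phi> x"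
        using pull
      proof eventually_elim
        case (elim x)
        then show ?case using w(3)[of x] by (cases "x \<in> B3") (simp_all add: wedge21_def)
      qed
    qed
    ultimately show ?thesis using \<eta>(2) \<phi> by (simp add: distrib_ext_deriv_def)
  qed
  obtain v where v: "v \<in> borel_measurable borel" "\<And>x. norm (v x) \<le> 1"
    "AE x in lborel. norm x < 1 \<longrightarrow> norm (v x) = 1 \<and> hopf3 (v x) = w x"
    "\<And>\<phi> j. test_function B3 \<phi> \<Longrightarrow>
      (LINT x|lborel. pderiv_at \<phi> (axis j 1) x *\<^sub>R v x)
        = - (LINT x|lborel. \<phi> x *\<^sub>R spin (hopf_conn (w x) (M x) (e x) j) (v x))"
    by (rule hopf_lift_of_representatives[OF weak dist w(1) Mm e(1) w1 w(3) M0 e(3) M2 e(4)]) (assumption | rule that)+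
  note [measurable] = v(1)

  \<comment> \<open>Sobolev regularity of the lift\<close>
  have Mi: "integrable lborel M" by (rule integrable_of_square[OF Mm Bb fin M0 M2])
  have ei: "integrable lborel e" by (rule integrable_of_square[OF e(1) Bb fin e(3) e(4)])
  \<comment> \<open>The parallel equation gives the weak derivative of \<open>v\<close> explicitly.
    As \<open>norm (v x) \<le> 1\<close>, its size is at most that of the connection, which is where
    the L^2 bound on \<open>\<eta>\<close> enters the regularity of the lift.\<close>
  define d where "d j x = spin (hopf_conn (w x) (M x) (e x) j) (v x)" for j x
  have dm [measurable]: "d j \<in> borel_measurable borel" for j
    unfolding d_def[abs_def] by (intro measurable_spin measurable_hopf(1)[OF w(1) Mm e(1) Mm] v(1))
  have dle: "AE x in lborel. norm (d j x) \<le> (1/2) * norm (M x) + (1/2) * norm (e x)" for j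
    using w1
  proof eventually_elim
    case (elim x)
    then have "norm (w x) \<le> 1" by (simp add: indicator_def)
    then have c: "norm (hopf_conn (w x) (M x) (e x) j) \<le> (1/2) * norm (M x) + (1/2) * norm (e x)"
      by (rule norm_hopf_conn_le)
    have "norm (d j x) \<le> norm (hopf_conn (w x) (M x) (e x) j) * 1"
      unfolding d_def norm_spin by (rule mult_left_mono[OF v(2)]) simp
    with c show ?case by simp
  qed
  have ind1: "integrable lborel (indicator B3 :: real^3 \<Rightarrow> real)" using fin by (intro integrable_real_indicator) auto
  have vloc: "v locally_integrable_on B3"
    unfolding locally_integrable_on_def
  proof (intro allI impI)
    fix K assume K: "compact K \<and> K \<subseteq> B3"
    show "set_integrable lebesgue K v"
      by (rule set_integrable_lebesgue_of_integrable[OF v(1) _ ind1])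
        (use K v(2) in \<open>auto intro!: AE_I2 simp: borel_compact indicator_def\<close>)
  qed
  have dloc: "d j locally_integrable_on B3" for j
    unfolding locally_integrable_on_def
  proof (intro allI impI)
    fix K assume K: "compact K \<and> K \<subseteq> B3"
    have g: "integrable lborel (\<lambda>x. (1/2) * norm (M x) + (1/2) * norm (e x))" using Mi ei by simp
    show "set_integrable lebesgue K (d j)"
      by (rule set_integrable_lebesgue_of_integrable[OF dm _ g])
        (use K dle[of j] in \<open>auto elim!: eventually_mono simp: borel_compact\<close>)
  qed
  have wv: "has_weak_pderiv B3 (axis j 1) v (d j)" for j
    unfolding has_weak_pderiv_def
  proof (intro conjI allI impI vloc dloc)
    fix \<phi> :: "real^3 \<Rightarrow> real" assume \<phi>: "test_function B3 \<phi>"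
    note [measurable] = test_function_measurable(1)[OF \<phi>] test_function_measurable(2)[OF \<phi> ax]
    have "(LINT x:B3|lebesgue. pderiv_at \<phi> (axis j 1) x *\<^sub>R v x) = (LINT x|lborel. pderiv_at \<phi> (axis j 1) x *\<^sub>R v x)"
    proof (rule set_integral_lebesgue_eq(1))
      have "indicator B3 x *\<^sub>R (pderiv_at \<phi> (axis j 1) x *\<^sub>R v x) = pderiv_at \<phi> (axis j 1) x *\<^sub>R v x" for x
        by (cases "x \<in> B3") (simp_all add: pderiv_eq_0_outside[OF \<phi>])
      then show "AE x in lborel. indicator B3 x *\<^sub>R (pderiv_at \<phi> (axis j 1) x *\<^sub>R v x) = pderiv_at \<phi> (axis j 1) x *\<^sub>R v x"
        by simp
    qed simp
    moreover have "(LINT x:B3|lebesgue. \<phi> x *\<^sub>R d j x) = (LINT x|lborel. \<phi> x *\<^sub>R d j x)"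
    proof (rule set_integral_lebesgue_eq(1))
      have "indicator B3 x *\<^sub>R (\<phi> x *\<^sub>R d j x) = \<phi> x *\<^sub>R d j x" for x
        by (cases "x \<in> B3") (simp_all add: test_function_eq_0_outside[OF \<phi>])
      then show "AE x in lborel. indicator B3 x *\<^sub>R (\<phi> x *\<^sub>R d j x) = \<phi> x *\<^sub>R d j x" by simp
    qed simp
    ultimately show "(LINT x:B3|lebesgue. pderiv_at \<phi> (axis j 1) x *\<^sub>R v x) = - (LINT x:B3|lebesgue. \<phi> x *\<^sub>R d j x)"
      using v(4)[OF \<phi>, of j] by (simp add: d_def)
  qed
  have vL: "L2_on B3 v"
  proof (rule L2_on_bounded_by[OF v(1) Bb ind1])
    show "AE x in lborel. x \<in> B3 \<longrightarrow> (norm (v x))\<^sup>2 \<le> indicator B3 x"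
      using power_mono[OF v(2) norm_ge_zero, of _ 2] by (intro AE_I2) simp
  qed
  have dL: "L2_on B3 (d j)" for j
  proof (rule L2_on_bounded_by[OF dm Bb])
    show "integrable lborel (\<lambda>x. (norm (M x))\<^sup>2 + (norm (e x))\<^sup>2)" using M2 e(4) by simp
    show "AE x in lborel. x \<in> B3 \<longrightarrow> (norm (d j x))\<^sup>2 \<le> (norm (M x))\<^sup>2 + (norm (e x))\<^sup>2"
      using dle[of j]
    proof eventually_elim
      case (elim x)
      have "(norm (d j x))\<^sup>2 \<le> ((1/2) * norm (M x) + (1/2) * norm (e x))\<^sup>2"
        using elim by (rule power_mono) simp
      also have "\<dots> = (1/4) * ((norm (M x))\<^sup>2 + 2 * norm (M x) * norm (e x) + (norm (e x))\<^sup>2)"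
        by (simp add: power2_eq_square algebra_simps)
      also have "\<dots> \<le> (norm (M x))\<^sup>2 + (norm (e x))\<^sup>2"
        using sum_squares_bound[of "norm (M x)" "norm (e x)"] zero_le_power2[of "norm (M x)"] zero_le_power2[of "norm (e x)"]
        unfolding ring_distribs by linarith
      finally show ?case by simp
    qed
  qed
  have "W12 B3 v"
    unfolding W12_def
  proof (intro conjI vL ballI)
    fix b :: "real^3" assume "b \<in> Basis"
    then obtain j where "b = axis j 1" by (auto simp: Basis_real_vec)
    then show "\<exists>d. has_weak_pderiv B3 b v d \<and> L2_on B3 d" using wv dL by blast
  qed
  moreover have "AE x in lebesgue. x \<in> B3 \<longrightarrow> v x \<in> sphere 0 1"
    unfolding AE_completion_iff using v(3) by eventually_elim simp
  moreover have "AE x in lebesgue. x \<in> B3 \<longrightarrow> u x = CR_to_R3 (hopf (v x))"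
    unfolding AE_completion_iff using v(3) w(2)
  proof eventually_elim
    case (elim x)
    then show ?case by (auto simp: hopf3_def)
  qed
  ultimately show ?thesis unfolding W12_sphere_def by blast
qed

end
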